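(* Let $A$ be a (not necessarily unital) dg algebra over $\boldsymbol{k}$ whose $\mathbb{Z}/2$-grading lifts to a $\mathbb{Z}$-grading $\deg$ making it a differential $\mathbb{Z}$-graded algebra (with differential of degree $1$). Then the $u$-connections $$\nabla=\frac{d}{du}+\frac{\mathscr{U}(\delta)}{u^2}+\frac{\mathscr{V}(\delta)+\Gamma}{u}\qquad\text{and}\qquad \nabla_{gr}=\frac{d}{du}+\frac{\Gamma'}{2u}$$ on $(\mathsf{C}^e(A),b^e,B^e)$ are equal up to a $u$-homotopy. Here $\Gamma_{n+1}=-\frac n2\,\mathrm{id}_{n+1}$, $\Gamma'(a_0[a_1|\dots|a_n])=\left(\sum_{i=0}^n\deg(a_i)-n\right)a_0[a_1|\dots|a_n]$ (with $\deg(e)=0$), and $$\mathscr{U}(\delta)_{n+1}=\tfrac12\begin{pmatrix}-\mu^{(0)}_{n+1}\delta^{(1)}_{n+1}&-\mu^{(0)}_{n+1}\delta^{(1)}_{n+1}\\ 0&0\end{pmatrix},\quad \mathscr{V}(\delta)_{n+1}=\tfrac12\begin{pmatrix}0&0\\ -h^e_{n+1}\sum_{i=1}^n\sum_{j=i+1}^{n+1}\tau^j_{n+1}\delta^{(i)}_{n+1}&0\end{pmatrix}$$ (both zero for $n=0$).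
   Context: $\boldsymbol{k}$ is a field of characteristic $\ne2$; dg algebras are $\mathbb{Z}/2$-graded with odd differential $d$. A mixed complex $(\mathsf{C},b,B)$ is a $\mathbb{Z}/2$-graded space with odd operators satisfying $b^2=B^2=bB+Bb=0$. A $u$-connection on it is an (even) operator $\nabla=\frac{d}{du}+\mathscr{A}(u)$ on $\mathsf{C}((u))$ (formal Laurent series in an even variable $u$), with $\mathscr{A}(u)$ $\boldsymbol{k}((u))$-linear, such that $[\nabla,b+uB]=\frac1{2u}(b+uB)$. Two $u$-connections on the same mixed complex are equal up to a $u$-homotopy if their difference has the form $(b+uB)H(u)+H(u)(b+uB)$ for some odd $\boldsymbol{k}((u))$-linear operator $H(u)$ on $\mathsf{C}((u))$. $|a|$ is the parity, $sA$ is $A$ with reversed grading, $|sa|=|a|-1$. $\mathsf{C}(A)=\bigoplus_{n\ge0}A\otimes sA^{\otimes n}$ with elements $a_0[a_1|\dots|a_n]$; $A^e=A\oplus\boldsymbol{k}e$ with $|e|=0$, $de=0$, $ae=ea=a$, $e^2=e$; $\mathsf{C}^+(A)=\bigoplus_{n\ge1}\boldsymbol{k}e\otimes sA^{\otimes n}$; $\mathsf{C}^e(A)=\mathsf{C}(A)\oplus\mathsf{C}^+(A)$. Operators on $\mathsf{C}^e(A)$ are written as $2\times2$ matrices with respect to this decomposition (columns: domain $\mathsf{C}(A)$, $\mathsf{C}^+(A)$). $T_{n+1}$ denotes the restriction of $T$ to $(A\otimes sA^{\otimes n})\oplus(\boldsymbol{k}e\otimes sA^{\otimes n})$ (for $n=0$: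 to $A$). On $\mathsf{C}^e(A)$ (with $a_0=e$ allowed): $\delta^{(i)}_{n+1}(a_0[a_1|\dots|a_n])=(-1)^{\sum_{k=0}^{i-1}|sa_k|}a_0[\dots|da_i|\dots|a_n]$, $0\le i\le n$; for $n\ge1$, $\mu^{(i)}_{n+1}(a_0[a_1|\dots|a_n])=(-1)^{\sum_{k=0}^{i}|sa_k|+1}a_0[\dots|a_ia_{i+1}|\dots|a_n]$ for $0\le i<n$ (for $i=0$: $(-1)^{|a_0|}a_0a_1[a_2|\dots|a_n]$), $\mu^{(n)}_{n+1}(a_0[a_1|\dots|a_n])=-(-1)^{|sa_n|(|a_0|+\sum_{k=1}^{n-1}|sa_k|)}a_na_0[a_1|\dots|a_{n-1}]$; $\mu^{(0)}_1=0$; $b^e_{n+1}=\sum_{i=0}^n\delta^{(i)}_{n+1}+\sum_{i=0}^n\mu^{(i)}_{n+1}$. On $\mathsf{C}(A)$: $\tau_{n+1}(a_0[a_1|\dots|a_n])=(-1)^{|sa_0|\sum_{i=1}^n|sa_i|}a_1[a_2|\dots|a_n|a_0]$, $N_{n+1}=\sum_{i=0}^n\tau_{n+1}^i$; $h^e:\mathsf{C}(A)\to\mathsf{C}^+(A)$, $h^e(a_0[a_1|\dots|a_n])=e[a_0|a_1|\dots|a_n]$; $B^e=\begin{pmatrix}0&0\\ h^e N&0\end{pmatrix}$. *)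

theory Defs
  imports
    "HOL-Library.Z2"
    "HOL-Library.Function_Algebras"
    "HOL-Library.Product_Plus"
    "HOL-Computational_Algebra.Formal_Laurent_Series"
begin

section \<open>Graded vector spaces and dg algebras\<close>

text \<open>Parities are elements of the two-element field \<open>bit\<close>; \<open>ksign p\<close> is $(-1)^p$.\<close>

definition ksign :: "bit \<Rightarrow> 'k::field" where
  "ksign p = (if p = 0 then 1 else - 1)"

definition is_decomp :: "('i \<Rightarrow> 'v::ab_group_add set) \<Rightarrow> 'v \<Rightarrow> ('i \<Rightarrow> 'v) \<Rightarrow> bool" where
  "is_decomp G x c \<longleftrightarrow>
     finite {i. c i \<noteq> 0} \<and> (\<forall>i. c i \<in> G i) \<and> x = (\<Sum>i | c i \<noteq> 0. c i)"

text \<open>\<open>is_grading s V G\<close>: the subspace \<open>V\<close> is the (internal) direct sum of the subspaces \<open>G i\<close>.\<close>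

definition is_grading ::
  "('k::field \<Rightarrow> 'v::ab_group_add \<Rightarrow> 'v) \<Rightarrow> 'v set \<Rightarrow> ('i \<Rightarrow> 'v set) \<Rightarrow> bool" where
  "is_grading s V G \<longleftrightarrow>
     module.subspace s V \<and> (\<forall>i. module.subspace s (G i) \<and> G i \<subseteq> V) \<and>
     (\<forall>x\<in>V. \<exists>!c. is_decomp G x c)"

definition gcomp :: "('i \<Rightarrow> 'v::ab_group_add set) \<Rightarrow> 'v \<Rightarrow> 'i \<Rightarrow> 'v" where
  "gcomp G x = (THE c. is_decomp G x c)"

text \<open>An operator of parity \<open>q\<close>.\<close>

definition has_parity :: "(bit \<Rightarrow> 'v set) \<Rightarrow> bit \<Rightarrow> ('v \<Rightarrow> 'v) \<Rightarrow> bool" where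
  "has_parity G q T \<longleftrightarrow> (\<forall>p. \<forall>x\<in>G p. T x \<in> G (p + q))"

text \<open>The underlying (not necessarily unital) ring of a dg algebra is a type of class \<open>ring\<close>; the
  remaining data are the scalar multiplication, the differential and the even and odd parts.\<close>

record ('a, 'k) dga_data =
  smul :: "'k \<Rightarrow> 'a \<Rightarrow> 'a"
  dif :: "'a \<Rightarrow> 'a"
  par :: "bit \<Rightarrow> 'a set"

definition dg_algebra :: "('a::ring, 'k::field) dga_data \<Rightarrow> bool" where
  "dg_algebra A \<longleftrightarrow>
     vector_space (smul A) \<and>
     (\<forall>c x y. smul A c (x * y) = smul A c x * y \<and> smul A c (x * y) = x * smul A c y) \<and>
     is_grading (smul A) UNIV (par A) \<and>
     (\<forall>p q. \<forall>x\<in>par A p. \<forall>y\<in>par A q. x * y \<in> par A (p + q)) \<and>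
     Vector_Spaces.linear (smul A) (smul A) (dif A) \<and>
     has_parity (par A) 1 (dif A) \<and>
     (\<forall>x. dif A (dif A x) = 0) \<and>
     (\<forall>p. \<forall>x\<in>par A p. \<forall>y. dif A (x * y) = dif A x * y + smul A (ksign p) (x * dif A y))"

text \<open>\<open>D i\<close> is the space of elements with \<open>deg = i\<close>. The Leibniz rule of the lifted structure is the
  one of \<open>A\<close>, since its signs depend only on parities.\<close>

definition Z_grading_lift :: "('a::ring, 'k::field) dga_data \<Rightarrow> (int \<Rightarrow> 'a set) \<Rightarrow> bool" where
  "Z_grading_lift A D \<longleftrightarrow>
     is_grading (smul A) UNIV D \<and>
     (\<forall>i. D i \<subseteq> par A (of_int i)) \<and>
     (\<forall>i j. \<forall>x\<in>D i. \<forall>y\<in>D j. x * y \<in> D (i + j)) \<and>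
     (\<forall>i. \<forall>x\<in>D i. dif A x \<in> D (i + 1))"

subsection \<open>The algebra obtained by adjoining \<open>e\<close>\<close>

text \<open>The pair \<open>(a, x)\<close> stands for $a + x e$.\<close>

definition ext_smul :: "('a::ring, 'k::field) dga_data \<Rightarrow> 'k \<Rightarrow> 'a \<times> 'k \<Rightarrow> 'a \<times> 'k" where
  "ext_smul A c x = (smul A c (fst x), c * snd x)"

definition ext_mult :: "('a::ring, 'k::field) dga_data \<Rightarrow> 'a \<times> 'k \<Rightarrow> 'a \<times> 'k \<Rightarrow> 'a \<times> 'k" where
  "ext_mult A x y =
     (fst x * fst y + smul A (snd y) (fst x) + smul A (snd x) (fst y), snd x * snd y)"

definition ext_dif :: "('a::ring, 'k::field) dga_data \<Rightarrow> 'a \<times> 'k \<Rightarrow> 'a \<times> 'k" where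
  "ext_dif A x = (dif A (fst x), 0)"

definition ext_gr :: "('i::zero \<Rightarrow> 'a set) \<Rightarrow> 'i \<Rightarrow> ('a \<times> 'k::zero) set" where
  "ext_gr G i = G i \<times> (if i = 0 then UNIV else {0})"

definition emb :: "'a \<Rightarrow> 'a \<times> 'k::zero" where
  "emb a = (a, 0)"

definition ee :: "'a::zero \<times> 'k::{zero,one}" where
  "ee = (0, 1)"

section \<open>Tensor products\<close>

text \<open>\<open>multilin s t \<phi>\<close>: on words of each fixed length, \<open>\<phi>\<close> is linear in every letter.\<close>

definition multilin ::
  "('k::field \<Rightarrow> 'v::ab_group_add \<Rightarrow> 'v) \<Rightarrow> ('k \<Rightarrow> 'w::ab_group_add \<Rightarrow> 'w) \<Rightarrow> ('v list \<Rightarrow> 'w) \<Rightarrow> bool"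
  where
  "multilin s t \<phi> \<longleftrightarrow> (\<forall>xs ys. Vector_Spaces.linear s t (\<lambda>x. \<phi> (xs @ x # ys)))"

text \<open>Over a field, $v_0\otimes\dots\otimes v_n$ is determined by the values of all multilinear forms at
  $(v_0,\dots,v_n)$. The direct sum of all tensor powers of \<open>(V, s)\<close> is therefore realized as the span
  of the functionals \<open>tensor s w\<close> on multilinear forms, for words \<open>w\<close> in \<open>V\<close>; its universal property
  is \<open>tensor_universal\<close> below.\<close>

type_synonym ('v, 'k) tens = "('v list \<Rightarrow> 'k) \<Rightarrow> 'k"

definition tscale :: "'k::field \<Rightarrow> ('v, 'k) tens \<Rightarrow> ('v, 'k) tens" where
  "tscale c x = (\<lambda>f. c * x f)"

definition tensor :: "('k::field \<Rightarrow> 'v::ab_group_add \<Rightarrow> 'v) \<Rightarrow> 'v list \<Rightarrow> ('v, 'k) tens" where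
  "tensor s w = (\<lambda>f. if multilin s (*) f then f w else 0)"

text \<open>The linear map with \<open>tensor s w \<mapsto> F w\<close>, for \<open>F\<close> multilinear with values in tensors; see
  \<open>lin_ext_tensor\<close>.\<close>

definition lin_ext :: "('v list \<Rightarrow> ('v, 'k) tens) \<Rightarrow> ('v, 'k) tens \<Rightarrow> ('v, 'k) tens" where
  "lin_ext F x = (\<lambda>f. x (\<lambda>w. F w f))"

text \<open>The linear map with \<open>tensor s w \<mapsto> F ds w\<close> for words \<open>w\<close> of homogeneous letters of degrees
  \<open>ds\<close>; see \<open>hom_ext_tensor\<close>. A general word is split into its homogeneous components.\<close>

definition hom_ext ::
  "('i \<Rightarrow> 'v::ab_group_add set) \<Rightarrow> ('i list \<Rightarrow> 'v list \<Rightarrow> ('v, 'k::field) tens) \<Rightarrow>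
   ('v, 'k) tens \<Rightarrow> ('v, 'k) tens" where
  "hom_ext G F = lin_ext (\<lambda>w.
     \<Sum>ds | length ds = length w \<and> (\<forall>k<length w. gcomp G (w ! k) (ds ! k) \<noteq> 0).
       F ds (map2 (gcomp G) w ds))"

lemma vector_space_tscale: "vector_space (tscale :: 'k::field \<Rightarrow> ('v, 'k) tens \<Rightarrow> _)"
  by unfold_locales (auto simp: tscale_def fun_eq_iff algebra_simps)

lemma vector_space_times: "vector_space ((*) :: 'k::field \<Rightarrow> 'k \<Rightarrow> 'k)"
  by unfold_locales (auto simp: algebra_simps)

lemma linear_iff':
  "Vector_Spaces.linear s t f \<longleftrightarrow> vector_space s \<and> vector_space t \<and>
     (\<forall>x y. f (x + y) = f x + f y) \<and> (\<forall>c x. f (s c x) = t c (f x))"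
  unfolding Vector_Spaces.linear_def module_hom_def module_hom_axioms_def
  by (auto simp: vector_space_def module_def)

lemma multilin_tensor:
  assumes "vector_space s"
  shows "multilin s tscale (tensor s)"
  using assms vector_space_tscale
  unfolding multilin_def linear_iff'
  by (auto simp: tensor_def tscale_def fun_eq_iff multilin_def linear_iff')

lemma tensor_universal:
  assumes s: "vector_space s" and t: "vector_space t" and \<phi>: "multilin s t \<phi>"
  shows "\<exists>T. Vector_Spaces.linear tscale t T \<and> (\<forall>w. T (tensor s w) = \<phi> w)"
proof -
  interpret TS: vector_space tscale by (rule vector_space_tscale)
  interpret W: vector_space t by fact
  interpret K: vector_space "(*) :: 'a \<Rightarrow> 'a \<Rightarrow> 'a" by (rule vector_space_times)
  interpret TW: vector_space_pair tscale t by unfold_locales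
  interpret WK: vector_space_pair t "(*) :: 'a \<Rightarrow> 'a \<Rightarrow> 'a" by unfold_locales
  interpret TK: vector_space_pair tscale "(*) :: 'a \<Rightarrow> 'a \<Rightarrow> 'a" by unfold_locales
  obtain B where B: "B \<subseteq> range (tensor s)" "TS.independent B" "range (tensor s) \<subseteq> TS.span B"
    using TS.maximal_independent_subset[of "range (tensor s)"] by blast
  define wd where "wd b = (SOME w. tensor s w = b)" for b
  have wd: "tensor s (wd b) = b" if "b \<in> B" for b
    unfolding wd_def using B(1) that by (metis (mono_tags, lifting) imageE someI_ex subsetD)
  obtain g where g: "Vector_Spaces.linear tscale t g" "\<And>b. b \<in> B \<Longrightarrow> g b = \<phi> (wd b)"
    using TW.linear_independent_extend[OF B(2), of "\<lambda>b. \<phi> (wd b)"] by blast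
  have "g (tensor s w) = \<phi> w" for w
  proof (rule ccontr)
    let ?v = "g (tensor s w) - \<phi> w"
    assume "g (tensor s w) \<noteq> \<phi> w"
    then have "W.independent {?v}" by simp
    from WK.linear_independent_extend[OF this, of "\<lambda>_. 1"]
    obtain l where l: "Vector_Spaces.linear t (*) l" "l ?v = (1::'a)" by auto
    let ?f = "\<lambda>w. l (\<phi> w)"
    have f: "multilin s (*) ?f"
      using \<phi> l(1) unfolding multilin_def linear_iff' by auto
    have "l (g (tensor s w)) = tensor s w ?f"
    proof (rule TK.linear_eq_on_span[where B = B and f = "\<lambda>x. l (g x)" and g = "\<lambda>x. x ?f"])
      show "Vector_Spaces.linear tscale (*) (\<lambda>x. l (g x))"
        using g(1) l(1) unfolding linear_iff' by auto
      show "Vector_Spaces.linear tscale (*) (\<lambda>x. x ?f)"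
        unfolding linear_iff' using TS.vector_space_axioms K.vector_space_axioms
        by (auto simp: tscale_def)
      show "l (g b) = b ?f" if "b \<in> B" for b
      proof -
        have "b ?f = tensor s (wd b) ?f" using wd[OF that] by simp
        then show ?thesis using f g(2)[OF that] by (simp add: tensor_def)
      qed
      show "tensor s w \<in> TS.span B" using B(3) by auto
    qed
    then have "l (g (tensor s w)) = l (\<phi> w)" using f by (simp add: tensor_def)
    moreover have "l ?v = l (g (tensor s w)) - l (\<phi> w)"
    proof -
      have "l (?v + \<phi> w) = l ?v + l (\<phi> w)" using l(1) unfolding linear_iff' by blast
      then show ?thesis by simp
    qed
    ultimately show False using l(2) by simp
  qed
  then show ?thesis using g(1) by blast
qed

lemma tensor_span_eq_0:
  assumes "x \<in> module.span tscale (range (tensor s))" and "\<not> multilin s (*) f"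
  shows "x f = 0"
proof -
  interpret TS: vector_space tscale by (rule vector_space_tscale)
  show ?thesis
    using assms(1)
    by (induction rule: TS.span_induct_alt) (use assms(2) in \<open>auto simp: tensor_def tscale_def\<close>)
qed

lemma lin_ext_tensor:
  assumes F: "multilin s tscale F" "\<And>w. F w \<in> module.span tscale (range (tensor s))"
  shows "lin_ext F (tensor s w) = F w"
proof (rule ext)
  fix f
  show "lin_ext F (tensor s w) f = F w f"
  proof (cases "multilin s (*) f")
    case True
    have "multilin s (*) (\<lambda>w. F w f)"
      using F(1) vector_space_times unfolding multilin_def linear_iff' by (auto simp: tscale_def)
    then show ?thesis by (simp add: lin_ext_def tensor_def)
  next
    case False
    then have "F v f = 0" for v using tensor_span_eq_0[OF F(2)] by blast
    then show ?thesis by (simp add: lin_ext_def tensor_def)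
  qed
qed

lemma
  assumes s: "vector_space s" and G: "is_grading s UNIV G"
  shows gcomp_decomp: "is_decomp G x (gcomp G x)"
    and gcomp_unique: "is_decomp G x c \<Longrightarrow> gcomp G x = c"
    and gcomp_add: "gcomp G (x + y) i = gcomp G x i + gcomp G y i"
    and gcomp_scale: "gcomp G (s a x) i = s a (gcomp G x i)"
    and gcomp_homogeneous: "x \<in> G j \<Longrightarrow> gcomp G x i = (if i = j then x else 0)"
proof -
  interpret S: vector_space s by fact
  have ex: "\<exists>!c. is_decomp G x c" for x using G unfolding is_grading_def by blast
  show d: "is_decomp G x (gcomp G x)" for x unfolding gcomp_def by (rule theI'[OF ex])
  show u: "gcomp G x = c" if "is_decomp G x c" for x c using ex d that by blast
  have sub: "S.subspace (G i)" for i using G unfolding is_grading_def by blast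
  have "is_decomp G (x + y) (\<lambda>i. gcomp G x i + gcomp G y i)"
  proof -
    let ?a = "gcomp G x" and ?b = "gcomp G y"
    let ?T = "{i. ?a i \<noteq> 0} \<union> {i. ?b i \<noteq> 0}"
    have fin: "finite ?T" using d unfolding is_decomp_def by blast
    have *: "(\<Sum>i | c i \<noteq> 0. c i) = sum c ?T" if "{i. c i \<noteq> 0} \<subseteq> ?T" for c :: "_ \<Rightarrow> 'b"
      using that fin by (intro sum.mono_neutral_left) auto
    have "x = sum ?a ?T" "y = sum ?b ?T"
      using d[of x] d[of y] *[of ?a] *[of ?b] unfolding is_decomp_def by auto
    moreover have "(\<Sum>i | ?a i + ?b i \<noteq> 0. ?a i + ?b i) = (\<Sum>i\<in>?T. ?a i + ?b i)"
      by (rule *) auto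
    moreover have "finite {i. ?a i + ?b i \<noteq> 0}"
      by (rule finite_subset[OF _ fin]) auto
    ultimately show ?thesis
      using d[of x] d[of y] sub unfolding is_decomp_def
      by (auto simp: sum.distrib S.subspace_add)
  qed
  from u[OF this] show "gcomp G (x + y) i = gcomp G x i + gcomp G y i" by simp
  have "is_decomp G (s a x) (\<lambda>i. s a (gcomp G x i))"
  proof (cases "a = 0")
    case True
    then show ?thesis using sub by (simp add: is_decomp_def S.subspace_0)
  next
    case False
    have "x = (\<Sum>i | gcomp G x i \<noteq> 0. gcomp G x i)"
      using d[of x] unfolding is_decomp_def by blast
    then have "s a x = (\<Sum>i | gcomp G x i \<noteq> 0. s a (gcomp G x i))"
      by (metis S.scale_sum_right)
    then show ?thesis
      using d[of x] sub False by (simp add: is_decomp_def S.subspace_scale)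
  qed
  from u[OF this] show "gcomp G (s a x) i = s a (gcomp G x i)" by simp
  show "gcomp G x i = (if i = j then x else 0)" if "x \<in> G j"
  proof -
    have "is_decomp G x (\<lambda>i. if i = j then x else 0)"
    proof (cases "x = 0")
      case True
      then show ?thesis using sub by (simp add: is_decomp_def S.subspace_0 cong: if_cong)
    next
      case False
      then have "{i. (if i = j then x else 0) \<noteq> 0} = {j}" by auto
      then show ?thesis using that sub by (auto simp: is_decomp_def S.subspace_0)
    qed
    from u[OF this] show ?thesis by simp
  qed
qed

lemma multilin_zero_letter:
  assumes "multilin s t F" and "k < length w" and "w ! k = 0"
  shows "F w = 0"
proof -
  have w: "w = take k w @ 0 # drop (Suc k) w"
    using assms(2,3) by (metis id_take_nth_drop)
  have "Vector_Spaces.linear s t (\<lambda>x. F (take k w @ x # drop (Suc k) w))"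
    using assms(1) unfolding multilin_def by blast
  then have "F (take k w @ (0 + 0) # drop (Suc k) w) =
      F (take k w @ 0 # drop (Suc k) w) + F (take k w @ 0 # drop (Suc k) w)"
    unfolding linear_iff' by blast
  then have "F (take k w @ 0 # drop (Suc k) w) = 0" by simp
  then show ?thesis by (subst w)
qed

lemma hom_ext_tensor:
  fixes G :: "'i \<Rightarrow> 'v::ab_group_add set" and F :: "'i list \<Rightarrow> 'v list \<Rightarrow> ('v, 'k::field) tens"
  assumes s: "vector_space s" and G: "is_grading s UNIV G"
    and F: "\<And>ds. multilin s tscale (\<lambda>w. if length w = length ds then F ds w else 0)"
    and F_span: "\<And>ds w. F ds w \<in> module.span tscale (range (tensor s))"
    and ds: "length ds = length w" "\<And>k. k < length w \<Longrightarrow> w ! k \<in> G (ds ! k)"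
  shows "hom_ext G F (tensor s w) = F ds w"
proof -
  interpret TS: vector_space tscale by (rule vector_space_tscale)
  note gc = gcomp_decomp[OF s G] gcomp_add[OF s G] gcomp_scale[OF s G]
  define S where
    "S w = {ds. length ds = length w \<and> (\<forall>k<length w. gcomp G (w ! k) (ds ! k) \<noteq> 0)}" for w
  define E where
    "E ds w = (if length w = length ds then F ds (map2 (gcomp G) w ds) else 0)" for ds w
  define K where "K w = (\<Sum>ds\<in>S w. F ds (map2 (gcomp G) w ds))" for w
  have finS: "finite (S w)" for w
  proof (rule finite_subset)
    let ?U = "\<Union>x\<in>set w. {i. gcomp G x i \<noteq> 0}"
    show "S w \<subseteq> {ds. set ds \<subseteq> ?U \<and> length ds = length w}"
      unfolding S_def by (fastforce simp: in_set_conv_nth)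
    have "finite ?U" using gc(1) unfolding is_decomp_def by blast
    then show "finite {ds. set ds \<subseteq> ?U \<and> length ds = length w}"
      by (rule finite_lists_length_eq)
  qed
  have E_out: "E ds w = 0" if "ds \<notin> S w" for ds w
  proof (cases "length ds = length w")
    case True
    from that True have "\<exists>k<length w. gcomp G (w ! k) (ds ! k) = 0"
      by (simp add: S_def)
    then obtain k where k: "k < length w" "gcomp G (w ! k) (ds ! k) = 0"
      by blast
    have "(\<lambda>w. if length w = length ds then F ds w else 0) (map2 (gcomp G) w ds) = 0"
      using multilin_zero_letter[OF F[of ds], of k "map2 (gcomp G) w ds"] True k by simp
    then show ?thesis using True by (simp add: E_def)
  qed (simp add: E_def)
  have K_E: "K w = (\<Sum>ds\<in>T. E ds w)" if "finite T" "S w \<subseteq> T" for w T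
  proof -
    have "K w = (\<Sum>ds\<in>S w. E ds w)"
      unfolding K_def by (rule sum.cong) (auto simp: E_def S_def)
    also have "\<dots> = (\<Sum>ds\<in>T. E ds w)"
      using that E_out by (intro sum.mono_neutral_left) auto
    finally show ?thesis .
  qed
  have E_slot: "\<exists>xs' ys' d. \<forall>x. E ds (xs @ x # ys) =
      (if length (xs' @ gcomp G x d # ys') = length ds then F ds (xs' @ gcomp G x d # ys') else 0) \<or>
      (\<forall>x. E ds (xs @ x # ys) = 0)" for ds xs ys
  proof (cases "length ds = length xs + Suc (length ys)")
    case True
    then obtain d1 d d2 where "ds = d1 @ d # d2" "length d1 = length xs" "length d2 = length ys"
      using that[of "take (length xs) ds" "ds ! length xs" "drop (Suc (length xs)) ds"]
      by (simp add: id_take_nth_drop[symmetric])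
    then have "\<forall>x. E ds (xs @ x # ys) =
      (if length (map2 (gcomp G) xs d1 @ gcomp G x d # map2 (gcomp G) ys d2) = length ds
       then F ds (map2 (gcomp G) xs d1 @ gcomp G x d # map2 (gcomp G) ys d2) else 0)"
      by (simp add: E_def)
    then show ?thesis by blast
  qed (auto simp: E_def)
  have E_lin: "E ds (xs @ (x + y) # ys) = E ds (xs @ x # ys) + E ds (xs @ y # ys)"
    "E ds (xs @ s c x # ys) = tscale c (E ds (xs @ x # ys))" for ds xs ys x y c
  proof -
    obtain xs' ys' d where *: "\<forall>x. E ds (xs @ x # ys) =
      (if length (xs' @ gcomp G x d # ys') = length ds then F ds (xs' @ gcomp G x d # ys') else 0) \<or>
      (\<forall>x. E ds (xs @ x # ys) = 0)" using E_slot[of ds xs ys] by blast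
    define L where
      "L z = (if length (xs' @ z # ys') = length ds then F ds (xs' @ z # ys') else 0)" for z
    have "Vector_Spaces.linear s tscale L"
      using F[of ds] unfolding multilin_def L_def by blast
    then have L: "L (gcomp G (x + y) d) = L (gcomp G x d) + L (gcomp G y d)"
      "L (gcomp G (s c x) d) = tscale c (L (gcomp G x d))"
      unfolding linear_iff' gc(2,3) by blast+
    consider (1) "\<And>x. E ds (xs @ x # ys) = L (gcomp G x d)" | (2) "\<And>x. E ds (xs @ x # ys) = 0"
      using * unfolding L_def by blast
    then have "E ds (xs @ (x + y) # ys) = E ds (xs @ x # ys) + E ds (xs @ y # ys) \<and>
        E ds (xs @ s c x # ys) = tscale c (E ds (xs @ x # ys))"
      by cases (simp_all only: L add_0 TS.scale_zero_right simp_thms)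
    then show "E ds (xs @ (x + y) # ys) = E ds (xs @ x # ys) + E ds (xs @ y # ys)"
      "E ds (xs @ s c x # ys) = tscale c (E ds (xs @ x # ys))"
      by blast+
  qed
  have K_multilin: "multilin s tscale K"
    unfolding multilin_def linear_iff'
  proof (intro allI conjI s vector_space_tscale)
    fix xs ys x y
    let ?T = "S (xs @ (x + y) # ys) \<union> S (xs @ x # ys) \<union> S (xs @ y # ys)"
    have "finite ?T" using finS by simp
    note K = K_E[OF this]
    show "K (xs @ (x + y) # ys) = K (xs @ x # ys) + K (xs @ y # ys)"
      by (subst (1 2 3) K) (auto simp: E_lin sum.distrib)
  next
    fix xs ys c x
    let ?T = "S (xs @ s c x # ys) \<union> S (xs @ x # ys)"
    have "finite ?T" using finS by simp
    note K = K_E[OF this]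
    show "K (xs @ s c x # ys) = tscale c (K (xs @ x # ys))"
      by (subst (1 2) K) (auto simp: E_lin TS.scale_sum_right)
  qed
  have "hom_ext G F (tensor s w) = K w"
    unfolding hom_ext_def S_def[symmetric] K_def[symmetric]
    by (rule lin_ext_tensor[OF K_multilin]) (auto simp: K_def intro: TS.span_sum F_span)
  also have "\<dots> = F ds w"
  proof -
    have comp: "gcomp G (w ! k) i = (if i = ds ! k then w ! k else 0)" if "k < length w" for k i
      by (rule gcomp_homogeneous[OF s G ds(2)[OF that]])
    then have "S w \<subseteq> {ds}"
      using ds(1) by (auto simp: S_def list_eq_iff_nth_eq split: if_splits)
    then have "K w = E ds w" using K_E[of "{ds}" w] by simp
    moreover have "map2 (gcomp G) w ds = w"
      using ds(1) comp by (auto simp: list_eq_iff_nth_eq)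
    ultimately show ?thesis using ds(1) by (simp add: E_def)
  qed
  finally show ?thesis .
qed

lemma vs_ext: "dg_algebra A \<Longrightarrow> vector_space (ext_smul A)"
proof -
  assume "dg_algebra A"
  then interpret vector_space "smul A" by (simp add: dg_algebra_def)
  show ?thesis
    by unfold_locales (auto simp: ext_smul_def algebra_simps scale_left_distrib scale_right_distrib prod_eq_iff)
qed

lemma gr_ext:
  fixes G :: "'i::zero \<Rightarrow> 'a::ring set" and A :: "('a,'k::field) dga_data"
  assumes A: "dg_algebra A" and G: "is_grading (smul A) UNIV G"
  shows "is_grading (ext_smul A) UNIV (ext_gr G)"
proof -
  interpret S: vector_space "smul A" using A by (simp add: dg_algebra_def)
  interpret E: vector_space "ext_smul A" using vs_ext[OF A] .
  have sub: "S.subspace (G i)" for i using G by (auto simp: is_grading_def)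
  have sube: "E.subspace (ext_gr G i)" for i
    using sub unfolding S.subspace_def E.subspace_def ext_gr_def ext_smul_def by (auto simp: zero_prod_def)
  have dec: "is_decomp (ext_gr G) x c \<longleftrightarrow> is_decomp G (fst x) (\<lambda>i. fst (c i)) \<and>
     (\<forall>i. snd (c i) = (if i = 0 then snd x else 0))" (is "?l = ?r") for x and c :: "'i \<Rightarrow> 'a \<times> 'k"
  proof
    assume l: ?l
    then have fin: "finite {i. c i \<noteq> 0}" and cG: "\<And>i. c i \<in> ext_gr G i" and x: "x = (\<Sum>i | c i \<noteq> 0. c i)"
      by (auto simp: is_decomp_def)
    have 1: "{i. fst (c i) \<noteq> 0} \<subseteq> {i. c i \<noteq> 0}" by (auto simp: zero_prod_def)
    have 2: "snd (c i) = 0" if "i \<noteq> 0" for i using cG[of i] that by (auto simp: ext_gr_def)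
    have fx: "fst x = (\<Sum>i | c i \<noteq> 0. fst (c i))" "snd x = (\<Sum>i | c i \<noteq> 0. snd (c i))"
      by (simp_all add: x fst_sum snd_sum)
    have "fst x = (\<Sum>i | fst (c i) \<noteq> 0. fst (c i))"
      unfolding fx(1) by (rule sum.mono_neutral_right[OF fin 1]) auto
    moreover have "snd x = snd (c 0)"
    proof -
      have "snd x = (\<Sum>i\<in>insert 0 {i. c i \<noteq> 0}. snd (c i))"
        unfolding fx(2) by (rule sum.mono_neutral_left) (use fin in \<open>auto simp: zero_prod_def\<close>)
      also have "\<dots> = (\<Sum>i\<in>{0}. snd (c i))"
        by (rule sum.mono_neutral_right) (use fin 2 in auto)
      finally show ?thesis by simp
    qed
    moreover have "fst (c i) \<in> G i" for i using cG[of i] by (auto simp: ext_gr_def)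
    ultimately show ?r using finite_subset[OF 1 fin] 2 by (auto simp: is_decomp_def)
  next
    assume r: ?r
    let ?S = "insert 0 {i. fst (c i) \<noteq> 0}"
    have fin: "finite ?S" using r by (auto simp: is_decomp_def)
    have 1: "{i. c i \<noteq> 0} \<subseteq> ?S" using r by (auto simp: zero_prod_def prod_eq_iff)
    have "(\<Sum>i | c i \<noteq> 0. c i) = (\<Sum>i\<in>?S. c i)"
      by (rule sum.mono_neutral_left[OF fin 1]) auto
    also have "\<dots> = x"
    proof (rule prod_eqI)
      have "fst (\<Sum>i\<in>?S. c i) = (\<Sum>i\<in>?S. fst (c i))" by (simp add: fst_sum)
      also have "\<dots> = (\<Sum>i | fst (c i) \<noteq> 0. fst (c i))"
        by (rule sum.mono_neutral_right[OF fin]) auto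
      finally show "fst (\<Sum>i\<in>?S. c i) = fst x" using r by (simp add: is_decomp_def)
      have "snd (\<Sum>i\<in>?S. c i) = (\<Sum>i\<in>?S. snd (c i))" by (simp add: snd_sum)
      also have "\<dots> = (\<Sum>i\<in>{0}. snd (c i))"
        by (rule sum.mono_neutral_right[OF fin]) (use r in auto)
      finally show "snd (\<Sum>i\<in>?S. c i) = snd x" using r by simp
    qed
    moreover have "c i \<in> ext_gr G i" for i
      using r by (auto simp: is_decomp_def ext_gr_def mem_Times_iff)
    ultimately show ?l using finite_subset[OF 1 fin] by (auto simp: is_decomp_def)
  qed
  have "\<exists>!c. is_decomp (ext_gr G) x c" for x :: "'a \<times> 'k"
  proof -
    obtain a where a: "is_decomp G (fst x) a" "\<And>b. is_decomp G (fst x) b \<Longrightarrow> b = a"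
      using G unfolding is_grading_def by blast
    show ?thesis
    proof (rule ex1I)
      show "is_decomp (ext_gr G) x (\<lambda>i. (a i, if i = 0 then snd x else 0))"
        unfolding dec using a(1) by simp
      fix c assume "is_decomp (ext_gr G) x c"
      then have c: "(\<lambda>i. fst (c i)) = a" "\<And>i. snd (c i) = (if i = 0 then snd x else 0)"
        unfolding dec using a(2) by blast+
      show "c = (\<lambda>i. (a i, if i = 0 then snd x else 0))"
        using fun_cong[OF c(1)] c(2) by (auto simp: fun_eq_iff prod_eq_iff)
    qed
  qed
  then show ?thesis using sube by (auto simp: is_grading_def)
qed

lemma multilin_tensor_word:
  assumes s: "vector_space s" and P: "\<And>xs ys. length xs + Suc (length ys) = m \<Longrightarrow>
     \<exists>us vs L. Vector_Spaces.linear s s L \<and> (\<forall>x. \<Psi> (xs @ x # ys) = us @ L x # vs)"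
  shows "multilin s tscale (\<lambda>w. if length w = m then tscale c (tensor s (\<Psi> w)) else 0)"
proof -
  interpret TS: vector_space tscale by (rule vector_space_tscale)
  show ?thesis unfolding multilin_def linear_iff'
  proof (intro allI conjI s vector_space_tscale)
    fix xs ys :: "'b list" and x y a
    let ?G = "\<lambda>w. if length w = m then tscale c (tensor s (\<Psi> w)) else 0"
    have "?G (xs @ (x + y) # ys) = ?G (xs @ x # ys) + ?G (xs @ y # ys) \<and>
       ?G (xs @ s a x # ys) = tscale a (?G (xs @ x # ys))"
    proof (cases "length xs + Suc (length ys) = m")
      case True
      obtain us vs L where L: "Vector_Spaces.linear s s L" "\<And>x. \<Psi> (xs @ x # ys) = us @ L x # vs"
        using P[OF True] by blast
      have "Vector_Spaces.linear s tscale (\<lambda>z. tensor s (us @ z # vs))"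
        using multilin_tensor[OF s] unfolding multilin_def by blast
      then show ?thesis using True L unfolding linear_iff'
        by (simp add: TS.scale_right_distrib TS.scale_left_commute)
    qed auto
    then show "?G (xs @ (x + y) # ys) = ?G (xs @ x # ys) + ?G (xs @ y # ys)"
       "?G (xs @ s a x # ys) = tscale a (?G (xs @ x # ys))" by blast+
  qed
qed

lemma vector_space_ext_props:
  assumes A: "dg_algebra A"
  shows "Vector_Spaces.linear (ext_smul A) (ext_smul A) (\<lambda>x. x)"
    "Vector_Spaces.linear (ext_smul A) (ext_smul A) (ext_dif A)"
    "Vector_Spaces.linear (ext_smul A) (ext_smul A) (ext_mult A x)"
    "Vector_Spaces.linear (ext_smul A) (ext_smul A) (\<lambda>y. ext_mult A y x)"
    "Vector_Spaces.linear (ext_smul A) (ext_smul A) (\<lambda>y. emb (fst y))"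
    "Vector_Spaces.linear (ext_smul A) (ext_smul A) (\<lambda>y. (0, snd y))"
proof -
  interpret S: vector_space "smul A" using A by (simp add: dg_algebra_def)
  have m: "smul A c x * y = smul A c (x * y)" "x * smul A c y = smul A c (x * y)" for c x y
    using A unfolding dg_algebra_def by metis+
  have d: "dif A (x + y) = dif A x + dif A y" "dif A (smul A c x) = smul A c (dif A x)" for x y c
    using A unfolding dg_algebra_def linear_iff' by blast+
  note simps = linear_iff' vs_ext[OF A] ext_smul_def ext_dif_def ext_mult_def emb_def prod_eq_iff
    m d algebra_simps S.scale_right_distrib S.scale_left_distrib
  show "Vector_Spaces.linear (ext_smul A) (ext_smul A) (\<lambda>x. x)" by (simp add: simps)
  show "Vector_Spaces.linear (ext_smul A) (ext_smul A) (ext_dif A)" by (simp add: simps)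
  show "Vector_Spaces.linear (ext_smul A) (ext_smul A) (ext_mult A x)" by (simp add: simps)
  show "Vector_Spaces.linear (ext_smul A) (ext_smul A) (\<lambda>y. ext_mult A y x)" by (simp add: simps)
  show "Vector_Spaces.linear (ext_smul A) (ext_smul A) (\<lambda>y. emb (fst y))" by (simp add: simps)
  show "Vector_Spaces.linear (ext_smul A) (ext_smul A) (\<lambda>y. (0, snd y))" by (simp add: simps)
qed

lemma multilin_zero: "vector_space s \<Longrightarrow> multilin s tscale (\<lambda>w. 0)"
proof -
  interpret TS: vector_space tscale by (rule vector_space_tscale)
  show "vector_space s \<Longrightarrow> multilin s tscale (\<lambda>w. 0)"
  by (simp add: multilin_def linear_iff' TS.vector_space_axioms)
qed

lemma tensor_in_span: "tscale c (tensor s w) \<in> module.span tscale (range (tensor s))"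
proof -
  interpret TS: vector_space tscale by (rule vector_space_tscale)
  show ?thesis by (intro TS.span_scale TS.span_base) simp
qed

lemma zero_in_span: "0 \<in> module.span tscale (range (tensor s))"
proof -
  interpret TS: vector_space tscale by (rule vector_space_tscale)
  show ?thesis by (rule TS.span_zero)
qed

section \<open>The extended Hochschild complex\<close>

text \<open>A word \<open>[a0, a1, \<dots>, an]\<close> of length \<open>n + 1\<close> in $A^e$ represents $a_0[a_1|\dots|a_n]$.\<close>

type_synonym ('a, 'k) chain = "('a \<times> 'k, 'k) tens"

abbreviation tns :: "('a::ring, 'k::field) dga_data \<Rightarrow> ('a \<times> 'k) list \<Rightarrow> ('a, 'k) chain" where
  "tns A \<equiv> tensor (ext_smul A)"

text \<open>\<open>w\<close> is a word of homogeneous letters of parities \<open>ps\<close>.\<close>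

definition homog :: "('a::ring, 'k::field) dga_data \<Rightarrow> bit list \<Rightarrow> ('a \<times> 'k) list \<Rightarrow> bool" where
  "homog A ps w \<longleftrightarrow> length ps = length w \<and> (\<forall>k<length w. w ! k \<in> ext_gr (par A) (ps ! k))"

definition A_words :: "('a \<times> 'k::field) list set" where
  "A_words = {map emb w |w. w \<noteq> []}"

definition e_words :: "('a::ring \<times> 'k::field) list set" where
  "e_words = {ee # map emb w |w. w \<noteq> []}"

text \<open>$\mathsf{C}(A)$, $\mathsf{C}^+(A)$ and $\mathsf{C}^e(A)$ (the sum is direct).\<close>

definition CA :: "('a::ring, 'k::field) dga_data \<Rightarrow> ('a, 'k) chain set" where
  "CA A = module.span tscale (tns A ` A_words)"

definition Cplus :: "('a::ring, 'k::field) dga_data \<Rightarrow> ('a, 'k) chain set" where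
  "Cplus A = module.span tscale (tns A ` e_words)"

definition Ce :: "('a::ring, 'k::field) dga_data \<Rightarrow> ('a, 'k) chain set" where
  "Ce A = {x + y |x y. x \<in> CA A \<and> y \<in> Cplus A}"

text \<open>The parity $|a_0|+\sum_{i=1}^n|sa_i|$ of $a_0[a_1|\dots|a_n]$ in terms of $|a_0|,\dots,|a_n|$.\<close>

definition word_par :: "bit list \<Rightarrow> bit" where
  "word_par ps = ps ! 0 + (\<Sum>i=1..length ps - 1. ps ! i - 1)"

definition Ce_par :: "('a::ring, 'k::field) dga_data \<Rightarrow> bit \<Rightarrow> ('a, 'k) chain set" where
  "Ce_par A p = module.span tscale
     {tns A w |w ps. w \<in> A_words \<union> e_words \<and> homog A ps w \<and> word_par ps = p}"

text \<open>The projections of $\mathsf{C}^e(A)$ onto $\mathsf{C}(A)$ and $\mathsf{C}^+(A)$, and the operator on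
  $\mathsf{C}^e(A)$ with a given $2\times 2$ matrix.\<close>

definition prC :: "('a::ring, 'k::field) dga_data \<Rightarrow> ('a, 'k) chain \<Rightarrow> ('a, 'k) chain" where
  "prC A = lin_ext (\<lambda>w. if w = [] then 0 else tns A (emb (fst (hd w)) # tl w))"

definition prplus :: "('a::ring, 'k::field) dga_data \<Rightarrow> ('a, 'k) chain \<Rightarrow> ('a, 'k) chain" where
  "prplus A = lin_ext (\<lambda>w. if w = [] then 0 else tns A ((0, snd (hd w)) # tl w))"

definition mat2 :: "('a::ring, 'k::field) dga_data \<Rightarrow>
    (('a, 'k) chain \<Rightarrow> ('a, 'k) chain) \<Rightarrow> (('a, 'k) chain \<Rightarrow> ('a, 'k) chain) \<Rightarrow>
    (('a, 'k) chain \<Rightarrow> ('a, 'k) chain) \<Rightarrow> (('a, 'k) chain \<Rightarrow> ('a, 'k) chain) \<Rightarrow>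
    ('a, 'k) chain \<Rightarrow> ('a, 'k) chain" where
  "mat2 A T11 T12 T21 T22 x =
     (T11 (prC A x) + T12 (prplus A x)) + (T21 (prC A x) + T22 (prplus A x))"

text \<open>In the following formulas \<open>ps\<close> is the list of the parities $|a_0|,\dots,|a_n|$ and
  $|sa_k|=|a_k|-1$. The operators \<open>\<delta>\<^sup>(\<^sup>i\<^sup>)\<close> and \<open>\<mu>\<^sup>(\<^sup>i\<^sup>)\<close> are extended by zero to words with \<open>n < i\<close>.\<close>

definition delta :: "('a::ring, 'k::field) dga_data \<Rightarrow> nat \<Rightarrow> ('a, 'k) chain \<Rightarrow> ('a, 'k) chain" where
  "delta A i = hom_ext (ext_gr (par A)) (\<lambda>ps w.
     if i < length w
     then tscale (ksign (\<Sum>k<i. ps ! k - 1)) (tns A (w[i := ext_dif A (w ! i)]))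
     else 0)"

lemma delta_tensor:
  assumes A: "dg_algebra A" and w: "homog A ps w" and i: "i < length w"
  shows "delta A i (tns A w) = tscale (ksign (\<Sum>k<i. ps ! k - 1)) (tns A (w[i := ext_dif A (w ! i)]))"
proof -
  note s = vs_ext[OF A]
  have g: "is_grading (ext_smul A) UNIV (ext_gr (par A))"
    by (rule gr_ext[OF A]) (use A in \<open>unfold dg_algebra_def, blast\<close>)
  have "multilin (ext_smul A) tscale (\<lambda>w. if length w = length ds then
      if i < length w then tscale (ksign (\<Sum>k<i. ds ! k - 1)) (tns A (w[i := ext_dif A (w ! i)])) else 0 else 0)" for ds
  proof (cases "i < length ds")
    case True
    have "multilin (ext_smul A) tscale (\<lambda>w. if length w = length ds then
       tscale (ksign (\<Sum>k<i. ds ! k - 1)) (tns A (w[i := ext_dif A (w ! i)])) else 0)"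
    proof (rule multilin_tensor_word[OF s])
      fix xs ys :: "('a \<times> 'b) list"
      assume l: "length xs + Suc (length ys) = length ds"
      let ?\<Psi> = "\<lambda>w. w[i := ext_dif A (w ! i)]"
      note lin = vector_space_ext_props[OF A]
      consider "i < length xs" | "i = length xs" | j where "i = Suc (length xs + j)"
        using less_iff_Suc_add linorder_less_linear by metis
      then show "\<exists>us vs L. Vector_Spaces.linear (ext_smul A) (ext_smul A) L \<and>
         (\<forall>x. (xs @ x # ys)[i := ext_dif A ((xs @ x # ys) ! i)] = us @ L x # vs)"
      proof cases
        case 1
        then have "\<forall>x. ?\<Psi> (xs @ x # ys) = xs[i := ext_dif A (xs ! i)] @ x # ys"
          by (simp add: list_update_append nth_append)
        then show ?thesis using lin(1) by blast
      next
        case 2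
        then have "\<forall>x. ?\<Psi> (xs @ x # ys) = xs @ ext_dif A x # ys"
          by (simp add: list_update_append nth_append)
        then show ?thesis using lin(2) by blast
      next
        case 3
        then have "\<forall>x. ?\<Psi> (xs @ x # ys) = xs @ x # ys[j := ext_dif A (ys ! j)]"
          by (simp add: list_update_append nth_append)
        then show ?thesis using lin(1) by blast
      qed
    qed
    then show ?thesis using True by (simp cong: if_cong)
  next
    case False
    then show ?thesis by (simp add: multilin_zero s cong: if_cong)
  qed
  then show ?thesis
    unfolding delta_def using w i unfolding homog_def
    by (subst hom_ext_tensor[OF s g]) (auto simp: tensor_in_span zero_in_span)
qed

definition mu :: "('a::ring, 'k::field) dga_data \<Rightarrow> nat \<Rightarrow> ('a, 'k) chain \<Rightarrow> ('a, 'k) chain" where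
  "mu A i = hom_ext (ext_gr (par A)) (\<lambda>ps w.
     let n = length w - 1 in
     if n = 0 \<or> n < i then 0
     else if i < n then
       tscale (ksign ((\<Sum>k\<le>i. ps ! k - 1) + 1))
         (tns A (take i w @ [ext_mult A (w ! i) (w ! (i + 1))] @ drop (i + 2) w))
     else
       tscale (- ksign ((ps ! n - 1) * (ps ! 0 + (\<Sum>k=1..n-1. ps ! k - 1))))
         (tns A (ext_mult A (w ! n) (w ! 0) # take (n - 1) (tl w))))"

lemma mu_tensor:
  assumes A: "dg_algebra A" and w: "homog A ps w"
  shows "mu A i (tns A w) = (
     let n = length w - 1 in
     if n = 0 \<or> n < i then 0
     else if i < n then
       tscale (ksign ((\<Sum>k\<le>i. ps ! k - 1) + 1))
         (tns A (take i w @ [ext_mult A (w ! i) (w ! (i + 1))] @ drop (i + 2) w))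
     else
       tscale (- ksign ((ps ! n - 1) * (ps ! 0 + (\<Sum>k=1..n-1. ps ! k - 1))))
         (tns A (ext_mult A (w ! n) (w ! 0) # take (n - 1) (tl w))))" (is "_ = ?F ps w")
proof -
  note s = vs_ext[OF A]
  have g: "is_grading (ext_smul A) UNIV (ext_gr (par A))"
    by (rule gr_ext[OF A]) (use A in \<open>unfold dg_algebra_def, blast\<close>)
  have "multilin (ext_smul A) tscale (\<lambda>w. if length w = length ds then ?F ds w else 0)" for ds
  proof -
    let ?n = "length ds - 1"
    note lin = vector_space_ext_props[OF A]
    consider "?n = 0 \<or> ?n < i" | "?n \<noteq> 0" "i < ?n" | "?n \<noteq> 0" "i = ?n" by linarith
    then show ?thesis
    proof cases
      case 1
      then have "(\<lambda>w::('a\<times>'b) list. if length w = length ds then ?F ds w else 0) = (\<lambda>w. 0)" by (auto simp: fun_eq_iff)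
      then show ?thesis by (simp only: multilin_zero[OF s])
    next
      case 2
      have "multilin (ext_smul A) tscale (\<lambda>w. if length w = length ds then tscale (ksign ((\<Sum>k\<le>i. ds ! k - 1) + 1))
         (tns A (take i w @ [ext_mult A (w ! i) (w ! (i + 1))] @ drop (i + 2) w)) else 0)"
      proof (rule multilin_tensor_word[OF s])
        fix xs ys :: "('a \<times> 'b) list"
        assume l: "length xs + Suc (length ys) = length ds"
        let ?\<Psi> = "\<lambda>w. take i w @ [ext_mult A (w ! i) (w ! (i + 1))] @ drop (i + 2) w"
        have "i + 1 < length xs \<or> i + 1 = length xs \<or> i = length xs \<or> (\<exists>j. i = Suc (length xs + j))"
          using less_iff_Suc_add by (metis Suc_eq_plus1 linorder_less_linear not_less_eq)
        then consider "i + 1 < length xs" | "i + 1 = length xs" | "i = length xs" | j where "i = Suc (length xs + j)"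
          by blast
        then show "\<exists>us vs L. Vector_Spaces.linear (ext_smul A) (ext_smul A) L \<and>
           (\<forall>x. ?\<Psi> (xs @ x # ys) = us @ L x # vs)"
        proof cases
          case 1
          then have "\<forall>x. ?\<Psi> (xs @ x # ys) = (take i xs @ [ext_mult A (xs ! i) (xs ! (i + 1))] @ drop (i + 2) xs) @ x # ys"
            by (simp add: nth_append)
          then show ?thesis using lin(1) by blast
        next
          case 2
          then have "\<forall>x. ?\<Psi> (xs @ x # ys) = take i xs @ ext_mult A (xs ! i) x # ys"
            by (simp add: nth_append)
          then show ?thesis using lin(3) by blast
        next
          case 3
          then have "\<forall>x. ?\<Psi> (xs @ x # ys) = xs @ ext_mult A x (ys ! 0) # drop 1 ys"
            by (simp add: nth_append)
          then show ?thesis using lin(4) by blast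
        next
          case 4
          then have "\<forall>x. ?\<Psi> (xs @ x # ys) = xs @ x # (take j ys @ [ext_mult A (ys ! j) (ys ! (j + 1))] @ drop (j + 2) ys)"
            by (simp add: nth_append add.commute numeral_3_eq_3)
          then show ?thesis using lin(1) by blast
        qed
      qed
      then show ?thesis using 2 by (simp cong: if_cong)
    next
      case 3
      have "multilin (ext_smul A) tscale (\<lambda>w. if length w = length ds then
          tscale (- ksign ((ds ! ?n - 1) * (ds ! 0 + (\<Sum>k=1..?n-1. ds ! k - 1))))
         (tns A (ext_mult A (w ! ?n) (w ! 0) # take (?n - 1) (tl w))) else 0)"
      proof (rule multilin_tensor_word[OF s])
        fix xs ys :: "('a \<times> 'b) list"
        assume l: "length xs + Suc (length ys) = length ds"
        let ?\<Psi> = "\<lambda>w. ext_mult A (w ! ?n) (w ! 0) # take (?n - 1) (tl w)"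
        consider "xs = []" | "ys = []" | a xs' b ys' where "xs = a # xs'" "ys = ys' @ [b]"
          by (metis list.exhaust rev_exhaust)
        then show "\<exists>us vs L. Vector_Spaces.linear (ext_smul A) (ext_smul A) L \<and>
           (\<forall>x. ?\<Psi> (xs @ x # ys) = us @ L x # vs)"
        proof cases
          case 1
          then have "\<forall>x. ?\<Psi> (xs @ x # ys) = [] @ ext_mult A (ys ! (?n-1)) x # take (?n - 1) ys"
            using l 3 by (auto simp: nth_Cons')
          then show ?thesis using lin(3) by blast
        next
          case 2
          then have "\<forall>x. ?\<Psi> (xs @ x # ys) = [] @ ext_mult A x (xs ! 0) # take (?n - 1) (tl xs)"
            using l 3 by (cases xs) (auto simp: nth_append nth_Cons')
          then show ?thesis using lin(4) by blast
        next
          case c: (3 a xs' b ys')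
          have n: "?n = Suc (length xs' + Suc (length ys'))" using l c by simp
          then have "\<forall>x. ?\<Psi> (xs @ x # ys) = (ext_mult A b a # xs') @ x # ys'"
            using c unfolding n by (simp add: nth_append)
          then show ?thesis using lin(1) by blast
        qed
      qed
      then show ?thesis using 3 by (simp add: Let_def cong: if_cong)
    qed
  qed
  moreover have "?F ds v \<in> module.span tscale (range (tns A))" for ds v
    by (auto simp: tensor_in_span zero_in_span Let_def)
  ultimately show ?thesis
    unfolding mu_def
    by (rule hom_ext_tensor[where F = "?F", OF s g]) (use w in \<open>auto simp: homog_def\<close>)
qed

definition be :: "('a::ring, 'k::field) dga_data \<Rightarrow> ('a, 'k) chain \<Rightarrow> ('a, 'k) chain" where
  "be A = lin_ext (\<lambda>w. let n = length w - 1 in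
     (\<Sum>i=0..n. delta A i (tns A w)) + (\<Sum>i=0..n. mu A i (tns A w)))"

definition tau :: "('a::ring, 'k::field) dga_data \<Rightarrow> ('a, 'k) chain \<Rightarrow> ('a, 'k) chain" where
  "tau A = hom_ext (ext_gr (par A)) (\<lambda>ps w.
     tscale (ksign ((ps ! 0 - 1) * (\<Sum>i=1..length w - 1. ps ! i - 1))) (tns A (rotate1 w)))"

lemma tau_tensor:
  assumes A: "dg_algebra A" and w: "homog A ps w"
  shows "tau A (tns A w) = tscale (ksign ((ps ! 0 - 1) * (\<Sum>i=1..length w - 1. ps ! i - 1))) (tns A (rotate1 w))"
proof -
  note s = vs_ext[OF A]
  note lin = vector_space_ext_props[OF A]
  have g: "is_grading (ext_smul A) UNIV (ext_gr (par A))"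
    by (rule gr_ext[OF A]) (use A in \<open>unfold dg_algebra_def, blast\<close>)
  have "multilin (ext_smul A) tscale (\<lambda>w. if length w = length ds then tscale c (tns A (rotate1 w)) else 0)" for c and ds :: "bit list"
  proof (rule multilin_tensor_word[OF s])
    fix xs ys :: "('a \<times> 'b) list"
    have "\<forall>x. rotate1 (xs @ x # ys) = (if xs = [] then ys else tl xs) @ x # (if xs = [] then [] else ys @ [hd xs])"
      by (cases xs) auto
    then show "\<exists>us vs L. Vector_Spaces.linear (ext_smul A) (ext_smul A) L \<and>
           (\<forall>x. rotate1 (xs @ x # ys) = us @ L x # vs)" using lin(1) by blast
  qed
  then have "multilin (ext_smul A) tscale (\<lambda>w. if length w = length ds then tscale (ksign ((ds ! 0 - 1) * (\<Sum>i=1..length w - 1. ds ! i - 1))) (tns A (rotate1 w)) else 0)" for ds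
    by (simp cong: if_cong)
  then show ?thesis
    unfolding tau_def
    by (rule hom_ext_tensor[OF s g]) (use w in \<open>auto simp: homog_def tensor_in_span\<close>)
qed

definition NN :: "('a::ring, 'k::field) dga_data \<Rightarrow> ('a, 'k) chain \<Rightarrow> ('a, 'k) chain" where
  "NN A = lin_ext (\<lambda>w. let n = length w - 1 in \<Sum>i=0..n. (tau A ^^ i) (tns A w))"

definition he :: "('a::ring, 'k::field) dga_data \<Rightarrow> ('a, 'k) chain \<Rightarrow> ('a, 'k) chain" where
  "he A = lin_ext (\<lambda>w. tns A (ee # w))"

definition Be :: "('a::ring, 'k::field) dga_data \<Rightarrow> ('a, 'k) chain \<Rightarrow> ('a, 'k) chain" where
  "Be A = mat2 A (\<lambda>_. 0) (\<lambda>_. 0) (\<lambda>x. he A (NN A x)) (\<lambda>_. 0)"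

definition UU :: "('a::ring, 'k::field) dga_data \<Rightarrow> ('a, 'k) chain \<Rightarrow> ('a, 'k) chain" where
  "UU A x = tscale (1 / 2)
     (mat2 A (\<lambda>y. - mu A 0 (delta A 1 y)) (\<lambda>y. - mu A 0 (delta A 1 y)) (\<lambda>_. 0) (\<lambda>_. 0) x)"

definition VV :: "('a::ring, 'k::field) dga_data \<Rightarrow> ('a, 'k) chain \<Rightarrow> ('a, 'k) chain" where
  "VV A x = tscale (1 / 2)
     (mat2 A (\<lambda>_. 0) (\<lambda>_. 0)
       (\<lambda>y. - he A (lin_ext (\<lambda>w. let n = length w - 1 in
          \<Sum>i=1..n. \<Sum>j=i+1..n+1. (tau A ^^ j) (delta A i (tns A w))) y))
       (\<lambda>_. 0) x)"

definition Gamma :: "('a::ring, 'k::field) dga_data \<Rightarrow> ('a, 'k) chain \<Rightarrow> ('a, 'k) chain" where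
  "Gamma A = lin_ext (\<lambda>w. let n = length w - 1 in tscale (- (of_nat n / 2)) (tns A w))"

definition Gamma' ::
  "('a::ring, 'k::field) dga_data \<Rightarrow> (int \<Rightarrow> 'a set) \<Rightarrow> ('a, 'k) chain \<Rightarrow> ('a, 'k) chain" where
  "Gamma' A D = hom_ext (ext_gr D) (\<lambda>ds w. let n = length w - 1 in
     tscale (of_int ((\<Sum>i=0..n. ds ! i) - int n)) (tns A w))"

section \<open>Mixed complexes and \<open>u\<close>-connections\<close>

text \<open>\<open>C\<close> and \<open>G p\<close> are subspaces of an ambient vector space; operators are only constrained on
  \<open>C\<close>, respectively on $\mathsf{C}((u))$.\<close>

definition linear_on :: "('k::field \<Rightarrow> 'v::ab_group_add \<Rightarrow> 'v) \<Rightarrow> 'v set \<Rightarrow> ('v \<Rightarrow> 'v) \<Rightarrow> bool" where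
  "linear_on s C T \<longleftrightarrow>
     (\<forall>x\<in>C. T x \<in> C) \<and> (\<forall>x\<in>C. \<forall>y\<in>C. T (x + y) = T x + T y) \<and> (\<forall>c. \<forall>x\<in>C. T (s c x) = s c (T x))"

definition mixed_complex ::
  "('k::field \<Rightarrow> 'v::ab_group_add \<Rightarrow> 'v) \<Rightarrow> 'v set \<Rightarrow> (bit \<Rightarrow> 'v set) \<Rightarrow> ('v \<Rightarrow> 'v) \<Rightarrow> ('v \<Rightarrow> 'v) \<Rightarrow> bool"
  where
  "mixed_complex s C G b B \<longleftrightarrow>
     vector_space s \<and> is_grading s C G \<and>
     linear_on s C b \<and> has_parity G 1 b \<and> linear_on s C B \<and> has_parity G 1 B \<and>
     (\<forall>x\<in>C. b (b x) = 0 \<and> B (B x) = 0 \<and> b (B x) + B (b x) = 0)"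

subsection \<open>Laurent series with coefficients in a vector space\<close>

definition laurent :: "'v::zero set \<Rightarrow> 'v fls set" where
  "laurent C = {x. \<forall>n. fls_nth x n \<in> C}"

definition fls_map :: "('v::zero \<Rightarrow> 'v) \<Rightarrow> 'v fls \<Rightarrow> 'v fls" where
  "fls_map T x = Abs_fls (\<lambda>n. T (fls_nth x n))"

text \<open>The action of $\boldsymbol{k}((u))$: the Cauchy product, a finite sum in each degree.\<close>

definition fls_smul ::
  "('k::field \<Rightarrow> 'v::ab_group_add \<Rightarrow> 'v) \<Rightarrow> 'k fls \<Rightarrow> 'v fls \<Rightarrow> 'v fls" where
  "fls_smul s g x = Abs_fls (\<lambda>n.
     \<Sum>i | fls_nth g i \<noteq> 0 \<and> fls_nth x (n - i) \<noteq> 0. s (fls_nth g i) (fls_nth x (n - i)))"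

definition d_du :: "('k::field \<Rightarrow> 'v::ab_group_add \<Rightarrow> 'v) \<Rightarrow> 'v fls \<Rightarrow> 'v fls" where
  "d_du s x = Abs_fls (\<lambda>n. s (of_int (n + 1)) (fls_nth x (n + 1)))"

definition fls_linear_on ::
  "('k::field \<Rightarrow> 'v::ab_group_add \<Rightarrow> 'v) \<Rightarrow> 'v set \<Rightarrow> ('v fls \<Rightarrow> 'v fls) \<Rightarrow> bool" where
  "fls_linear_on s C T \<longleftrightarrow>
     (\<forall>x\<in>laurent C. T x \<in> laurent C) \<and>
     (\<forall>x\<in>laurent C. \<forall>y\<in>laurent C. T (x + y) = T x + T y) \<and>
     (\<forall>g. \<forall>x\<in>laurent C. T (fls_smul s g x) = fls_smul s g (T x))"

text \<open>$b + uB$\<close>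

definition buB ::
  "('k::field \<Rightarrow> 'v::ab_group_add \<Rightarrow> 'v) \<Rightarrow> ('v \<Rightarrow> 'v) \<Rightarrow> ('v \<Rightarrow> 'v) \<Rightarrow> 'v fls \<Rightarrow> 'v fls" where
  "buB s b B x = fls_map b x + fls_smul s fls_X (fls_map B x)"

definition u_connection ::
  "('k::field \<Rightarrow> 'v::ab_group_add \<Rightarrow> 'v) \<Rightarrow> 'v set \<Rightarrow> (bit \<Rightarrow> 'v set) \<Rightarrow> ('v \<Rightarrow> 'v) \<Rightarrow> ('v \<Rightarrow> 'v) \<Rightarrow>
   ('v fls \<Rightarrow> 'v fls) \<Rightarrow> bool" where
  "u_connection s C G b B conn \<longleftrightarrow>
     (\<exists>\<A>. fls_linear_on s C \<A> \<and> has_parity (\<lambda>p. laurent (G p)) 0 \<A> \<and>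
        (\<forall>x\<in>laurent C. conn x = d_du s x + \<A> x)) \<and>
     (\<forall>x\<in>laurent C. conn (buB s b B x) - buB s b B (conn x) =
        fls_smul s (1 / (2 * fls_X)) (buB s b B x))"

definition equal_up_to_u_homotopy ::
  "('k::field \<Rightarrow> 'v::ab_group_add \<Rightarrow> 'v) \<Rightarrow> 'v set \<Rightarrow> (bit \<Rightarrow> 'v set) \<Rightarrow> ('v \<Rightarrow> 'v) \<Rightarrow> ('v \<Rightarrow> 'v) \<Rightarrow>
   ('v fls \<Rightarrow> 'v fls) \<Rightarrow> ('v fls \<Rightarrow> 'v fls) \<Rightarrow> bool" where
  "equal_up_to_u_homotopy s C G b B conn1 conn2 \<longleftrightarrow>
     (\<exists>H. fls_linear_on s C H \<and> has_parity (\<lambda>p. laurent (G p)) 1 H \<and>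
        (\<forall>x\<in>laurent C. conn1 x - conn2 x = buB s b B (H x) + H (buB s b B x)))"

definition nabla :: "('a::ring, 'k::field) dga_data \<Rightarrow> ('a, 'k) chain fls \<Rightarrow> ('a, 'k) chain fls" where
  "nabla A x = d_du tscale x
     + fls_smul tscale (1 / fls_X\<^sup>2) (fls_map (UU A) x)
     + fls_smul tscale (1 / fls_X) (fls_map (\<lambda>y. VV A y + Gamma A y) x)"

definition nabla_gr ::
  "('a::ring, 'k::field) dga_data \<Rightarrow> (int \<Rightarrow> 'a set) \<Rightarrow> ('a, 'k) chain fls \<Rightarrow> ('a, 'k) chain fls" where
  "nabla_gr A D x = d_du tscale x + fls_smul tscale (1 / (2 * fls_X)) (fls_map (Gamma' A D) x)"

end

theory Submission
  imports Defs
begin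

text \<open>
  The degree operator $E(a)=\deg(a)\,a$ is a derivation of $A$ with $[E,d]=d$. The homotopy is the
  one of the Cartan formula for $E$, namely $H=u^{-2}H_0+u^{-1}H_1$ with
  $$H_0=-\tfrac12\,\mu^{(0)}E^{(1)},\qquad
    H_1=-\tfrac12\,h^e\sum_{i=1}^n\sum_{j=i+1}^{n+1}\tau^jE^{(i)},$$
  where $E^{(i)}$ multiplies a word by $\deg(a_i)$. Since $E$ commutes with all operators up to
  $[E,d]=d$, the homotopy formula turns $E$ into $\delta$ in these expressions and leaves
  $-\tfrac12\sum_i\deg(a_i)=\Gamma-\tfrac12\Gamma'$, the Lie derivative up to a factor.

  All signs are Koszul signs for the shifted letters $sa_0,\dots,sa_n$: with these,
  $\delta^{(i)}\tau=\tau\delta^{(i+1)}$ and $\mu^{(i)}\tau=\tau\mu^{(i+1)}$ hold without signs, so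
  that identities need to be checked on words only for $\delta^{(0)}$ and $\mu^{(0)}$. On
  $\mathsf{C}^+(A)$ one uses $b^eh^e=1-\tau^{-1}-h^eb'$, where
  $b'$ is $b^e$ without $\mu^{(n)}$.
\<close>

section \<open>Laurent series\<close>

text \<open>Origin of the formulas: U(\<delta>) and V(\<delta>) are the two components of the
  contraction by the derivation d in the noncommutative Cartan calculus, and H0, H1 are the same
  expressions with E in place of d. Since d = [E, d] is a boundary among derivations, its
  contraction is one as well, up to the Lie derivative of E. Comparing powers of u, the homotopy
  amounts to three identities on C^e: bH0 + H0b = U, bH1 + H1b + BH0 + H0B = V + \<Gamma> -
  \<Gamma>'/2 and BH1 + H1B = 0. The obstacle is that the operators are known only by signed
  formulas on homogeneous words, and take different shapes on C(A) and C^+(A). The simplicial and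
  cyclic identities are therefore proved for all words of a fixed length in A^e, with e in any
  place. The distinction enters only afterwards, when C^e is generated by words x in A and by
  \<open>he A x\<close>, and the unit property of e is used only through \<open>he\<close>. Only the
  image of deg in k enters, so positive characteristic makes no difference.\<close>

lemma fls_map_nth: "T 0 = 0 \<Longrightarrow> fls_nth (fls_map T x) n = T (fls_nth x n)"
  unfolding fls_map_def
  by (rule nth_Abs_fls_lower_bound[where N = "fls_subdegree x"]) auto

lemma fls_smul_nth:
  "fls_nth (fls_smul s g x) n =
     (\<Sum>i | fls_nth g i \<noteq> 0 \<and> fls_nth x (n - i) \<noteq> 0. s (fls_nth g i) (fls_nth x (n - i)))"
  unfolding fls_smul_def
proof (rule nth_Abs_fls_lower_bound[where N = "fls_subdegree g + fls_subdegree x"], intro allI impI)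
  fix n assume n: "n < fls_subdegree g + fls_subdegree x"
  have "{i. fls_nth g i \<noteq> 0 \<and> fls_nth x (n - i) \<noteq> 0} = {}"
  proof (rule ccontr)
    assume "{i. fls_nth g i \<noteq> 0 \<and> fls_nth x (n - i) \<noteq> 0} \<noteq> {}"
    then obtain i where "fls_nth g i \<noteq> 0" "fls_nth x (n - i) \<noteq> 0" by blast
    then have "fls_subdegree g \<le> i" "fls_subdegree x \<le> n - i"
      by (meson fls_eq0_below_subdegree not_le)+
    then show False using n by linarith
  qed
  then show "(\<Sum>i | fls_nth g i \<noteq> 0 \<and> fls_nth x (n - i) \<noteq> 0. s (fls_nth g i) (fls_nth x (n - i))) =
      0"
    by (simp only: sum.empty)
qed

text \<open>The index set in the definition depends on the support of x. An interval that depends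
  only on a lower bound N can be shared by several series, so that additivity and linearity can be
  checked term by term.\<close>

lemma fls_smul_nth_interval:
  assumes s: "vector_space s" and N: "\<And>i. i < N \<Longrightarrow> fls_nth x i = 0"
  shows "fls_nth (fls_smul s g x) n =
     (\<Sum>i = fls_subdegree g..n - N. s (fls_nth g i) (fls_nth x (n - i)))"
proof -
  interpret vector_space s by fact
  have "{i. fls_nth g i \<noteq> 0 \<and> fls_nth x (n - i) \<noteq> 0} \<subseteq> {fls_subdegree g..n - N}"
  proof
    fix i assume i: "i \<in> {i. fls_nth g i \<noteq> 0 \<and> fls_nth x (n - i) \<noteq> 0}"
    then have "fls_subdegree g \<le> i" "N \<le> n - i"
      using N by (simp_all, meson fls_eq0_below_subdegree not_le, meson not_le)
    then show "i \<in> {fls_subdegree g..n - N}" by auto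
  qed
  then show ?thesis unfolding fls_smul_nth
    by (intro sum.mono_neutral_left) (auto)
qed

text \<open>The explicit scalars of the connections and the homotopy are u, u^{-1}, u^{-2} and
  1/(2u); up to a constant they act by shifting coefficients.\<close>

lemma fls_smul_monomial_nth:
  assumes s: "vector_space s" and g: "\<And>i. fls_nth g i = (if i = k then c else 0)"
  shows "fls_nth (fls_smul s g x) n = s c (fls_nth x (n - k))"
proof -
  interpret vector_space s by fact
  have "fls_nth (fls_smul s g x) n = (\<Sum>i\<in>{k}. s (fls_nth g i) (fls_nth x (n - i)))"
    unfolding fls_smul_nth using g by (intro sum.mono_neutral_left) (auto split: if_splits)
  then show ?thesis using g by simp
qed

lemma d_du_nth:
  assumes s: "vector_space s"
  shows "fls_nth (d_du s x) n = s (of_int (n + 1)) (fls_nth x (n + 1))"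
proof -
  interpret vector_space s by fact
  show ?thesis unfolding d_du_def
    by (rule nth_Abs_fls_lower_bound[where N = "fls_subdegree x - 1"]) auto
qed

lemma buB_nth:
  assumes s: "vector_space s" and "b 0 = 0" "B 0 = 0"
  shows "fls_nth (buB s b B x) n = b (fls_nth x n) + B (fls_nth x (n - 1))"
proof -
  interpret vector_space s by fact
  have "fls_nth (fls_smul s fls_X (fls_map B x)) n = s 1 (fls_nth (fls_map B x) (n - 1))"
    by (rule fls_smul_monomial_nth[OF s]) simp
  then show ?thesis using assms by (simp add: buB_def fls_map_nth)
qed

lemma fls_inverse_monomials_nth:
  "fls_nth (1 / (fls_X :: 'k::field fls)) i = (if i = - 1 then 1 else 0)"
  "fls_nth (1 / (fls_X :: 'k::field fls)\<^sup>2) i = (if i = - 2 then 1 else 0)"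
  "fls_nth (1 / (2 * fls_X :: 'k::field fls)) i = (if i = - 1 then 1 / 2 else 0)"
proof -
  have inv: "1 / (fls_X :: 'k fls) = fls_X_inv"
    by (metis divide_inverse fls_inverse_X mult_1)
  show "fls_nth (1 / (fls_X :: 'k fls)) i = (if i = - 1 then 1 else 0)"
    unfolding inv by simp
  have "1 / (fls_X :: 'k fls)\<^sup>2 = fls_X_inv ^ 2"
    using inv by (metis power_one_over)
  then show "fls_nth (1 / (fls_X :: 'k fls)\<^sup>2) i = (if i = - 2 then 1 else 0)"
    by simp
  have half: "1 / (2 * fls_X :: 'k fls) = fls_const (inverse 2) * fls_X_inv"
  proof -
    have "(2 :: 'k fls) = fls_const 2" by (metis fls_const_numeral)
    then have "1 / (2 * fls_X :: 'k fls) = inverse (fls_const 2) * (1 / fls_X)"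
      by (simp add: field_simps)
    then show ?thesis by (simp only: inv fls_inverse_const)
  qed
  show "fls_nth (1 / (2 * fls_X :: 'k fls)) i = (if i = - 1 then 1 / 2 else 0)"
    unfolding half fls_mult_const_nth fls_X_inv_nth by simp
qed

section \<open>Linearity over k((u))\<close>

lemma linear_on_0:
  assumes s: "vector_space s" and T: "linear_on s C T" and C: "module.subspace s C"
  shows "T 0 = 0"
proof -
  interpret vector_space s by fact
  have "0 \<in> C" using C by (rule subspace_0)
  then have "T (0 + 0) = T 0 + T 0" using T unfolding linear_on_def by blast
  then show "T 0 = 0" by simp
qed

lemma linear_on_sum:
  assumes s: "vector_space s" and T: "linear_on s C T" and C: "module.subspace s C"
    and f: "\<And>i. i \<in> I \<Longrightarrow> f i \<in> C"
  shows "T (\<Sum>i\<in>I. s (c i) (f i)) = (\<Sum>i\<in>I. s (c i) (T (f i)))"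
proof -
  interpret vector_space s by fact
  show ?thesis
    using f
  proof (induction I rule: infinite_finite_induct)
    case (insert i I)
    have "(\<Sum>i\<in>I. s (c i) (f i)) \<in> C" "s (c i) (f i) \<in> C"
      using insert.prems C by (auto intro!: subspace_sum subspace_scale)
    then have "T (s (c i) (f i) + (\<Sum>i\<in>I. s (c i) (f i))) =
        T (s (c i) (f i)) + T (\<Sum>i\<in>I. s (c i) (f i))"
      using T unfolding linear_on_def by blast
    moreover have "T (s (c i) (f i)) = s (c i) (T (f i))"
      using T insert.prems unfolding linear_on_def by blast
    ultimately show ?case using insert by simp
  qed (simp_all add: linear_on_0[OF s T C])
qed

lemma fls_smul_add:
  assumes s: "vector_space s"
  shows "fls_smul s g (x + y) = fls_smul s g x + fls_smul s g y"
proof -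
  interpret vector_space s by fact
  show ?thesis
  proof (rule fls_eqI)
    fix n
    let ?N = "min (fls_subdegree x) (fls_subdegree y)"
    show "fls_nth (fls_smul s g (x + y)) n = fls_nth (fls_smul s g x + fls_smul s g y) n"
      unfolding fls_plus_nth
      by (subst (1 2 3) fls_smul_nth_interval[OF s, where N = ?N])
        (simp_all add: sum.distrib scale_right_distrib)
  qed
qed

text \<open>In each degree the Cauchy product is a finite sum, so k-linearity of T suffices; T 0 = 0
  makes the lower bound of x valid for its image too.\<close>

lemma fls_linear_on_map:
  assumes s: "vector_space s" and T: "linear_on s C T" and C: "module.subspace s C"
  shows "fls_linear_on s C (fls_map T)"
proof -
  interpret vector_space s by fact
  note T0 = linear_on_0[OF s T C]
  have "fls_map T (fls_smul s g x) = fls_smul s g (fls_map T x)" if "x \<in> laurent C" for g x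
  proof (rule fls_eqI)
    fix n
    have "\<And>i. i < fls_subdegree x \<Longrightarrow> fls_nth (fls_map T x) i = 0"
      using T0 by (simp add: fls_map_nth)
    then show "fls_nth (fls_map T (fls_smul s g x)) n = fls_nth (fls_smul s g (fls_map T x)) n"
      using that unfolding fls_map_nth[of T, OF T0]
      by (simp add: fls_smul_nth_interval[OF s, where N = "fls_subdegree x"] T0 fls_map_nth
          linear_on_sum[OF s T C] laurent_def)
  qed
  then show ?thesis
    using T unfolding fls_linear_on_def linear_on_def
    by (auto simp: laurent_def fls_map_nth T0 fls_eq_iff)
qed

lemma fls_linear_on_add:
  assumes s: "vector_space s" and C: "module.subspace s C"
    and T: "fls_linear_on s C T" and T': "fls_linear_on s C T'"
  shows "fls_linear_on s C (\<lambda>x. T x + T' x)"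
proof -
  interpret vector_space s by fact
  have "T x + T' x \<in> laurent C" if "x \<in> laurent C" for x
    using T T' that C unfolding fls_linear_on_def by (simp add: laurent_def subspace_add)
  then show ?thesis using T T' unfolding fls_linear_on_def
    by (simp add: fls_smul_add[OF s] add_ac)
qed

lemma fls_linear_on_comp:
  "fls_linear_on s C T \<Longrightarrow> fls_linear_on s C T' \<Longrightarrow> fls_linear_on s C (\<lambda>x. T (T' x))"
  unfolding fls_linear_on_def by auto

text \<open>This is commutativity of k((u)) with a monomial as one factor: both products are the
  same finite sum, the lower bound of x being shifted by k.\<close>

lemma fls_linear_on_monomial:
  assumes s: "vector_space s" and C: "module.subspace s C"
    and g: "\<And>i. fls_nth g i = (if i = k then c else 0)"
  shows "fls_linear_on s C (fls_smul s g)"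
proof -
  interpret vector_space s by fact
  note nth = fls_smul_monomial_nth[OF s g]
  have "fls_smul s g (fls_smul s h x) = fls_smul s h (fls_smul s g x)" for h x
  proof (rule fls_eqI)
    fix n
    have N: "\<And>i. i < fls_subdegree x + k \<Longrightarrow> fls_nth (fls_smul s g x) i = 0"
      by (simp add: nth)
    have "fls_nth (fls_smul s g (fls_smul s h x)) n =
        (\<Sum>i = fls_subdegree h..n - k - fls_subdegree x. s c (s (fls_nth h i) (fls_nth x (n - k -
            i))))"
      unfolding nth by (subst fls_smul_nth_interval[OF s, where N = "fls_subdegree x"])
        (simp_all add: scale_sum_right)
    moreover have "fls_nth (fls_smul s h (fls_smul s g x)) n =
        (\<Sum>i = fls_subdegree h..n - (fls_subdegree x + k). s (fls_nth h i) (s c (fls_nth x (n - i -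
            k))))"
      by (subst fls_smul_nth_interval[OF s, where N = "fls_subdegree x + k"]) (simp_all add: nth)
    moreover have "n - (fls_subdegree x + k) = n - k - fls_subdegree x" "n - k - i =
        n - i - k" for i
      by simp_all
    ultimately show "fls_nth (fls_smul s g (fls_smul s h x)) n =
        fls_nth (fls_smul s h (fls_smul s g x)) n"
      by (simp only: scale_left_commute)
  qed
  then show ?thesis
    using C unfolding fls_linear_on_def
    by (auto simp: fls_smul_add[OF s] laurent_def nth intro: subspace_scale)
qed

text \<open>\<open>H0\<close> and \<open>H1\<close> are the coefficients of the homotopy at $u^{-2}$ and $u^{-1}$. The connection
  property of the first connection comes for free from that of the second one, because
  $(b+uB)^2=0$.\<close>

lemma equal_up_to_u_homotopyI:
  fixes s :: "'k::field \<Rightarrow> 'v::ab_group_add \<Rightarrow> 'v"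
  assumes two: "(2::'k) \<noteq> 0" and mixed: "mixed_complex s C G b B"
    and \<Gamma>: "linear_on s C \<Gamma>" "has_parity G 0 \<Gamma>"
    and H0: "linear_on s C H0" "has_parity G 1 H0"
    and H1: "linear_on s C H1" "has_parity G 1 H1"
    and U0: "U 0 = 0" and V0: "V 0 = 0"
    and \<Gamma>b: "\<And>x. x \<in> C \<Longrightarrow> \<Gamma> (b x) - b (\<Gamma> x) = b x"
    and \<Gamma>B: "\<And>x. x \<in> C \<Longrightarrow> \<Gamma> (B x) - B (\<Gamma> x) = - B x"
    and HU: "\<And>x. x \<in> C \<Longrightarrow> U x = b (H0 x) + H0 (b x)"
    and HV: "\<And>x. x \<in> C \<Longrightarrow> V x - s (1 / 2) (\<Gamma> x) = b (H1 x) + H1 (b x) + (B (H0 x) + H0 (B x))"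
    and HB: "\<And>x. x \<in> C \<Longrightarrow> B (H1 x) + H1 (B x) = 0"
  defines "conn1 \<equiv> \<lambda>x. d_du s x + fls_smul s (1 / fls_X\<^sup>2) (fls_map U x)
      + fls_smul s (1 / fls_X) (fls_map V x)"
    and "conn2 \<equiv> \<lambda>x. d_du s x + fls_smul s (1 / (2 * fls_X)) (fls_map \<Gamma> x)"
  shows "u_connection s C G b B conn1" "u_connection s C G b B conn2"
    "equal_up_to_u_homotopy s C G b B conn1 conn2"
proof -
  have s: "vector_space s" using mixed unfolding mixed_complex_def by blast
  interpret vector_space s by fact
  have C: "subspace C" and GC: "\<And>p. G p \<subseteq> C" and Gs: "\<And>p. subspace (G p)"
    and b: "linear_on s C b" "has_parity G 1 b" and B: "linear_on s C B" "has_parity G 1 B"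
    using mixed unfolding mixed_complex_def is_grading_def by blast+
  have bB: "b (b x) = 0" "B (B x) = 0" "b (B x) + B (b x) = 0" if "x \<in> C" for x
    using mixed that unfolding mixed_complex_def by blast+
  note zero = linear_on_0[OF s _ C]
  note z = zero[OF b(1)] zero[OF B(1)] zero[OF \<Gamma>(1)] zero[OF H0(1)] zero[OF H1(1)] U0 V0
  note mono = fls_inverse_monomials_nth[where ?'k = 'k]
  note mono_nth = fls_smul_monomial_nth[OF s mono(1)] fls_smul_monomial_nth[OF s mono(2)]
    fls_smul_monomial_nth[OF s mono(3)]
  define H where "H x = fls_smul s (1 / fls_X\<^sup>2) (fls_map H0 x) +
      fls_smul s (1 / fls_X) (fls_map H1 x)"
    for x
  let ?D = "buB s b B"
  have D_nth: "fls_nth (?D x) n = b (fls_nth x n) + B (fls_nth x (n - 1))" for x n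
    by (rule buB_nth[OF s]) (simp_all add: z)
  have H_nth: "fls_nth (H x) n = H0 (fls_nth x (n + 2)) + H1 (fls_nth x (n + 1))" for x n
    by (simp only: H_def mono_nth fls_plus_nth) (simp add: fls_map_nth z)
  have conn1_nth: "fls_nth (conn1 x) n = s (of_int (n + 1)) (fls_nth x (n + 1))
      + U (fls_nth x (n + 2)) + V (fls_nth x (n + 1))" for x n
    by (simp only: conn1_def mono_nth fls_plus_nth) (simp add: fls_map_nth z d_du_nth[OF s])
  have conn2_nth: "fls_nth (conn2 x) n = s (of_int (n + 1)) (fls_nth x (n + 1))
      + s (1 / 2) (\<Gamma> (fls_nth x (n + 1)))" for x n
    by (simp only: conn2_def mono_nth fls_plus_nth) (simp add: fls_map_nth z d_du_nth[OF s])
  note lin = b(1) B(1) \<Gamma>(1) H0(1) H1(1)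
  have cl: "b x \<in> C" "B x \<in> C" "\<Gamma> x \<in> C" "H0 x \<in> C" "H1 x \<in> C" if "x \<in> C" for x
    using lin that unfolding linear_on_def by auto
  have add: "b (x + y) = b x + b y" "B (x + y) = B x + B y" "\<Gamma> (x + y) = \<Gamma> x + \<Gamma> y"
    "H0 (x + y) = H0 x + H0 y" "H1 (x + y) = H1 x + H1 y" if "x \<in> C" "y \<in> C" for x y
    using lin that unfolding linear_on_def by auto
  have scale: "b (s c x) = s c (b x)" "B (s c x) = s c (B x)" "\<Gamma> (s c x) = s c (\<Gamma> x)"
    if "x \<in> C" for x c
    using lin that unfolding linear_on_def by auto
  have Cs: "s c x \<in> C" if "x \<in> C" for c x using C that by (rule subspace_scale)
  have Ca: "x + y \<in> C" if "x \<in> C" "y \<in> C" for x y using C that by (rule subspace_add)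
  have LC: "fls_nth x n \<in> C" if "x \<in> laurent C" for x n using that by (simp add: laurent_def)
  have linD: "fls_linear_on s C ?D"
    unfolding buB_def
    by (intro fls_linear_on_add[OF s C] fls_linear_on_map[OF s _ C] b B
        fls_linear_on_comp[OF fls_linear_on_monomial[OF s C, where k = 1 and c = 1]]) simp
  have linH: "fls_linear_on s C H"
    unfolding H_def
    by (intro fls_linear_on_add[OF s C] fls_linear_on_map[OF s _ C] H0 H1
        fls_linear_on_comp[OF fls_linear_on_monomial[OF s C mono(1)]]
        fls_linear_on_comp[OF fls_linear_on_monomial[OF s C mono(2)]])
  define A2 where "A2 x = fls_smul s (1 / (2 * fls_X)) (fls_map \<Gamma> x)" for x
  have linA2: "fls_linear_on s C A2"
    unfolding A2_def
    by (intro fls_linear_on_map[OF s _ C] \<Gamma>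
        fls_linear_on_comp[OF fls_linear_on_monomial[OF s C mono(3)]])
  have par: "b x \<in> G (p + 1)" "B x \<in> G (p + 1)" "H0 x \<in> G (p + 1)" "H1 x \<in> G (p + 1)"
    "\<Gamma> x \<in> G (p + 0)" if "x \<in> G p" for x p
    using b(2) B(2) H0(2) H1(2) \<Gamma>(2) that unfolding has_parity_def by blast+
  have Ga: "x + y \<in> G p" if "x \<in> G p" "y \<in> G p" for x y p using Gs that by (rule subspace_add)
  have parD: "has_parity (\<lambda>p. laurent (G p)) 1 ?D"
    unfolding has_parity_def laurent_def mem_Collect_eq D_nth by (blast intro: par Ga)
  have parH: "has_parity (\<lambda>p. laurent (G p)) 1 H"
    unfolding has_parity_def laurent_def mem_Collect_eq H_nth by (blast intro: par Ga)
  have parA2: "has_parity (\<lambda>p. laurent (G p)) 0 A2"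
    unfolding has_parity_def laurent_def mem_Collect_eq A2_def mono_nth fls_map_nth[of \<Gamma>, OF z(3)]
    by (blast intro: par subspace_scale[OF Gs])
  \<comment> \<open>\<open>HU\<close>, \<open>HV\<close> and \<open>HB\<close> are the parts of
    (b+uB)H + H(b+uB) at u^{-2}, u^{-1} and u^0; in the coefficient of u^n they are applied to the
    coefficients n + 2, n + 1 and n of x.\<close>
  have diff: "conn1 x = conn2 x + (?D (H x) + H (?D x))" if x: "x \<in> laurent C" for x
  proof (rule fls_eqI)
    fix n
    let ?x = "\<lambda>k. fls_nth x (n + k)"
    have xk: "fls_nth x k \<in> C" for k using LC[OF x] by auto
    have "fls_nth (?D (H x) + H (?D x)) n = (b (H0 (?x 2)) + H0 (b (?x 2)))
      + (b (H1 (?x 1)) + H1 (b (?x 1)) + (B (H0 (?x 1)) + H0 (B (?x 1))))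
      + (B (H1 (fls_nth x n)) + H1 (B (fls_nth x n)))"
      by (simp add: D_nth H_nth add xk cl algebra_simps)
    also have "\<dots> = U (?x 2) + (V (?x 1) - s (1 / 2) (\<Gamma> (?x 1)))"
      by (simp only: HU HV HB xk add_0_right)
    finally show "fls_nth (conn1 x) n = fls_nth (conn2 x + (?D (H x) + H (?D x))) n"
      by (simp add: conn1_nth conn2_nth)
  qed
  have D_in: "?D x \<in> laurent C" "H x \<in> laurent C" if "x \<in> laurent C" for x
    using linD linH that unfolding fls_linear_on_def by blast+
  have DD: "?D (?D x) = 0" if x: "x \<in> laurent C" for x
  proof (rule fls_eqI)
    fix n
    have xk: "fls_nth x k \<in> C" for k using LC[OF x] by auto
    have "fls_nth (?D (?D x)) n = b (b (fls_nth x n)) +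
       (b (B (fls_nth x (n - 1))) + B (b (fls_nth x (n - 1)))) + B (B (fls_nth x (n - 1 - 1)))"
      by (simp only: D_nth add xk cl add.assoc)
    then show "fls_nth (?D (?D x)) n = fls_nth 0 n"
      by (simp only: bB xk add_0_left add_0_right fls_zero_nth)
  qed
  have comm2: "conn2 (?D x) - ?D (conn2 x) = fls_smul s (1 / (2 * fls_X)) (?D x)"
    if x: "x \<in> laurent C" for x
  proof (rule fls_eqI)
    fix n
    let ?y = "fls_nth x (n + 1)" and ?z = "fls_nth x n"
    have xk: "fls_nth x k \<in> C" for k using LC[OF x] by auto
    note [simp] = add scale cl Cs Ca xk
    have "fls_nth (conn2 (?D x) - ?D (conn2 x)) n =
       (s (of_int (n + 1)) (b ?y + B ?z) + s (1/2) (\<Gamma> (b ?y) + \<Gamma> (B ?z))) -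
       ((s (of_int (n + 1)) (b ?y) + s (1/2) (b (\<Gamma> ?y)))
        + (s (of_int n) (B ?z) + s (1/2) (B (\<Gamma> ?z))))"
      by (simp add: D_nth conn2_nth)
    \<comment> \<open>The free summand \<open>B ?z\<close> is [d/du, uB] = B: the factors n + 1 and
      n differ by 1.\<close>
    also have "\<dots> = B ?z + s (1/2) ((\<Gamma> (b ?y) - b (\<Gamma> ?y)) + (\<Gamma> (B ?z) - B (\<Gamma> ?z)))"
      by (simp add: algebra_simps scale_left_distrib scale_right_distrib scale_right_diff_distrib)
    also have "\<dots> = s 1 (B ?z) - s (1/2) (B ?z) + s (1/2) (b ?y)"
      by (simp add: \<Gamma>b \<Gamma>B scale_right_distrib scale_right_diff_distrib del: scale_one)
         (simp add: scale_right_diff_distrib)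
    also have "\<dots> = s (1 - 1/2) (B ?z) + s (1/2) (b ?y)"
      by (simp only: scale_left_diff_distrib)
    \<comment> \<open>B from d/du minus B/2 from \<open>\<Gamma>\<close> has to be B/2; here
      characteristic different from 2 enters.\<close>
    also have "(1::'k) - 1/2 = 1/2" using two by (simp add: field_simps)
    finally show "fls_nth (conn2 (?D x) - ?D (conn2 x)) n =
        fls_nth (fls_smul s (1 / (2 * fls_X)) (?D x)) n"
      by (simp add: mono_nth D_nth scale_right_distrib add.commute)
  qed
  have conn2_in: "conn2 x \<in> laurent C" if "x \<in> laurent C" for x
    using LC[OF that] by (auto simp: laurent_def conn2_nth intro!: Ca Cs cl)
  have addD: "?D (x + y) = ?D x + ?D y" if "x \<in> laurent C" "y \<in> laurent C" for x y
    using linD that unfolding fls_linear_on_def by blast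
  have addH: "H (x + y) = H x + H y" if "x \<in> laurent C" "y \<in> laurent C" for x y
    using linH that unfolding fls_linear_on_def by blast
  have La: "x + y \<in> laurent C" if "x \<in> laurent C" "y \<in> laurent C" for x y
    using that Ca by (simp add: laurent_def)
  have "H 0 = 0" by (rule fls_eqI) (simp add: H_nth z)
  have comm1: "conn1 (?D x) - ?D (conn1 x) = fls_smul s (1 / (2 * fls_X)) (?D x)"
    if x: "x \<in> laurent C" for x
  proof -
    have "conn1 (?D x) = conn2 (?D x) + ?D (H (?D x))"
      using diff[of "?D x"] x \<open>H 0 = 0\<close> by (simp add: D_in DD)
    moreover have "?D (conn1 x) = ?D (conn2 x) + ?D (H (?D x))"
      using x by (simp add: diff addD La D_in conn2_in DD)
    ultimately show ?thesis using comm2[OF x] by simp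
  qed
  show "u_connection s C G b B conn2"
    unfolding u_connection_def using linA2 parA2 comm2
    by (intro conjI exI[of _ A2]) (auto simp: conn2_def A2_def)
  show "equal_up_to_u_homotopy s C G b B conn1 conn2"
    unfolding equal_up_to_u_homotopy_def using linH parH diff
    by (intro exI[of _ H]) auto
  \<comment> \<open>The linear part of \<open>conn1\<close> is taken in the form given by
    \<open>diff\<close>, since linearity and parity are known for \<open>A2\<close>, b + uB and
    H.\<close>
  define A1 where "A1 x = A2 x + (?D (H x) + H (?D x))" for x
  have "fls_linear_on s C A1"
    unfolding A1_def
    by (intro fls_linear_on_add[OF s C] linA2 fls_linear_on_comp[OF linD linH]
        fls_linear_on_comp[OF linH linD])
  moreover have "has_parity (\<lambda>p. laurent (G p)) 0 A1"
  proof -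
    have "?D (H x) \<in> laurent (G p)" "H (?D x) \<in> laurent (G p)" "A2 x \<in> laurent (G p)"
      if "x \<in> laurent (G p)" for x p
    proof -
      have "p + 1 + 1 = p" by (cases p) auto
      moreover have "?D (H x) \<in> laurent (G (p + 1 + 1))" "H (?D x) \<in> laurent (G (p + 1 + 1))"
        using parD parH that unfolding has_parity_def by blast+
      ultimately show "?D (H x) \<in> laurent (G p)" "H (?D x) \<in> laurent (G p)" by simp_all
      show "A2 x \<in> laurent (G p)" using parA2 that unfolding has_parity_def add_0_right by blast
    qed
    then show ?thesis unfolding has_parity_def A1_def
      by (simp add: laurent_def Ga)
  qed
  ultimately show "u_connection s C G b B conn1"
    unfolding u_connection_def using comm1 diff
    by (intro conjI exI[of _ A1]) (auto simp: A1_def A2_def conn2_def add.assoc)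
qed

section \<open>Linear operators on tensors\<close>

interpretation TS: vector_space "tscale :: 'k::field \<Rightarrow> ('v, 'k) tens \<Rightarrow> ('v, 'k) tens"
  by (rule vector_space_tscale)

text \<open>\<open>lin_ext\<close> and \<open>hom_ext\<close> yield maps that are linear on all
  functionals, so linearity is stated without a carrier set; spans enter only when operators are
  compared or their values located.\<close>

definition lin :: "(('v, 'k::field) tens \<Rightarrow> ('w, 'k) tens) \<Rightarrow> bool" where
  "lin X \<longleftrightarrow> (\<forall>x y. X (x + y) = X x + X y) \<and> (\<forall>c x. X (tscale c x) = tscale c (X x))"

lemma linD: "lin X \<Longrightarrow> X (x + y) = X x + X y" "lin X \<Longrightarrow> X (tscale c x) = tscale c (X x)"
  unfolding lin_def by blast+

lemma lin_0: "lin X \<Longrightarrow> X 0 = 0"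
  using linD(2)[of X 0 0] by simp

lemma lin_uminus_eq: "lin X \<Longrightarrow> X (- x) = - X x"
  using linD(1)[of X x "- x"] lin_0[of X] by (simp add: eq_neg_iff_add_eq_0 add.commute)

lemma lin_diff_eq: "lin X \<Longrightarrow> X (x - y) = X x - X y"
  using linD(1)[of X x "- y"] lin_uminus_eq[of X y] by simp

lemma lin_sum_eq: "lin X \<Longrightarrow> X (\<Sum>i\<in>I. f i) = (\<Sum>i\<in>I. X (f i))"
  by (induction I rule: infinite_finite_induct) (simp_all add: lin_0[of X] linD[of X])

lemmas lin_simps = linD lin_0 lin_uminus_eq lin_diff_eq lin_sum_eq

lemma lin_id: "lin (\<lambda>x. x)" and lin_zero: "lin (\<lambda>x. 0)"
  by (simp_all add: lin_def)

lemma lin_add: "lin X \<Longrightarrow> lin Y \<Longrightarrow> lin (\<lambda>x. X x + Y x)"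
  and lin_diff: "lin X \<Longrightarrow> lin Y \<Longrightarrow> lin (\<lambda>x. X x - Y x)"
  and lin_uminus: "lin X \<Longrightarrow> lin (\<lambda>x. - X x)"
  and lin_scale: "lin X \<Longrightarrow> lin (\<lambda>x. tscale c (X x))"
  by (simp_all add: lin_def TS.scale_right_distrib TS.scale_right_diff_distrib
      TS.scale_left_commute)

lemma lin_sum: "(\<And>i. i \<in> I \<Longrightarrow> lin (X i)) \<Longrightarrow> lin (\<lambda>x. \<Sum>i\<in>I. X i x)"
  by (induction I rule: infinite_finite_induct) (simp_all add: lin_zero lin_add)

lemma lin_funpow:
  fixes X :: "('v, 'k::field) tens \<Rightarrow> ('v, 'k) tens"
  shows "lin X \<Longrightarrow> lin Y \<Longrightarrow> lin (\<lambda>x. (X ^^ n) (Y x))"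
  by (induction n) (simp_all add: lin_def)

lemma lin_lin_ext: "lin Y \<Longrightarrow> lin (\<lambda>x. lin_ext F (Y x))"
  by (simp add: lin_def lin_ext_def tscale_def fun_eq_iff)

lemma lin_hom_ext: "lin Y \<Longrightarrow> lin (\<lambda>x. hom_ext G F (Y x))"
  unfolding hom_ext_def by (rule lin_lin_ext)

lemmas lin_intros = lin_id lin_zero lin_add lin_diff lin_uminus lin_scale lin_sum lin_lin_ext
    lin_hom_ext

lemma lin_eq_on_span:
  assumes "x \<in> TS.span M" and X: "lin X" and Y: "lin Y" and eq: "\<And>y. y \<in> M \<Longrightarrow> X y = Y y"
  shows "X x = Y x"
proof -
  have "TS.subspace {x. X x = Y x}"
    by (rule TS.subspaceI)
      (simp_all only: linD[OF X] linD[OF Y] lin_0[OF X] lin_0[OF Y] mem_Collect_eq)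
  moreover have "M \<subseteq> {x. X x = Y x}" using eq by blast
  ultimately have "TS.span M \<subseteq> {x. X x = Y x}" by (simp only: TS.span_minimal)
  then show ?thesis using assms(1) by blast
qed

lemma lin_in_span:
  assumes "x \<in> TS.span M" and X: "lin X" and in_span: "\<And>y. y \<in> M \<Longrightarrow> X y \<in> TS.span N"
  shows "X x \<in> TS.span N"
proof -
  have "TS.subspace {x. X x \<in> TS.span N}"
    by (rule TS.subspaceI)
      (simp_all only: linD[OF X] lin_0[OF X] mem_Collect_eq TS.span_zero TS.span_add TS.span_scale)
  moreover have "M \<subseteq> {x. X x \<in> TS.span N}" using in_span by blast
  ultimately have "TS.span M \<subseteq> {x. X x \<in> TS.span N}" by (simp only: TS.span_minimal)
  then show ?thesis using assms(1) by blast
qed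

text \<open>Linearity in a letter compares words of equal length only, so the operator may depend on
  the length, as b, N and \<Gamma> do through n.\<close>

lemma multilin_comp_lin:
  assumes s: "vector_space s" and F: "multilin s tscale F" and X: "\<And>n. lin (X n)"
  shows "multilin s tscale (\<lambda>w. X (length w) (F w))"
  using F X TS.vector_space_axioms unfolding multilin_def linear_iff' lin_def by simp

lemma lin_ext_length:
  assumes s: "vector_space s" and X: "\<And>n. lin (X n)"
    and span: "\<And>w. X (length w) (tensor s w) \<in> TS.span (range (tensor s))"
  shows "lin_ext (\<lambda>w. X (length w) (tensor s w)) (tensor s w) = X (length w) (tensor s w)"
  by (rule lin_ext_tensor[OF multilin_comp_lin[OF s multilin_tensor[OF s] X] span])

section \<open>Cancellation patterns in double sums\<close>

text \<open>Pattern of the square of a sum of anticommuting operators of square zero.\<close>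

lemma sum_antisym_eq_0:
  fixes f :: "nat \<Rightarrow> nat \<Rightarrow> 'v::ab_group_add"
  assumes "\<And>i. i \<le> n \<Longrightarrow> f i i = 0" "\<And>i j. i < j \<Longrightarrow> j \<le> n \<Longrightarrow> f i j = - f j i"
  shows "(\<Sum>i\<le>n. \<Sum>j\<le>n. f i j) = 0"
  using assms
proof (induction n)
  case (Suc n)
  have "(\<Sum>i\<le>n. f i (Suc n)) = - (\<Sum>i\<le>n. f (Suc n) i)"
    unfolding sum_negf[symmetric] by (rule sum.cong) (simp_all add: Suc.prems)
  then show ?case using Suc by (simp add: sum.distrib)
qed simp

text \<open>Pattern of the square of a simplicial boundary whose signs sit in the faces: the pair
  (i, j) with i < j cancels the pair (j - 1, i), and these exhaust the rectangle.\<close>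

lemma sum_presimplicial_eq_0:
  fixes f :: "nat \<Rightarrow> nat \<Rightarrow> 'v::ab_group_add"
  assumes "\<And>i j. i < j \<Longrightarrow> j \<le> Suc n \<Longrightarrow> f i j = - f (j - 1) i"
  shows "(\<Sum>i\<le>n. \<Sum>j\<le>Suc n. f i j) = 0"
  using assms
proof (induction n)
  case 0
  then show ?case using 0[of 0 1] by simp
next
  case (Suc n)
  have "(\<Sum>i\<le>n. f i (Suc (Suc n))) = - (\<Sum>i\<le>n. f (Suc n) i)"
    unfolding sum_negf[symmetric] by (rule sum.cong) (simp_all add: Suc.prems)
  moreover have "f (Suc n) (Suc (Suc n)) = - f (Suc n) (Suc n)"
    using Suc.prems[of "Suc n" "Suc (Suc n)"] by simp
  moreover have "(\<Sum>i\<le>n. \<Sum>j\<le>Suc n. f i j) = 0" using Suc by simp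
  ultimately show ?case by (simp add: sum.distrib algebra_simps)
qed

lemma sum_atMost_split:
  fixes f :: "nat \<Rightarrow> 'v::comm_monoid_add"
  assumes "i \<le> Suc n"
  shows "sum f {..n} = sum f {..<i} + sum f {i..n}"
proof -
  have "{..n} = {..<i} \<union> {i..n}" using assms by auto
  then show ?thesis by (simp add: sum.union_disjoint ivl_disj_int)
qed

lemma lin_if: "lin X \<Longrightarrow> lin Y \<Longrightarrow> lin (\<lambda>x. if b then X x else Y x)"
  by (cases b) simp_all

section \<open>Words of homogeneous letters\<close>

lemma ksign_minus: "- ksign p = ksign (p + 1)"
  by (cases p) (simp_all add: ksign_def)

text \<open>Letters are paired with their degrees. \<open>sh\<close> is the parity for which all letters, including
  $a_0$, are shifted; it differs from \<open>word_par\<close> by 1.\<close>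

type_synonym ('a, 'k) lword = "(int \<times> 'a \<times> 'k) list"

definition sh :: "('a, 'k) lword \<Rightarrow> bit" where
  "sh lw = (\<Sum>z\<leftarrow>lw. of_int (fst z) + 1)"

lemma sh_simps [simp]: "sh [] = 0" "sh (z # lw) = of_int (fst z) + 1 + sh lw" "sh (lw @ lw') =
    sh lw + sh lw'"
  by (simp_all add: sh_def)

abbreviation pars :: "('a, 'k) lword \<Rightarrow> bit list" where
  "pars \<equiv> map (\<lambda>z. of_int (fst z))"

lemma sum_pars: "(\<Sum>k<length xs. pars (xs @ ys) ! k - 1) = sh xs"
proof (induction xs rule: rev_induct)
  case (snoc x xs)
  have "(\<Sum>k<length xs. pars ((xs @ [x]) @ ys) ! k - 1) = sh xs"
    using snoc by (simp add: nth_append)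
  then show ?case by (simp add: nth_append)
qed simp

lemma sum_pars_Cons: "(\<Sum>k=1..length xs. pars (x # xs @ ys) ! k - 1) = sh xs"
  using sum_pars[of xs ys] by (simp add: sum.atLeast1_atMost_eq)

lemma bit_add_1_1: "(p :: bit) + 1 + 1 = p"
  by (cases p) simp_all

section \<open>The Z-graded algebra and the formulas on homogeneous words\<close>

locale lifted_dga =
  fixes A :: "('a::ring, 'k::field) dga_data" and D :: "int \<Rightarrow> 'a set"
  assumes A: "dg_algebra A" and D: "Z_grading_lift A D"
begin

sublocale S: vector_space "smul A" using A by (simp add: dg_algebra_def)

lemma smul_mult: "smul A c x * y = smul A c (x * y)" "x * smul A c y = smul A c (x * y)"
  using A unfolding dg_algebra_def by metis+

lemma dif_simps: "dif A (x + y) = dif A x + dif A y" "dif A (smul A c x) =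
    smul A c (dif A x)" "dif A (dif A x) = 0"
  using A unfolding dg_algebra_def linear_iff' by blast+

lemma dif_0: "dif A 0 = 0"
  using dif_simps(1)[of 0 0] by simp

lemma D_props: "x \<in> D i \<Longrightarrow> x \<in> par A (of_int i)" "x \<in> D i \<Longrightarrow> y \<in> D j \<Longrightarrow> x * y \<in> D (i + j)"
  "x \<in> D i \<Longrightarrow> dif A x \<in> D (i + 1)" "S.subspace (D i)"
  using D unfolding Z_grading_lift_def is_grading_def by blast+

lemma ext_gr_par: "x \<in> ext_gr D i \<Longrightarrow> x \<in> ext_gr (par A) (of_int i)"
  using D_props(1)[of "fst x" i] by (auto simp: ext_gr_def split: if_splits)

lemma ext_mult_gr: "x \<in> ext_gr D i \<Longrightarrow> y \<in> ext_gr D j \<Longrightarrow> ext_mult A x y \<in> ext_gr D (i + j)"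
  using D_props(2)[of "fst x" i "fst y" j] S.subspace_scale[OF D_props(4)] S.subspace_0[OF
      D_props(4)]
  by (auto simp: ext_gr_def ext_mult_def split: if_splits intro!: S.subspace_add[OF D_props(4)])

lemma ext_dif_gr: "x \<in> ext_gr D i \<Longrightarrow> ext_dif A x \<in> ext_gr D (i + 1)"
  using D_props(3)[of "fst x" i] by (auto simp: ext_gr_def ext_dif_def split: if_splits)

lemma ext_assoc: "ext_mult A (ext_mult A x y) z = ext_mult A x (ext_mult A y z)"
  by (simp add: ext_mult_def smul_mult algebra_simps S.scale_right_distrib)

lemma ext_dif_dif: "ext_dif A (ext_dif A x) = 0"
  by (simp add: ext_dif_def dif_simps zero_prod_def)

text \<open>A homogeneous x with non-zero e-component has degree 0; there the sign is +1, which is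
  what the terms coming from e require, since de = 0.\<close>

lemma ext_leibniz:
  assumes "x \<in> ext_gr D i"
  shows "ext_dif A (ext_mult A x y) =
    ext_mult A (ext_dif A x) y + ext_smul A (ksign (of_int i)) (ext_mult A x (ext_dif A y))"
proof -
  have x: "fst x \<in> par A (of_int i)" "i \<noteq> 0 \<Longrightarrow> snd x = 0"
    using assms D_props(1)[of "fst x" i] by (auto simp: ext_gr_def split: if_splits)
  have "dif A (fst x * fst y) = dif A (fst x) * fst y +
      smul A (ksign (of_int i)) (fst x * dif A (fst y))"
    using A x(1) unfolding dg_algebra_def by blast
  then show ?thesis
    using x(2) by (cases "i = 0")
      (simp_all add: ext_dif_def ext_mult_def ext_smul_def dif_simps ksign_def
          S.scale_right_distrib)
qed

definition good :: "('a, 'k) lword \<Rightarrow> bool" where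
  "good lw \<longleftrightarrow> (\<forall>z\<in>set lw. snd z \<in> ext_gr D (fst z))"

lemma good_simps [simp]: "good []" "good (z # lw) \<longleftrightarrow> snd z \<in> ext_gr D (fst z) \<and> good lw"
  "good (lw @ lw') \<longleftrightarrow> good lw \<and> good lw'"
  by (auto simp: good_def)

definition T :: "('a, 'k) lword \<Rightarrow> ('a, 'k) chain" where
  "T lw = tns A (map snd lw)"

lemma homog: "good lw \<Longrightarrow> homog A (pars lw) (map snd lw)"
  by (auto simp: homog_def good_def ext_gr_par)

text \<open>\<open>T\<close> forgets the degree labels, so they are arbitrary and may differ between
  the words. This matters for the Leibniz rule, which produces the labels d + d' + 1, d + 1 + d' and
  d + (d' + 1).\<close>

lemma T_letter: "T (xs @ (d, x + y) # ys) = T (xs @ (d1, x) # ys) + T (xs @ (d2, y) # ys)"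
  "T (xs @ (d, ext_smul A c x) # ys) = tscale c (T (xs @ (d1, x) # ys))"
  "T (xs @ (d, 0) # ys) = 0"
proof -
  have *: "Vector_Spaces.linear (ext_smul A) tscale (\<lambda>x. tns A (map snd xs @ x # map snd ys))"
    using multilin_tensor[OF vs_ext[OF A]] unfolding multilin_def by blast
  show **: "T (xs @ (d, x + y) # ys) = T (xs @ (d1, x) # ys) +
      T (xs @ (d2, y) # ys)" for d d1 d2 x y
    using * unfolding linear_iff' T_def by (simp only: list.map map_append snd_conv)
  show "T (xs @ (d, ext_smul A c x) # ys) = tscale c (T (xs @ (d1, x) # ys))"
    using * unfolding linear_iff' T_def by (simp only: list.map map_append snd_conv)
  show "T (xs @ (d, 0) # ys) = 0"
    using **[of d 0 0 d d] by simp
qed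

abbreviation "\<delta> \<equiv> delta A"
abbreviation "\<mu> \<equiv> mu A"
abbreviation "\<tau> \<equiv> tau A"

lemma delta_T:
  assumes "good (xs @ (d, x) # ys)" and "i = length xs"
  shows "\<delta> i (T (xs @ (d, x) # ys)) = tscale (ksign (sh xs)) (T (xs @ (d + 1, ext_dif A x) # ys))"
proof -
  have "\<delta> i (T (xs @ (d, x) # ys)) = tscale (ksign (\<Sum>k<length xs. pars (xs @ (d, x) # ys) ! k - 1))
     (T (xs @ (d + 1, ext_dif A x) # ys))"
    unfolding T_def assms(2) by (subst delta_tensor[OF A homog[OF assms(1)]]) (simp_all add:
        nth_append list_update_append)
  then show ?thesis unfolding sum_pars .
qed

lemma delta_T_zero: "length lw \<le> i \<Longrightarrow> \<delta> i (T lw) = 0"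
  by (auto simp: T_def delta_def hom_ext_def lin_ext_def tensor_def fun_eq_iff)

lemma mu_T:
  assumes "good (xs @ (d, x) # (d', y) # ys)" and "i = length xs"
  shows "\<mu> i (T (xs @ (d, x) # (d', y) # ys)) =
     tscale (ksign (sh xs + of_int d)) (T (xs @ (d + d', ext_mult A x y) # ys))"
proof -
  have "(\<Sum>k\<le>length xs. pars (xs @ (d, x) # (d', y) # ys) ! k - 1) + 1 = sh (xs @ [(d, x)]) + 1"
    using sum_pars[of "xs @ [(d, x)]" "(d', y) # ys"] by (simp add: lessThan_Suc_atMost)
  \<comment> \<open>|sa_i| + 1 = |a_i|: the sign of \<mu>^(i) counts the letters before a_i as
    shifted and a_i itself as unshifted.\<close>
  also have "\<dots> = sh xs + of_int d" by (cases "of_int d :: bit") simp_all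
  finally show ?thesis
    unfolding T_def assms(2) by (subst mu_tensor[OF A homog[OF assms(1)]]) (simp add: nth_append
        Let_def)
qed

lemma mu_0_T:
  assumes "x \<in> ext_gr D d" "y \<in> ext_gr D d'" "good ws"
  shows "\<mu> 0 (T ((d, x) # (d', y) # ws)) = tscale (ksign (of_int d)) (T ((d +
      d', ext_mult A x y) # ws))"
  using mu_T[of "[]" d x d' y ws 0] assms by simp

lemma mu_T_last:
  assumes "good ((d, x) # ys @ [(d', y)])" and "i = Suc (length ys)"
  shows "\<mu> i (T ((d, x) # ys @ [(d', y)])) =
     tscale (ksign ((of_int d' + 1) * (of_int d + sh ys) + 1)) (T ((d' + d, ext_mult A y x) # ys))"
proof -
  note sum = sum_pars_Cons[of "(d, x)" ys "[(d', y)]"]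
  show ?thesis
    using sum unfolding T_def assms(2)
    by (subst mu_tensor[OF A homog[OF assms(1)]]) (simp add: nth_append Let_def ksign_minus)
qed

lemma mu_T_zero: "good lw \<Longrightarrow> length lw \<le> 1 \<or> length lw \<le> i \<Longrightarrow> \<mu> i (T lw) = 0"
  unfolding T_def by (subst mu_tensor[OF A homog]) (auto simp: Let_def)

lemma tau_T:
  assumes "good (z # ys)"
  shows "\<tau> (T (z # ys)) = tscale (ksign ((of_int (fst z) + 1) * sh ys)) (T (ys @ [z]))"
  using sum_pars_Cons[of z ys "[]"] unfolding T_def
  by (subst tau_tensor[OF A homog[OF assms]]) (simp add: rotate1_def)

text \<open>Defined through the Z-grading, unlike \<delta>, \<mu> and \<tau>, which see parities
  only. The eigenvalue is the image of the degree in k.\<close>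

definition E :: "nat \<Rightarrow> ('a, 'k) chain \<Rightarrow> ('a, 'k) chain" where
  "E i = hom_ext (ext_gr D) (\<lambda>ds w. if i < length w then tscale (of_int (ds ! i)) (tns A w) else 0)"

lemma gr_ext_D: "is_grading (ext_smul A) UNIV (ext_gr D)"
  by (rule gr_ext[OF A]) (use D in \<open>unfold Z_grading_lift_def, blast\<close>)

lemma multilin_word: "multilin (ext_smul A) tscale (\<lambda>w. if length w =
    m then tscale c (tns A w) else 0)"
  by (rule multilin_tensor_word[OF vs_ext[OF A]]) (use vector_space_ext_props(1)[OF A] in blast)

text \<open>Common form of E and \<Gamma>': diagonal on homogeneous words, with an eigenvalue read
  off from the length and the degrees.\<close>

lemma hom_ext_length_T:
  assumes "good lw"
  shows "hom_ext (ext_gr D) (\<lambda>ds w. tscale (c (length w) ds) (tns A w)) (T lw) =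
    tscale (c (length lw) (map fst lw)) (T lw)"
  unfolding T_def
proof (subst hom_ext_tensor[OF vs_ext[OF A] gr_ext_D, where ds = "map fst lw"])
  show "multilin (ext_smul A) tscale
    (\<lambda>w. if length w = length ds then tscale (c (length w) ds) (tns A w) else 0)" for ds
    using multilin_word[of "length ds" "c (length ds) ds"] by (simp cong: if_cong)
qed (use assms in \<open>auto simp: good_def tensor_in_span\<close>)

lemma E_T: "good lw \<Longrightarrow> E i (T lw) = tscale (if i < length lw then of_int (fst (lw ! i)) else 0) (T
    lw)"
proof -
  have "E i = hom_ext (ext_gr D) (\<lambda>ds w. tscale (if i < length w then of_int (ds ! i) else 0) (tns
      A w))"
    unfolding E_def by (rule arg_cong[where f = "hom_ext (ext_gr D)"]) (auto simp: fun_eq_iff)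
  then show "good lw \<Longrightarrow> E i (T lw) = tscale (if i < length lw then of_int (fst (lw ! i)) else 0) (T
      lw)"
    by (simp add: hom_ext_length_T[where c = "\<lambda>n ds. if i < n then of_int (ds ! i) else 0"])
qed

lemma Gamma'_T: "good lw \<Longrightarrow> length lw = Suc n \<Longrightarrow>
   Gamma' A D (T lw) = tscale ((\<Sum>i\<le>n. of_int (fst (lw ! i))) - of_nat n) (T lw)"
proof -
  assume lw: "good lw" "length lw = Suc n"
  have "Gamma' A D (T lw) = tscale (of_int ((\<Sum>i=0..n. fst (lw ! i)) - int n)) (T lw)"
    unfolding Gamma'_def Let_def using hom_ext_length_T[OF lw(1),
      where c = "\<lambda>n ds. of_int ((\<Sum>i = 0..n - 1. ds ! i) - int (n - 1))"] lw(2) by simp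
  then show ?thesis by (simp add: atMost_atLeast0)
qed

lemma lin_delta: "lin Y \<Longrightarrow> lin (\<lambda>x. \<delta> i (Y x))" and lin_mu: "lin Y \<Longrightarrow> lin (\<lambda>x. \<mu> i (Y x))"
  and lin_tau: "lin Y \<Longrightarrow> lin (\<lambda>x. \<tau> (Y x))" and lin_E: "lin Y \<Longrightarrow> lin (\<lambda>x. E i (Y x))"
  unfolding delta_def mu_def tau_def E_def by (rule lin_hom_ext, assumption)+

lemma lin_tau_pow: "lin Y \<Longrightarrow> lin (\<lambda>x. (\<tau> ^^ i) (Y x))"
  by (rule lin_funpow[OF lin_tau[OF lin_id]])

lemmas lin_ops = lin_delta lin_mu lin_tau lin_E lin_tau_pow

lemmas op_simps =
  lin_simps[OF lin_delta[OF lin_id]] lin_simps[OF lin_mu[OF lin_id]]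
  lin_simps[OF lin_tau[OF lin_id]] lin_simps[OF lin_E[OF lin_id]] lin_simps[OF lin_tau_pow[OF
      lin_id]]

section \<open>Spans of words of fixed length\<close>

text \<open>Letters range over A^e and e may stand anywhere, so that identities on
  \<open>chains\<close> apply to C(A) and to the image of \<open>he A\<close> alike.\<close>

definition chains :: "nat \<Rightarrow> ('a, 'k) chain set" where
  "chains n = TS.span {T lw |lw. good lw \<and> length lw = n}"

definition A_lword :: "('a, 'k) lword \<Rightarrow> bool" where
  "A_lword lw \<longleftrightarrow> (\<forall>z\<in>set lw. snd (snd z) = 0)"

lemma A_lword_simps [simp]: "A_lword []" "A_lword (z # lw) \<longleftrightarrow> snd (snd z) = 0 \<and> A_lword lw"
  "A_lword (lw @ lw') \<longleftrightarrow> A_lword lw \<and> A_lword lw'"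
  by (auto simp: A_lword_def)

text \<open>The index p is the parity with a_0 shifted as well. It differs by 1 from the parity in
  C(A), but equals the parity of the word in C^+(A) obtained by putting e in front.\<close>

definition A_chains :: "bit \<Rightarrow> nat \<Rightarrow> ('a, 'k) chain set" where
  "A_chains p n = TS.span {T lw |lw. good lw \<and> length lw = n \<and> A_lword lw \<and> sh lw = p}"

lemma A_chains_chains: "x \<in> A_chains p n \<Longrightarrow> x \<in> chains n"
  unfolding A_chains_def chains_def by (erule TS.span_mono[THEN subsetD, rotated]) blast

lemma chains_eqI:
  assumes "lin X" "lin Y" "\<And>lw. good lw \<Longrightarrow> length lw = n \<Longrightarrow> X (T lw) = Y (T lw)" "x \<in> chains n"
  shows "X x = Y x"
  using assms(4) unfolding chains_def by (rule lin_eq_on_span[OF _ assms(1,2)]) (use assms(3) in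
      blast)

text \<open>Each basic operator sends a homogeneous word to a multiple of a single homogeneous word,
  whence the shape of the hypothesis.\<close>

lemma chains_in:
  assumes "lin X" "x \<in> chains n"
    and "\<And>lw. good lw \<Longrightarrow> length lw = n \<Longrightarrow> \<exists>c lw'. X (T lw) = tscale c (T lw') \<and> good lw' \<and>
        length lw' = m"
  shows "X x \<in> chains m"
  using assms(2) unfolding chains_def
proof (rule lin_in_span[OF _ assms(1)])
  fix y assume "y \<in> {T lw |lw. good lw \<and> length lw = n}"
  then obtain c lw' where "X y = tscale c (T lw')" "good lw'" "length lw' = m"
      using assms(3) by blast
  then show "X y \<in> TS.span {T lw |lw. good lw \<and> length lw = m}"
    by (simp only:) (intro TS.span_scale TS.span_base, blast)
qed

lemma A_chains_in:
  assumes "lin X" "x \<in> A_chains p n"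
    and "\<And>lw. good lw \<Longrightarrow> length lw = n \<Longrightarrow> A_lword lw \<Longrightarrow> sh lw = p \<Longrightarrow> \<exists>c lw'. X (T lw) = tscale c (T lw')
      \<and> good lw' \<and> length lw' = m \<and> A_lword lw' \<and> sh lw' = q"
  shows "X x \<in> A_chains q m"
  using assms(2) unfolding A_chains_def
proof (rule lin_in_span[OF _ assms(1)])
  fix y assume "y \<in> {T lw |lw. good lw \<and> length lw = n \<and> A_lword lw \<and> sh lw = p}"
  then obtain c lw' where "X y = tscale c (T lw')" "good lw'" "length lw' =
      m" "A_lword lw'" "sh lw' = q"
    using assms(3) by blast
  then show "X y \<in> TS.span {T lw |lw. good lw \<and> length lw = m \<and> A_lword lw \<and> sh lw = q}"
    by (simp only:) (intro TS.span_scale TS.span_base, blast)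
qed

lemma split_at:
  assumes "i < length lw"
  obtains xs d x ys where "lw = xs @ (d, x) # ys" "length xs = i"
  using id_take_nth_drop[OF assms] assms by (metis length_take min.absorb4 surj_pair)

lemma split_two:
  assumes "Suc i < length lw"
  obtains xs d x d' y ys where "lw = xs @ (d, x) # (d', y) # ys" "length xs = i"
proof -
  obtain xs d x zs where 1: "lw = xs @ (d, x) # zs" "length xs = i"
    using split_at[of i lw] assms by (metis Suc_lessD)
  then obtain z ys where "zs = z # ys" using assms by (cases zs) auto
  then show ?thesis using 1 that by (cases z) simp
qed

lemma split_ends:
  assumes "length lw = Suc (Suc n)"
  obtains d x ys d' y where "lw = (d, x) # ys @ [(d', y)]" "length ys = n"
proof -
  obtain z zs where 1: "lw = z # zs" "length zs = Suc n" using assms by (cases lw) auto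
  then obtain ys z' where "zs = ys @ [z']" "length ys = n" by (cases zs rule: rev_cases) auto
  then show ?thesis using 1 that by (cases z; cases z') simp
qed

lemma delta_word:
  assumes "good lw" "i < length lw"
  shows "\<exists>c lw'. \<delta> i (T lw) = tscale c (T lw') \<and> good lw' \<and> length lw' = length lw \<and>
    (A_lword lw \<longrightarrow> A_lword lw') \<and> sh lw' = sh lw + 1 \<and>
        map fst lw' = (map fst lw)[i := fst (lw ! i) + 1]"
proof -
  obtain xs d x ys where lw: "lw = xs @ (d, x) # ys" "length xs = i" using split_at[OF assms(2)] .
  have "\<delta> i (T lw) = tscale (ksign (sh xs)) (T (xs @ (d + 1, ext_dif A x) # ys))"
    using assms(1) lw by (simp add: delta_T)
  moreover have "sh (xs @ (d + 1, ext_dif A x) # ys) = sh lw + 1"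
    unfolding lw(1) by (cases "of_int d :: bit"; cases "sh xs"; cases "sh ys") simp_all
  moreover have "good (xs @ (d + 1, ext_dif A x) # ys)"
    using assms(1) unfolding lw(1) by (simp add: ext_dif_gr)
  moreover have "A_lword lw \<longrightarrow> A_lword (xs @ (d + 1, ext_dif A x) # ys)"
    unfolding lw(1) by (simp add: ext_dif_def)
  moreover have "length (xs @ (d + 1, ext_dif A x) # ys) = length lw"
    "map fst (xs @ (d + 1, ext_dif A x) # ys) = (map fst lw)[i := fst (lw ! i) + 1]"
    unfolding lw(1) lw(2)[symmetric] by (simp_all add: list_update_append)
  ultimately show ?thesis by blast
qed

text \<open>Position 0 is left out of the degree statement because \<mu>^(n) multiplies the last
  letter into it. The positions k \<ge> 1 serve the derivation rule for E^(k), the sum of the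
  degrees serves the Lie derivative.\<close>

lemma mu_word:
  assumes "good lw" "length lw = Suc n" "i \<le> n" "n \<ge> 1"
  shows "\<exists>c lw'. \<mu> i (T lw) = tscale c (T lw') \<and> good lw' \<and> length lw' = n \<and>
    (A_lword lw \<longrightarrow> A_lword lw') \<and> sh lw' = sh lw + 1 \<and>
    (\<forall>k\<in>{1..<n}. fst (lw' ! k) = (if k < i then fst (lw ! k) else
       if k = i then fst (lw ! k) + fst (lw ! Suc k) else fst (lw ! Suc k))) \<and>
    (\<Sum>z\<leftarrow>lw'. fst z) = (\<Sum>z\<leftarrow>lw. fst z)"
proof (cases "i < n")
  case True
  have "Suc i < length lw" using True assms(2) by simp
  then obtain xs d x d' y ys where lw: "lw = xs @ (d, x) # (d', y) # ys" "length xs = i"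
    by (rule split_two)
  let ?lw = "xs @ (d + d', ext_mult A x y) # ys"
  have "\<mu> i (T lw) = tscale (ksign (sh xs + of_int d)) (T ?lw)"
    using assms(1) lw by (simp add: mu_T)
  moreover have "sh ?lw = sh lw + 1"
    unfolding lw(1) by (cases "of_int d :: bit"; cases "of_int d' :: bit"; cases "sh xs"; cases
        "sh ys") simp_all
  moreover have "good ?lw"
    using assms(1) unfolding lw(1) by (simp add: ext_mult_gr)
  moreover have "A_lword lw \<longrightarrow> A_lword ?lw"
    unfolding lw(1) by (simp add: ext_mult_def)
  moreover have "length ?lw = n" "(\<Sum>z\<leftarrow>?lw. fst z) = (\<Sum>z\<leftarrow>lw. fst z)"
    using assms(2) unfolding lw(1) by simp_all
  moreover have "\<forall>k\<in>{1..<n}. fst (?lw ! k) = (if k < i then fst (lw ! k) else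
       if k = i then fst (lw ! k) + fst (lw ! Suc k) else fst (lw ! Suc k))"
    using assms(2) unfolding lw(1) lw(2)[symmetric] by (simp add: nth_append nth_Cons')
  ultimately show ?thesis by blast
next
  case False
  then have i: "i = n" using assms(3) by simp
  have "length lw = Suc (Suc (n - 1))" using assms(2,4) by simp
  then obtain d x ys d' y where lw: "lw = (d, x) # ys @ [(d', y)]" "length ys = n - 1"
    by (rule split_ends)
  let ?lw = "(d' + d, ext_mult A y x) # ys"
  have "\<mu> i (T lw) = tscale (ksign ((of_int d' + 1) * (of_int d + sh ys) + 1)) (T ?lw)"
    using assms(1,4) lw i by (simp add: mu_T_last)
  moreover have "sh ?lw = sh lw + 1"
    unfolding lw(1) by (cases "of_int d :: bit"; cases "of_int d' :: bit"; cases "sh ys") simp_all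
  moreover have "good ?lw"
    using assms(1) unfolding lw(1) by (simp add: ext_mult_gr)
  moreover have "A_lword lw \<longrightarrow> A_lword ?lw"
    unfolding lw(1) by (simp add: ext_mult_def)
  moreover have "length ?lw = n" "(\<Sum>z\<leftarrow>?lw. fst z) = (\<Sum>z\<leftarrow>lw. fst z)"
    using assms(4) lw(2) unfolding lw(1) by simp_all
  moreover have "\<forall>k\<in>{1..<n}. fst (?lw ! k) = (if k < i then fst (lw ! k) else
       if k = i then fst (lw ! k) + fst (lw ! Suc k) else fst (lw ! Suc k))"
    using lw(2) assms(4) unfolding lw(1) i by (auto simp: nth_append nth_Cons')
  ultimately show ?thesis by blast
qed

lemma tau_word:
  assumes "good lw" "lw \<noteq> []"
  shows "\<exists>c. \<tau> (T lw) = tscale c (T (rotate1 lw)) \<and> good (rotate1 lw) \<and>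
      A_lword (rotate1 lw) = A_lword lw \<and>
    sh (rotate1 lw) = sh lw"
proof -
  obtain z ys where lw: "lw = z # ys" using assms(2) by (cases lw) auto
  then show ?thesis using assms(1) tau_T[of z ys] by (auto simp: add_ac)
qed

lemma delta_chains: "x \<in> chains n \<Longrightarrow> \<delta> i x \<in> chains n"
proof (rule chains_in[OF lin_delta[OF lin_id]])
  fix lw :: "('a, 'k) lword" assume "good lw" "length lw = n"
  then show "\<exists>c lw'. \<delta> i (T lw) = tscale c (T lw') \<and> good lw' \<and> length lw' = n"
    using delta_word[of lw i] delta_T_zero[of lw i] TS.scale_zero_left[of "T lw"]
    by (cases "i < n") (metis, metis not_le)
qed

lemma mu_chains: "x \<in> chains (Suc n) \<Longrightarrow> n \<ge> 1 \<Longrightarrow> i \<le> n \<Longrightarrow> \<mu> i x \<in> chains n"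
proof (rule chains_in[OF lin_mu[OF lin_id]])
  fix lw :: "('a, 'k) lword" assume "good lw" "length lw = Suc n" "n \<ge> 1" "i \<le> n"
  then show "\<exists>c lw'. \<mu> i (T lw) = tscale c (T lw') \<and> good lw' \<and> length lw' = n"
    using mu_word[of lw n i] by blast
qed

lemma mu_chains_1: "x \<in> chains 1 \<Longrightarrow> \<mu> i x = 0"
  by (rule chains_eqI[OF lin_mu[OF lin_id] lin_zero]) (simp_all add: mu_T_zero)

lemma tau_chains: "x \<in> chains (Suc n) \<Longrightarrow> \<tau> x \<in> chains (Suc n)"
proof (rule chains_in[OF lin_tau[OF lin_id]])
  fix lw :: "('a, 'k) lword" assume *: "good lw" "length lw = Suc n"
  then show "\<exists>c lw'. \<tau> (T lw) = tscale c (T lw') \<and> good lw' \<and> length lw' = Suc n"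
    using tau_word[of lw] by (metis length_rotate1 list.size(3) old.nat.distinct(2))
qed

lemma tau_pow_chains: "x \<in> chains (Suc n) \<Longrightarrow> (\<tau> ^^ i) x \<in> chains (Suc n)"
  by (induction i) (simp_all add: tau_chains)

lemma E_chains: "x \<in> chains n \<Longrightarrow> E i x \<in> chains n"
proof (rule chains_in[OF lin_E[OF lin_id]])
  fix lw :: "('a, 'k) lword" assume *: "good lw" "length lw = n"
  then show "\<exists>c lw'. E i (T lw) = tscale c (T lw') \<and> good lw' \<and> length lw' = n"
    using E_T[of lw i] by blast
qed

lemma delta_A_chains: "x \<in> A_chains p (Suc n) \<Longrightarrow> i \<le> n \<Longrightarrow> \<delta> i x \<in> A_chains (p + 1) (Suc n)"
proof (rule A_chains_in[OF lin_delta[OF lin_id]])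
  fix lw :: "('a, 'k) lword" assume "good lw" "length lw = Suc n" "A_lword lw" "sh lw = p" "i \<le> n"
  then show "\<exists>c lw'. \<delta> i (T lw) = tscale c (T lw') \<and> good lw' \<and> length lw' = Suc n \<and> A_lword lw' \<and>
      sh lw' = p + 1"
    using delta_word[of lw i] by (metis less_Suc_eq_le)
qed

lemma mu_A_chains: "x \<in> A_chains p (Suc (Suc n)) \<Longrightarrow> i \<le> Suc n \<Longrightarrow> \<mu> i x \<in> A_chains (p + 1) (Suc n)"
proof (rule A_chains_in[OF lin_mu[OF lin_id]])
  fix lw :: "('a, 'k) lword"
  assume "good lw" "length lw = Suc (Suc n)" "A_lword lw" "sh lw = p" "i \<le> Suc n"
  then show "\<exists>c lw'. \<mu> i (T lw) = tscale c (T lw') \<and> good lw' \<and> length lw' = Suc n \<and> A_lword lw' \<and>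
      sh lw' = p + 1"
    using mu_word[of lw "Suc n" i] by (metis le_add1 plus_1_eq_Suc)
qed

lemma tau_A_chains: "x \<in> A_chains p (Suc n) \<Longrightarrow> \<tau> x \<in> A_chains p (Suc n)"
proof (rule A_chains_in[OF lin_tau[OF lin_id]])
  fix lw :: "('a, 'k) lword" assume *: "good lw" "length lw = Suc n" "A_lword lw" "sh lw = p"
  then show "\<exists>c lw'. \<tau> (T lw) = tscale c (T lw') \<and> good lw' \<and> length lw' = Suc n \<and> A_lword lw' \<and>
      sh lw' = p"
    using tau_word[of lw] by (metis length_rotate1 list.size(3) old.nat.distinct(2))
qed

lemma tau_pow_A_chains: "x \<in> A_chains p (Suc n) \<Longrightarrow> (\<tau> ^^ i) x \<in> A_chains p (Suc n)"
  by (induction i) (simp_all add: tau_A_chains)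

lemma E_A_chains: "x \<in> A_chains p n \<Longrightarrow> E i x \<in> A_chains p n"
proof (rule A_chains_in[OF lin_E[OF lin_id]])
  fix lw :: "('a, 'k) lword" assume *: "good lw" "length lw = n" "A_lword lw" "sh lw = p"
  then show "\<exists>c lw'. E i (T lw) = tscale c (T lw') \<and> good lw' \<and> length lw' = n \<and> A_lword lw' \<and>
      sh lw' = p"
    using E_T[of lw i] by blast
qed

lemma chains_lin: "x \<in> chains n \<Longrightarrow> y \<in> chains n \<Longrightarrow> x + y \<in> chains n" "x \<in> chains n \<Longrightarrow>
    tscale c x \<in> chains n"
  "x \<in> chains n \<Longrightarrow> - x \<in> chains n" "x \<in> chains n \<Longrightarrow> y \<in> chains n \<Longrightarrow> x - y \<in> chains n" "0 \<in> chains n"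
  "(\<And>i. i \<in> I \<Longrightarrow> f i \<in> chains n) \<Longrightarrow> sum f I \<in> chains n"
  unfolding chains_def by (rule TS.span_add TS.span_scale TS.span_neg TS.span_diff TS.span_zero
      TS.span_sum; assumption)+

section \<open>Cyclic and simplicial relations\<close>

text \<open>A power of \<tau> moves an initial block behind the rest, with the Koszul sign of the
  two blocks. An empty rest gives \<tau>^{n+1} = 1; a rest of one letter gives \<tau>^n =
  \<tau>^{-1} explicitly.\<close>

lemma tau_pow_T:
  "good (xs @ ys) \<Longrightarrow> (\<tau> ^^ length xs) (T (xs @ ys)) = tscale (ksign (sh xs * sh ys)) (T (ys @ xs))"
proof (induction xs arbitrary: ys)
  case Nil
  then show ?case by (simp add: ksign_def)
next
  case (Cons z xs)
  have "(\<tau> ^^ length (z # xs)) (T ((z # xs) @ ys)) = (\<tau> ^^ length xs) (\<tau> (T (z # xs @ ys)))"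
    by (simp add: funpow_swap1)
  also have "\<dots> = tscale (ksign ((of_int (fst z) + 1) * (sh xs +
      sh ys))) ((\<tau> ^^ length xs) (T (xs @ ys @ [z])))"
    using Cons.prems by (simp add: tau_T op_simps)
  also have "\<dots> = tscale (ksign ((of_int (fst z) + 1) * (sh xs +
      sh ys))) (tscale (ksign (sh xs * sh (ys @ [z]))) (T ((ys @ [z]) @ xs)))"
    using Cons.IH[of "ys @ [z]"] Cons.prems by simp
  also have "\<dots> = tscale (ksign (sh (z # xs) * sh ys)) (T (ys @ z # xs))"
    by (cases "of_int (fst z) :: bit"; cases "sh xs"; cases "sh ys") (simp_all add: ksign_def)
  finally show ?case .
qed

lemma tau_pow_id: "x \<in> chains n \<Longrightarrow> (\<tau> ^^ n) x = x"
proof (rule chains_eqI[OF lin_tau_pow[OF lin_id] lin_id])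
  fix lw :: "('a, 'k) lword" assume "good lw" "length lw = n"
  then show "(\<tau> ^^ n) (T lw) = T lw" using tau_pow_T[of lw "[]"] by (simp add: ksign_def)
qed

lemma delta_tau: "x \<in> chains (Suc n) \<Longrightarrow> i < n \<Longrightarrow> \<delta> i (\<tau> x) = \<tau> (\<delta> (Suc i) x)"
proof (rule chains_eqI[of "\<lambda>x. \<delta> i (\<tau> x)" "\<lambda>x. \<tau> (\<delta> (Suc i) x)"])
  fix lw :: "('a, 'k) lword" assume lw: "good lw" "length lw = Suc n" "i < n"
  obtain z zs where z: "lw = z # zs" using lw(2) by (cases lw) auto
  have "i < length zs" using lw(2,3) z by simp
  then obtain xs d x ys where zs: "zs = xs @ (d, x) # ys" "length xs = i" by (rule split_at)
  have "\<delta> i (T (xs @ (d, x) # (ys @ [z]))) = tscale (ksign (sh xs)) (T (xs @ (d +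
      1, ext_dif A x) # ys @ [z]))"
    "\<delta> (Suc i) (T ((z # xs) @ (d, x) # ys)) = tscale (ksign (sh (z # xs))) (T ((z # xs) @ (d +
        1, ext_dif A x) # ys))"
    using lw(1) zs unfolding z by (subst delta_T; simp)+
  then show "\<delta> i (\<tau> (T lw)) = \<tau> (\<delta> (Suc i) (T lw))"
    using lw(1) unfolding z zs(1)
    by (cases "of_int (fst z) :: bit"; cases "sh xs"; cases "sh ys"; cases "of_int d :: bit")
      (simp_all add: ksign_def tau_T op_simps ext_dif_gr)
qed (intro lin_ops lin_intros)+

lemma delta_last_tau: "x \<in> chains (Suc n) \<Longrightarrow> \<delta> n (\<tau> x) = \<tau> (\<delta> 0 x)"
proof (rule chains_eqI[of "\<lambda>x. \<delta> n (\<tau> x)" "\<lambda>x. \<tau> (\<delta> 0 x)"])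
  fix lw :: "('a, 'k) lword" assume lw: "good lw" "length lw = Suc n"
  obtain d x zs where z: "lw = (d, x) # zs" using lw(2) by (cases lw) auto
  have "\<delta> n (T (zs @ (d, x) # [])) = tscale (ksign (sh zs)) (T (zs @ [(d + 1, ext_dif A x)]))"
    "\<delta> 0 (T ([] @ (d, x) # zs)) = tscale (ksign 0) (T ((d + 1, ext_dif A x) # zs))"
    using lw unfolding z by (subst delta_T; simp)+
  then show "\<delta> n (\<tau> (T lw)) = \<tau> (\<delta> 0 (T lw))"
    using lw(1) unfolding z
    by (cases "sh zs"; cases "of_int d :: bit")
      (simp_all add: ksign_def tau_T op_simps ext_dif_gr)
qed (intro lin_ops lin_intros)+

lemma mu_tau: "x \<in> chains (Suc n) \<Longrightarrow> i < n \<Longrightarrow> \<mu> i (\<tau> x) = \<tau> (\<mu> (Suc i) x)"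
proof (rule chains_eqI[of "\<lambda>x. \<mu> i (\<tau> x)" "\<lambda>x. \<tau> (\<mu> (Suc i) x)"])
  fix lw :: "('a, 'k) lword" assume lw: "good lw" "length lw = Suc n" "i < n"
  obtain d0 x0 zs where z: "lw = (d0, x0) # zs" using lw(2) by (cases lw) auto
  show "\<mu> i (\<tau> (T lw)) = \<tau> (\<mu> (Suc i) (T lw))"
  proof (cases "Suc i < n")
    case True
    then have "Suc i < length zs" using lw(2,3) z by simp
    then obtain xs d x d' y ys where zs: "zs = xs @ (d, x) # (d', y) # ys" "length xs = i"
        by (rule split_two)
    have "\<mu> i (T (xs @ (d, x) # (d', y) # (ys @ [(d0, x0)]))) =
        tscale (ksign (sh xs + of_int d)) (T (xs @ (d + d', ext_mult A x y) # (ys @ [(d0, x0)])))"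
      "\<mu> (Suc i) (T (((d0, x0) # xs) @ (d, x) # (d', y) # ys)) =
        tscale (ksign (sh ((d0, x0) # xs) + of_int d)) (T (((d0, x0) # xs) @ (d +
            d', ext_mult A x y) # ys))"
      using lw(1) zs unfolding z by (subst mu_T; simp)+
    then show ?thesis
      using lw(1) unfolding z zs(1)
      by (cases "of_int d0 :: bit"; cases "sh xs"; cases "sh ys"; cases "of_int d :: bit"; cases
          "of_int d' :: bit")
        (simp_all add: ksign_def tau_T op_simps ext_mult_gr)
  next
    case False
    then have "length zs = Suc i" using lw(2,3) z by simp
    then obtain ys d x where zs: "zs = ys @ [(d, x)]" "length ys = i"
      by (cases zs rule: rev_cases) auto
    have "\<mu> i (T (ys @ (d, x) # (d0, x0) # [])) =
        tscale (ksign (sh ys + of_int d)) (T (ys @ (d + d0, ext_mult A x x0) # []))"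
      using lw(1) zs unfolding z by (subst mu_T; simp)
    moreover have "\<mu> (Suc i) (T ((d0, x0) # ys @ [(d, x)])) =
        tscale (ksign ((of_int d + 1) * (of_int d0 + sh ys) + 1)) (T ((d +
            d0, ext_mult A x x0) # ys))"
      using lw(1) zs unfolding z by (subst mu_T_last; simp)
    ultimately show ?thesis
      using lw(1) unfolding z zs(1)
      by (cases "of_int d0 :: bit"; cases "sh ys"; cases "of_int d :: bit")
        (simp_all add: ksign_def tau_T op_simps ext_mult_gr)
  qed
qed (intro lin_ops lin_intros)+

text \<open>After the rotation a_0 is the last letter and a_1 the first, so the wrapped product is
  a_0a_1, already in front; hence no \<tau> remains on the right, unlike for i < n.\<close>

lemma mu_last_tau: "x \<in> chains (Suc n) \<Longrightarrow> \<mu> n (\<tau> x) = \<mu> 0 x"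
proof (rule chains_eqI[of "\<lambda>x. \<mu> n (\<tau> x)" "\<lambda>x. \<mu> 0 x"])
  fix lw :: "('a, 'k) lword" assume lw: "good lw" "length lw = Suc n"
  show "\<mu> n (\<tau> (T lw)) = \<mu> 0 (T lw)"
  proof (cases "n = 0")
    case True
    then obtain z where "lw = [z]" using lw(2) by (cases lw) auto
    then show ?thesis using lw(1) True by (simp add: tau_T op_simps mu_T_zero)
  next
    case False
    then have "Suc 0 < length lw" using lw(2) by simp
    then obtain d x d' y ys where zs: "lw = [] @ (d, x) # (d', y) # ys"
      by (rule split_two) auto
    have "\<mu> 0 (T ([] @ (d, x) # (d', y) # ys)) =
        tscale (ksign (of_int d)) (T ((d + d', ext_mult A x y) # ys))"
      using lw(1) zs by (subst mu_T; simp)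
    moreover have "\<mu> n (T ((d', y) # ys @ [(d, x)])) =
        tscale (ksign ((of_int d + 1) * (of_int d' + sh ys) + 1)) (T ((d +
            d', ext_mult A x y) # ys))"
      using lw zs by (subst mu_T_last; simp)
    ultimately show ?thesis
      using lw(1) unfolding zs
      by (cases "sh ys"; cases "of_int d :: bit"; cases "of_int d' :: bit")
        (simp_all add: ksign_def tau_T op_simps)
  qed
qed (intro lin_ops lin_intros)+

lemma delta_0_0: "x \<in> chains (Suc n) \<Longrightarrow> \<delta> 0 (\<delta> 0 x) = 0"
proof (rule chains_eqI[of "\<lambda>x. \<delta> 0 (\<delta> 0 x)" "\<lambda>x. 0"])
  fix lw :: "('a, 'k) lword" assume lw: "good lw" "length lw = Suc n"
  obtain d x zs where z: "lw = (d, x) # zs" using lw(2) by (cases lw) auto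
  show "\<delta> 0 (\<delta> 0 (T lw)) = 0"
    using lw delta_T[of "[]" d x zs 0] delta_T[of "[]" "d + 1" "ext_dif A x" zs 0] unfolding z
    by (simp add: op_simps ext_dif_gr ext_dif_dif T_letter(3)[of "[]", simplified])
qed (intro lin_ops lin_intros)+

lemma delta_0_delta: "x \<in> chains (Suc n) \<Longrightarrow> j \<ge> 1 \<Longrightarrow> j \<le> n \<Longrightarrow> \<delta> 0 (\<delta> j x) = - \<delta> j (\<delta> 0 x)"
proof (rule chains_eqI[of "\<lambda>x. \<delta> 0 (\<delta> j x)" "\<lambda>x. - \<delta> j (\<delta> 0 x)"])
  fix lw :: "('a, 'k) lword" assume lw: "good lw" "length lw = Suc n" "j \<ge> 1" "j \<le> n"
  obtain d0 x0 zs where z: "lw = (d0, x0) # zs" using lw(2) by (cases lw) auto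
  have "j - 1 < length zs" using lw(2-4) z by simp
  then obtain xs d x ys where zs: "zs = xs @ (d, x) # ys" "length xs = j - 1" by (rule split_at)
  have *: "\<delta> j (T (((d1, x1) # xs) @ (d, x) # ys)) =
     tscale (ksign (sh ((d1, x1) # xs))) (T (((d1, x1) # xs) @ (d + 1, ext_dif A x) # ys))"
    if "x1 \<in> ext_gr D d1" for d1 x1
    using lw(1,3) zs that unfolding z by (subst delta_T; simp)
  show "\<delta> 0 (\<delta> j (T lw)) = - \<delta> j (\<delta> 0 (T lw))"
    using lw(1) *[of x0 d0] *[of "ext_dif A x0" "d0 + 1"] unfolding z zs(1)
    using delta_T[of "[]" d0 x0 "xs @ (d, x) # ys" 0] delta_T[of "[]" d0 x0 "xs @ (d +
        1, ext_dif A x) # ys" 0]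
    by (cases "of_int d0 :: bit"; cases "sh xs"; cases "of_int d :: bit")
      (simp_all add: ksign_def op_simps ext_dif_gr)
qed (intro lin_ops lin_intros)+

text \<open>For j = 1 and j = n this is associativity, of a_0a_1a_2 and of a_na_0a_1; otherwise the
  two products are disjoint and only the sign changes.\<close>

lemma mu_0_mu:
  assumes x: "x \<in> chains (Suc n)" and j: "j \<ge> 1" "j \<le> n"
  shows "\<mu> 0 (\<mu> j x) = - \<mu> (j - 1) (\<mu> 0 x)"
proof (cases "n \<ge> 2")
  case False
  \<comment> \<open>For n = 1 each product leaves a single letter, where every \<mu> is zero by
    convention.\<close>
  then have "n = 1" using j by linarith
  then have "\<mu> j x \<in> chains 1" "\<mu> 0 x \<in> chains 1" using mu_chains[OF x] j by auto
  then show ?thesis by (simp add: mu_chains_1)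
next
  case n: True
  show ?thesis using _ _ _ x
  proof (rule chains_eqI[of "\<lambda>x. \<mu> 0 (\<mu> j x)" "\<lambda>x. - \<mu> (j - 1) (\<mu> 0 x)"])
    fix lw :: "('a, 'k) lword" assume lw: "good lw" "length lw = Suc n"
    then have "Suc 0 < length lw" using n by simp
    then obtain d x d' y zs where z: "lw = [] @ (d, x) # (d', y) # zs" by (rule split_two) auto
    have gr: "x \<in> ext_gr D d" "y \<in> ext_gr D d'" "good zs" using lw z by auto
    consider "j = 1" | "1 < j" "j < n" | "j = n" "1 < j" using j by linarith
    then show "\<mu> 0 (\<mu> j (T lw)) = - \<mu> (j - 1) (\<mu> 0 (T lw))"
    proof cases
      case 1
      obtain e u ws where zs: "zs = (e, u) # ws" using lw z n by (cases zs) auto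
      have "\<mu> 1 (T ([(d, x)] @ (d', y) # (e, u) # ws)) =
          tscale (ksign (of_int d + 1 + of_int d')) (T ((d, x) # (d' + e, ext_mult A y u) # ws))"
        using lw(1) unfolding z zs by (subst mu_T; simp)
      then show ?thesis using gr unfolding z zs 1
        by (cases "of_int d :: bit"; cases "of_int d' :: bit")
          (simp_all add: op_simps mu_0_T ext_mult_gr ext_assoc ksign_def add.assoc)
    next
      case 2
      then have "Suc (j - 2) < length zs" using lw(2) z by simp
      then obtain xs e u e' v ws where zs: "zs = xs @ (e, u) # (e', v) # ws" "length xs = j - 2"
        by (rule split_two)
      let ?ws = "xs @ (e + e', ext_mult A u v) # ws"
      have "\<mu> j (T (((d, x) # (d', y) # xs) @ (e, u) # (e', v) # ws)) =
          tscale (ksign (of_int d + of_int d' + sh xs + of_int e)) (T ((d, x) # (d', y) # ?ws))"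
        using lw(1) 2 zs(2) unfolding z zs(1)
        by (subst mu_T; simp; cases "of_int d :: bit"; cases "of_int d' :: bit"; cases "sh xs";
            cases "of_int e :: bit"; simp)
      moreover have "\<mu> (j - 1) (T (((d + d', ext_mult A x y) # xs) @ (e, u) # (e', v) # ws)) =
          tscale (ksign (of_int d + of_int d' + 1 + sh xs + of_int e)) (T ((d +
              d', ext_mult A x y) # ?ws))"
        using lw(1) 2 zs(2) unfolding z zs(1)
        by (subst mu_T; simp add: ext_mult_gr)
      ultimately show ?thesis using gr unfolding z zs
        by (cases "of_int d :: bit"; cases "of_int d' :: bit"; cases "sh xs"; cases "of_int e ::
            bit")
          (simp_all add: op_simps mu_0_T ext_mult_gr ksign_def)
    next
      case 3
      then have "zs \<noteq> []" using lw(2) z by auto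
      then obtain ws e u where zs: "zs = ws @ [(e, u)]" by (metis rev_exhaust surj_pair)
      have "\<mu> j (T ((d, x) # ((d', y) # ws) @ [(e, u)])) =
          tscale (ksign ((of_int e + 1) * (of_int d + (of_int d' + 1 + sh ws)) + 1)) (T ((e +
              d, ext_mult A u x) # (d', y) # ws))"
        using lw 3 unfolding z zs by (subst mu_T_last; simp)
      moreover have "\<mu> (j - 1) (T ((d + d', ext_mult A x y) # ws @ [(e, u)])) =
          tscale (ksign ((of_int e + 1) * (of_int d + of_int d' + sh ws) + 1)) (T ((e + (d +
              d'), ext_mult A u (ext_mult A x y)) # ws))"
        using lw 3 unfolding z zs by (subst mu_T_last; simp add: ext_mult_gr)
      ultimately show ?thesis using gr unfolding z zs
        by (cases "of_int d :: bit"; cases "of_int d' :: bit"; cases "sh ws"; cases "of_int e ::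
            bit")
          (simp_all add: op_simps mu_0_T ext_mult_gr ksign_def ext_assoc add.assoc)
    qed
  qed (intro lin_ops lin_intros)+
qed

text \<open>Leibniz rule for a_0a_1; the sign (-1)^{|a_0|} built into \<mu>^(0) turns it into a
  relation with constant signs.\<close>

lemma delta_0_mu_0: "x \<in> chains (Suc (Suc n)) \<Longrightarrow> \<delta> 0 (\<mu> 0 x) = - \<mu> 0 (\<delta> 0 x) - \<mu> 0 (\<delta> 1 x)"
proof (rule chains_eqI[of "\<lambda>x. \<delta> 0 (\<mu> 0 x)" "\<lambda>x. - \<mu> 0 (\<delta> 0 x) - \<mu> 0 (\<delta> 1 x)"])
  fix lw :: "('a, 'k) lword" assume lw: "good lw" "length lw = Suc (Suc n)"
  have "Suc 0 < length lw" using lw by simp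
  then obtain d x d' y zs where z: "lw = [] @ (d, x) # (d', y) # zs" by (rule split_two) auto
  have gr: "x \<in> ext_gr D d" "y \<in> ext_gr D d'" "good zs" using lw z by auto
  have delta0: "\<delta> 0 (T ((e, u) # ws)) = tscale (ksign 0) (T ((e + 1, ext_dif A u) # ws))"
    if "u \<in> ext_gr D e" "good ws" for e u ws
    using delta_T[of "[]" e u ws 0] that by simp
  have delta1: "\<delta> 1 (T ([(d, x)] @ (d', y) # zs)) =
      tscale (ksign (sh [(d, x)])) (T ([(d, x)] @ (d' + 1, ext_dif A y) # zs))"
    using gr by (subst delta_T; simp)
  have leib: "T ((d + d' + 1, ext_dif A (ext_mult A x y)) # zs) =
      T ((d + 1 + d', ext_mult A (ext_dif A x) y) # zs)
     + tscale (ksign (of_int d)) (T ((d + (d' + 1), ext_mult A x (ext_dif A y)) # zs))"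
    unfolding ext_leibniz[OF gr(1)]
    using T_letter(1)[of "[]", simplified] T_letter(2)[of "[]", simplified] by metis
  show "\<delta> 0 (\<mu> 0 (T lw)) = - \<mu> 0 (\<delta> 0 (T lw)) - \<mu> 0 (\<delta> 1 (T lw))"
    using delta1 leib gr unfolding z
    by (cases "of_int d :: bit") (simp_all add: op_simps mu_0_T delta0 ext_mult_gr ext_dif_gr
        ksign_def)
qed (intro lin_ops lin_intros)+

lemma delta_mu_0: "x \<in> chains (Suc (Suc n)) \<Longrightarrow> i < n \<Longrightarrow> \<delta> (Suc i) (\<mu> 0 x) = - \<mu> 0 (\<delta> (Suc (Suc i)) x)"
proof (rule chains_eqI[of "\<lambda>x. \<delta> (Suc i) (\<mu> 0 x)" "\<lambda>x. - \<mu> 0 (\<delta> (Suc (Suc i)) x)"])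
  fix lw :: "('a, 'k) lword" assume lw: "good lw" "length lw = Suc (Suc n)" "i < n"
  have "Suc 0 < length lw" using lw by simp
  then obtain d x d' y zs where z: "lw = [] @ (d, x) # (d', y) # zs" by (rule split_two) auto
  have "i < length zs" using lw z by simp
  then obtain xs e u ys where zs: "zs = xs @ (e, u) # ys" "length xs = i" by (rule split_at)
  have gr: "x \<in> ext_gr D d" "y \<in> ext_gr D d'" "u \<in> ext_gr D e" "good xs" "good ys"
      using lw z zs by auto
  have "\<delta> (Suc i) (T (((d + d', ext_mult A x y) # xs) @ (e, u) # ys)) =
      tscale (ksign (of_int d + of_int d' + 1 + sh xs)) (T ((d + d', ext_mult A x y) # xs @ (e +
          1, ext_dif A u) # ys))"
    using gr zs(2) by (subst delta_T; simp add: ext_mult_gr)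
  moreover have "\<delta> (Suc (Suc i)) (T (((d, x) # (d', y) # xs) @ (e, u) # ys)) =
      tscale (ksign (of_int d + of_int d' + sh xs)) (T ((d, x) # (d', y) # xs @ (e +
          1, ext_dif A u) # ys))"
    using gr zs(2) by (subst delta_T; simp; cases "of_int d :: bit"; cases "of_int d' :: bit"; simp)
  ultimately show "\<delta> (Suc i) (\<mu> 0 (T lw)) = - \<mu> 0 (\<delta> (Suc (Suc i)) (T lw))"
    using gr unfolding z zs(1)
    by (cases "of_int d :: bit"; cases "of_int d' :: bit"; cases "sh xs")
      (simp_all add: op_simps mu_0_T ext_mult_gr ext_dif_gr ksign_def)
qed (intro lin_ops lin_intros)+

text \<open>\<tau> has finite order on words of length n. Cancelling it lets the following
  inductions carry a relation from index i, applied to \<tau> x, to index i + 1.\<close>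

lemma tau_inj:
  assumes "\<tau> x = \<tau> y" "x \<in> chains n" "y \<in> chains n" "n > 0"
  shows "x = y"
proof -
  have "(\<tau> ^^ (n - 1)) (\<tau> z) = z" if "z \<in> chains n" for z
    using tau_pow_id[OF that] \<open>n > 0\<close> by (metis Suc_pred' comp_apply funpow_Suc_right)
  then show ?thesis using assms by metis
qed

lemma mu_mu: "x \<in> chains (Suc n) \<Longrightarrow> i < j \<Longrightarrow> j \<le> n \<Longrightarrow> \<mu> i (\<mu> j x) = - \<mu> (j - 1) (\<mu> i x)"
proof (induction i arbitrary: j x)
  case 0
  then show ?case using mu_0_mu[of x n j] by simp
next
  case (Suc i)
  obtain m where n: "n = Suc (Suc m)" using Suc.prems
    by (metis One_nat_def Suc_lessD Suc_less_eq less_imp_Suc_add less_le_trans not0_implies_Suc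
        not_less_zero)
  obtain k where j: "j = Suc k" "i < k" using Suc.prems(2) by (cases j) auto
  have x: "x \<in> chains (Suc (Suc (Suc m)))" using Suc.prems n by simp
  have mux: "\<mu> l x \<in> chains (Suc (Suc m))" if "l \<le> n" for l using mu_chains[OF x] that n by simp
  have mux': "\<mu> l (\<mu> l' x) \<in> chains (Suc m)" if "l < n" "l' \<le> n" for l l'
    using mu_chains[OF mux] that n by simp
  \<comment> \<open>Moving \<tau> inwards lowers both indices by one, so the induction hypothesis
    applies to \<tau> x; moving it back outwards raises them again.\<close>
  have "\<tau> (\<mu> (Suc i) (\<mu> j x)) = \<mu> i (\<tau> (\<mu> j x))"
    using mux j n Suc.prems by (subst mu_tau[of _ "Suc m"]) auto
  also have "\<dots> = \<mu> i (\<mu> k (\<tau> x))"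
    unfolding j(1) using x j n Suc.prems by (subst mu_tau[of x "Suc (Suc m)"]) auto
  also have "\<dots> = - \<mu> (k - 1) (\<mu> i (\<tau> x))"
    by (rule Suc.IH) (use j n tau_chains[OF x] Suc.prems in auto)
  also have "\<dots> = - \<mu> (k - 1) (\<tau> (\<mu> (Suc i) x))"
    using x j n Suc.prems by (subst mu_tau[of x "Suc (Suc m)"]) auto
  also have "\<dots> = - \<tau> (\<mu> (Suc (k - 1)) (\<mu> (Suc i) x))"
    using mux[of "Suc i"] j n Suc.prems by (subst mu_tau[of _ "Suc m"]) auto
  also have "\<dots> = \<tau> (- \<mu> k (\<mu> (Suc i) x))"
    using j by (simp add: op_simps)
  finally have "\<mu> (Suc i) (\<mu> j x) = - \<mu> k (\<mu> (Suc i) x)"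
    by (rule tau_inj[where n = "Suc m"]) (use mux' j n Suc.prems in \<open>auto intro: chains_lin\<close>)
  then show ?case using j by simp
qed

lemma delta_delta: "x \<in> chains (Suc n) \<Longrightarrow> i < j \<Longrightarrow> j \<le> n \<Longrightarrow> \<delta> i (\<delta> j x) = - \<delta> j (\<delta> i x)"
proof (induction i arbitrary: j x)
  case 0
  then show ?case using delta_0_delta[of x n j] by simp
next
  case (Suc i)
  obtain k where j: "j = Suc k" "i < k" "k < n" using Suc.prems by (cases j) auto
  note x = Suc.prems(1)
  have "\<tau> (\<delta> (Suc i) (\<delta> (Suc k) x)) = \<delta> i (\<delta> k (\<tau> x))"
    using x j by (simp add: delta_tau[of _ n] delta_chains)
  also have "\<dots> = - \<delta> k (\<delta> i (\<tau> x))"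
    by (rule Suc.IH) (use j tau_chains[OF x] in auto)
  also have "\<dots> = \<tau> (- \<delta> (Suc k) (\<delta> (Suc i) x))"
    using x j by (simp add: delta_tau[of _ n] delta_chains op_simps)
  finally show ?case
    unfolding j(1)
    by (rule tau_inj[where n = "Suc n"]) (use x in \<open>auto intro: chains_lin delta_chains\<close>)
qed

lemma delta_self: "x \<in> chains (Suc n) \<Longrightarrow> i \<le> n \<Longrightarrow> \<delta> i (\<delta> i x) = 0"
proof (induction i arbitrary: x)
  case 0
  then show ?case by (simp add: delta_0_0)
next
  case (Suc i)
  have "\<tau> (\<delta> (Suc i) (\<delta> (Suc i) x)) = \<delta> i (\<delta> i (\<tau> x))"
    using Suc.prems by (simp add: delta_tau[of _ n] delta_chains)
  also have "\<dots> = \<tau> 0"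
    unfolding op_simps by (rule Suc.IH) (use Suc.prems tau_chains in auto)
  finally show ?case
    by (rule tau_inj[where n = "Suc n"]) (use Suc.prems in \<open>auto intro: chains_lin delta_chains\<close>)
qed

section \<open>The two parts of b on words of fixed length\<close>

definition bdelta :: "nat \<Rightarrow> ('a, 'k) chain \<Rightarrow> ('a, 'k) chain" where "bdelta n x = (\<Sum>i\<le>n. \<delta> i x)"
definition bmu :: "nat \<Rightarrow> ('a, 'k) chain \<Rightarrow> ('a, 'k) chain" where "bmu n x = (\<Sum>i\<le>n. \<mu> i x)"

lemma lin_bdelta: "lin Y \<Longrightarrow> lin (\<lambda>x. bdelta n (Y x))" and lin_bmu: "lin Y \<Longrightarrow> lin (\<lambda>x. bmu n (Y x))"
  unfolding bdelta_def bmu_def by (intro lin_sum lin_ops, assumption)+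

lemmas b_simps = lin_simps[OF lin_bdelta[OF lin_id]] lin_simps[OF lin_bmu[OF lin_id]]

lemma bdelta_tau:
  assumes "x \<in> chains (Suc n)"
  shows "bdelta n (\<tau> x) = \<tau> (bdelta n x)"
proof -
  have "bdelta n (\<tau> x) = (\<Sum>i<n. \<delta> i (\<tau> x)) + \<delta> n (\<tau> x)"
    by (simp add: bdelta_def flip: lessThan_Suc_atMost)
  also have "\<dots> = (\<Sum>i<n. \<tau> (\<delta> (Suc i) x)) + \<tau> (\<delta> 0 x)"
    using assms by (simp add: delta_tau delta_last_tau)
  also have "\<dots> = \<tau> (bdelta n x)"
    by (simp add: bdelta_def sum.atMost_shift op_simps add.commute)
  finally show ?thesis .
qed

lemma bdelta_tau_pow: "x \<in> chains (Suc n) \<Longrightarrow> bdelta n ((\<tau> ^^ i) x) = (\<tau> ^^ i) (bdelta n x)"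
  by (induction i) (simp_all add: bdelta_tau tau_pow_chains)

lemma bdelta_chains: "x \<in> chains (Suc n) \<Longrightarrow> bdelta n x \<in> chains (Suc n)"
  unfolding bdelta_def by (intro chains_lin delta_chains)

lemma bmu_chains: "x \<in> chains (Suc (Suc n)) \<Longrightarrow> bmu (Suc n) x \<in> chains (Suc n)"
  unfolding bmu_def by (intro chains_lin mu_chains) auto

lemma bdelta_bdelta: "x \<in> chains (Suc n) \<Longrightarrow> bdelta n (bdelta n x) = 0"
  unfolding bdelta_def op_simps by (rule sum_antisym_eq_0) (simp_all add: delta_delta[of x n]
      delta_self)

lemma bmu_bmu: "x \<in> chains (Suc (Suc n)) \<Longrightarrow> bmu n (bmu (Suc n) x) = 0"
  unfolding bmu_def op_simps by (rule sum_presimplicial_eq_0) (simp_all add: mu_mu[of x "Suc n"])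

text \<open>Since d is a derivation, each \<mu>^(j) separately anticommutes with the whole internal
  differential. The latter commutes with \<tau>, which reduces j to 0.\<close>

lemma bdelta_mu: "x \<in> chains (Suc (Suc n)) \<Longrightarrow> j \<le> Suc n \<Longrightarrow>
    bdelta n (\<mu> j x) = - \<mu> j (bdelta (Suc n) x)"
proof (induction j arbitrary: x)
  case 0
  have "bdelta n (\<mu> 0 x) = \<delta> 0 (\<mu> 0 x) + (\<Sum>i<n. \<delta> (Suc i) (\<mu> 0 x))"
    by (simp add: bdelta_def sum.atMost_shift)
  also have "\<dots> = - \<mu> 0 (\<delta> 0 x) - \<mu> 0 (\<delta> 1 x) - (\<Sum>i<n. \<mu> 0 (\<delta> (Suc (Suc i)) x))"
    using 0 by (simp add: delta_0_mu_0 delta_mu_0 sum_negf)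
  also have "\<dots> = - \<mu> 0 (bdelta (Suc n) x)"
    unfolding bdelta_def sum.atMost_Suc_shift sum.atMost_shift[of _ n] by (simp add: op_simps)
  finally show ?case .
next
  case (Suc j)
  note x = Suc.prems(1)
  have mux: "\<mu> l y \<in> chains (Suc n)" if "l \<le> Suc n" "y \<in> chains (Suc (Suc n))" for l y
    using mu_chains[OF that(2)] that by simp
  have "\<tau> (bdelta n (\<mu> (Suc j) x)) = bdelta n (\<mu> j (\<tau> x))"
    using Suc.prems mux by (simp add: mu_tau[of _ "Suc n"] bdelta_tau)
  also have "\<dots> = - \<mu> j (bdelta (Suc n) (\<tau> x))"
    by (rule Suc.IH) (use tau_chains[OF x] Suc.prems in auto)
  also have "\<dots> = \<tau> (- \<mu> (Suc j) (bdelta (Suc n) x))"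
    using Suc.prems by (simp add: bdelta_tau mu_tau[of _ "Suc n"] bdelta_chains op_simps)
  finally show ?case
    by (rule tau_inj[where n = "Suc n"]) (use Suc.prems mux bdelta_chains in \<open>auto intro:
        chains_lin\<close>)
qed

lemma bdelta_bmu: "x \<in> chains (Suc (Suc n)) \<Longrightarrow> bdelta n (bmu (Suc n) x) =
    - bmu (Suc n) (bdelta (Suc n) x)"
  unfolding bmu_def by (simp add: bdelta_mu b_simps sum_negf del: sum.atMost_Suc)

section \<open>Relations with the degree operators\<close>

lemma E_tau: "x \<in> chains (Suc n) \<Longrightarrow> i < n \<Longrightarrow> E i (\<tau> x) = \<tau> (E (Suc i) x)"
proof (rule chains_eqI[of "\<lambda>x. E i (\<tau> x)" "\<lambda>x. \<tau> (E (Suc i) x)"])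
  fix lw :: "('a, 'k) lword" assume lw: "good lw" "length lw = Suc n" "i < n"
  then have ne: "lw \<noteq> []" by auto
  obtain c where "\<tau> (T lw) = tscale c (T (rotate1 lw))" "good (rotate1 lw)"
    using tau_word[OF lw(1) ne] by blast
  then show "E i (\<tau> (T lw)) = \<tau> (E (Suc i) (T lw))"
    using lw by (simp add: E_T op_simps nth_rotate1 mult.commute)
qed (intro lin_ops lin_intros)+

lemma E_tau_pow: "x \<in> chains (Suc n) \<Longrightarrow> k + j \<le> n \<Longrightarrow> E k ((\<tau> ^^ j) x) = (\<tau> ^^ j) (E (k + j) x)"
proof (induction j arbitrary: x)
  case (Suc j)
  have "E k ((\<tau> ^^ Suc j) x) = E k ((\<tau> ^^ j) (\<tau> x))" by (simp add: funpow_swap1)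
  also have "\<dots> = (\<tau> ^^ j) (E (k + j) (\<tau> x))"
    by (rule Suc.IH) (use Suc.prems tau_chains in auto)
  also have "\<dots> = (\<tau> ^^ Suc j) (E (k + Suc j) x)"
    using Suc.prems by (simp add: E_tau[of _ n] funpow_swap1)
  finally show ?case .
qed simp

text \<open>\<open>\<tau> ^^ n\<close> is the inverse of \<tau> on words of n + 1 letters.\<close>

lemma E_tau_inv:
  assumes x: "x \<in> chains (Suc n)" and i: "i < n"
  shows "E (Suc i) ((\<tau> ^^ n) x) = (\<tau> ^^ n) (E i x)"
proof -
  have "\<tau> ((\<tau> ^^ n) y) = y" if "y \<in> chains (Suc n)" for y
    using tau_pow_id[OF that] by simp
  then have "\<tau> (E (Suc i) ((\<tau> ^^ n) x)) = \<tau> ((\<tau> ^^ n) (E i x))"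
    using x i by (simp add: E_tau[of _ n, symmetric] tau_pow_chains E_chains)
  then show ?thesis by (rule tau_inj) (use x in \<open>auto intro: tau_pow_chains E_chains\<close>)
qed

text \<open>[E, d] = d letter by letter: d raises the degree at its own position only.\<close>

lemma E_delta:
  assumes "x \<in> chains (Suc n)" "i \<le> n"
  shows "E j (\<delta> i x) = \<delta> i (E j x) + (if i = j then \<delta> i x else 0)"
  using _ _ _ assms(1)
proof (rule chains_eqI[of "\<lambda>x. E j (\<delta> i x)" "\<lambda>x. \<delta> i (E j x) + (if i = j then \<delta> i x else 0)"])
  fix lw :: "('a, 'k) lword" assume lw: "good lw" "length lw = Suc n"
  obtain c lw' where lw': "\<delta> i (T lw) = tscale c (T lw')" "good lw'" "length lw' = length lw"
    "map fst lw' = (map fst lw)[i := fst (lw ! i) + 1]"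
    using delta_word[OF lw(1), of i] lw assms(2) by auto
  have "fst (lw' ! j) = (if i = j then fst (lw ! i) + 1 else fst (lw ! j))" if "j < length lw"
    using arg_cong[OF lw'(4), of "\<lambda>xs. xs ! j"] that lw'(3) by (auto simp: nth_list_update)
  then show "E j (\<delta> i (T lw)) = \<delta> i (E j (T lw)) + (if i = j then \<delta> i (T lw) else 0)"
    using lw lw' assms(2) by (auto simp: E_T op_simps algebra_simps TS.scale_left_distrib)
qed (intro lin_ops lin_intros lin_if)+

text \<open>The derivation rule: the degree of a merged letter is a sum, so k = i gives two terms,
  and behind the product the positions move by one.\<close>

lemma E_mu:
  assumes "x \<in> chains (Suc n)" "k \<ge> 1" "k < n" "i \<le> n"
  shows "E k (\<mu> i x) = \<mu> i (if k < i then E k x else if k =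
      i then E k x + E (Suc k) x else E (Suc k) x)"
  using _ _ _ assms(1)
proof (rule chains_eqI[of "\<lambda>x. E k (\<mu> i x)"
      "\<lambda>x. \<mu> i (if k < i then E k x else if k = i then E k x + E (Suc k) x else E (Suc k) x)"])
  fix lw :: "('a, 'k) lword" assume lw: "good lw" "length lw = Suc n"
  have "1 \<le> n" using assms by simp
  then obtain c lw' where lw': "\<mu> i (T lw) = tscale c (T lw')" "good lw'" "length lw' = n"
    "\<forall>k\<in>{1..<n}. fst (lw' ! k) = (if k < i then fst (lw ! k) else
       if k = i then fst (lw ! k) + fst (lw ! Suc k) else fst (lw ! Suc k))"
    using mu_word[OF lw assms(4)] by blast
  then have "fst (lw' ! k) = (if k < i then fst (lw ! k) else
       if k = i then fst (lw ! k) + fst (lw ! Suc k) else fst (lw ! Suc k))"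
    using assms by auto
  then show "E k (\<mu> i (T lw)) = \<mu> i (if k < i then E k (T lw) else if k =
      i then E k (T lw) + E (Suc k) (T lw) else E (Suc k) (T lw))"
    using lw lw' assms by (auto simp: E_T op_simps algebra_simps TS.scale_left_distrib)
qed (intro lin_ops lin_intros lin_if)+

lemma mu_tau_pow: "x \<in> chains (Suc n) \<Longrightarrow> k + j \<le> n \<Longrightarrow> \<mu> k ((\<tau> ^^ j) x) = (\<tau> ^^ j) (\<mu> (k + j) x)"
proof (induction j arbitrary: x)
  case (Suc j)
  have "\<mu> k ((\<tau> ^^ Suc j) x) = \<mu> k ((\<tau> ^^ j) (\<tau> x))" by (simp add: funpow_swap1)
  also have "\<dots> = (\<tau> ^^ j) (\<mu> (k + j) (\<tau> x))"
    by (rule Suc.IH) (use Suc.prems tau_chains in auto)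
  also have "\<dots> = (\<tau> ^^ Suc j) (\<mu> (k + Suc j) x)"
    using Suc.prems by (simp add: mu_tau[of _ n] funpow_swap1)
  finally show ?case .
qed simp

text \<open>Once k + j exceeds n, the product passes through \<mu>^(n)\<tau> = \<mu>^(0), which
  consumes one \<tau>; the index restarts at l = k + j - n - 1.\<close>

lemma mu_tau_pow_wrap:
  assumes x: "x \<in> chains (Suc n)" and "k \<le> n" "l \<le> n" "j + k = n + 1 + l"
  shows "\<mu> k ((\<tau> ^^ j) x) = (\<tau> ^^ (j - 1)) (\<mu> l x)"
proof -
  have j: "j = (n - k) + Suc l" using assms by simp
  have y: "(\<tau> ^^ l) x \<in> chains (Suc n)" using x by (rule tau_pow_chains)
  have "\<mu> k ((\<tau> ^^ j) x) = \<mu> k ((\<tau> ^^ (n - k)) (\<tau> ((\<tau> ^^ l) x)))"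
    unfolding j by (simp add: funpow_add funpow_swap1)
  also have "\<dots> = (\<tau> ^^ (n - k)) (\<mu> n (\<tau> ((\<tau> ^^ l) x)))"
    using mu_tau_pow[OF tau_chains[OF y], of k "n - k"] assms(2) by simp
  also have "\<dots> = (\<tau> ^^ (n - k)) ((\<tau> ^^ l) (\<mu> l x))"
    using mu_last_tau[OF y] mu_tau_pow[OF x, of 0 l] assms(3) by simp
  also have "\<dots> = (\<tau> ^^ (j - 1)) (\<mu> l x)"
    unfolding j by (simp add: funpow_add)
  finally show ?thesis .
qed

section \<open>Norm, bar differential and the cyclic sum of the homotopy\<close>

definition bmu' :: "nat \<Rightarrow> ('a, 'k) chain \<Rightarrow> ('a, 'k) chain" where "bmu' n x = (\<Sum>i<n. \<mu> i x)"

definition cnorm :: "nat \<Rightarrow> ('a, 'k) chain \<Rightarrow> ('a, 'k) chain" where "cnorm n x = (\<Sum>i\<le>n. (\<tau> ^^ i) x)"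

text \<open>\<Phi> = E gives the sum in H1, \<Phi> = \<delta> the one in V. The top power j = n + 1
  is the identity.\<close>

definition sg :: "(nat \<Rightarrow> ('a, 'k) chain \<Rightarrow> ('a, 'k) chain) \<Rightarrow> nat \<Rightarrow> ('a, 'k) chain \<Rightarrow> ('a, 'k) chain"
    where
  "sg \<Phi> n x = (\<Sum>i=1..n. \<Sum>j=i+1..n+1. (\<tau> ^^ j) (\<Phi> i x))"

lemma lin_bmu': "lin Y \<Longrightarrow> lin (\<lambda>x. bmu' n (Y x))"
  and lin_norm: "lin Y \<Longrightarrow> lin (\<lambda>x. cnorm n (Y x))"
  and lin_sg_E: "lin Y \<Longrightarrow> lin (\<lambda>x. sg E n (Y x))"
  unfolding bmu'_def cnorm_def sg_def by (intro lin_sum lin_ops, assumption)+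

lemmas b_simps2 = b_simps lin_simps[OF lin_bmu'[OF lin_id]] lin_simps[OF lin_norm[OF lin_id]]
  lin_simps[OF lin_sg_E[OF lin_id]]

lemma norm_chains: "x \<in> chains (Suc n) \<Longrightarrow> cnorm n x \<in> chains (Suc n)"
  unfolding cnorm_def by (intro chains_lin tau_pow_chains)

lemma sg_E_chains: "x \<in> chains (Suc n) \<Longrightarrow> sg E n x \<in> chains (Suc n)"
  unfolding sg_def by (intro chains_lin tau_pow_chains E_chains)

text \<open>Because \<tau>^{n+1} = 1, the range may start at 1, as the wrap-around formula for
  \<tau>^j requires.\<close>

lemma norm_shift: "x \<in> chains (Suc n) \<Longrightarrow> cnorm n x = (\<Sum>j=1..Suc n. (\<tau> ^^ j) x)"
proof -
  assume x: "x \<in> chains (Suc n)"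
  have "(\<Sum>j<Suc n. (\<tau> ^^ Suc j) x) + x = cnorm n x + x"
    unfolding cnorm_def lessThan_Suc_atMost[symmetric]
    using sum.lessThan_Suc_shift[of "\<lambda>j. (\<tau> ^^ j) x" "Suc n"] sum.lessThan_Suc[of "\<lambda>j. (\<tau> ^^ j) x"
        "Suc n"]
    by (simp only: tau_pow_id[OF x] funpow_0 add.commute)
  then show ?thesis unfolding One_nat_def sum.atLeast1_atMost_eq by (simp only: add_right_cancel)
qed

lemma tau_norm: "x \<in> chains (Suc n) \<Longrightarrow> \<tau> (cnorm n x) = cnorm n x"
  and norm_tau: "x \<in> chains (Suc n) \<Longrightarrow> cnorm n (\<tau> x) = cnorm n x"
proof -
  assume x: "x \<in> chains (Suc n)"
  have "\<tau> (cnorm n x) = (\<Sum>j=1..Suc n. (\<tau> ^^ j) x)"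
    unfolding cnorm_def op_simps One_nat_def sum.atLeast1_atMost_eq lessThan_Suc_atMost by simp
  then show "\<tau> (cnorm n x) = cnorm n x" using norm_shift[OF x] by simp
  moreover have "cnorm n (\<tau> x) = \<tau> (cnorm n x)"
    unfolding cnorm_def op_simps by (simp add: funpow_swap1)
  ultimately show "cnorm n (\<tau> x) = cnorm n x" by simp
qed

lemma tau_pow_norm: "x \<in> chains (Suc n) \<Longrightarrow> (\<tau> ^^ i) (cnorm n x) = cnorm n x"
  and norm_tau_pow: "x \<in> chains (Suc n) \<Longrightarrow> cnorm n ((\<tau> ^^ i) x) = cnorm n x"
  by (induction i) (simp_all add: tau_norm norm_tau tau_pow_chains)

lemma bdelta_norm: "x \<in> chains (Suc n) \<Longrightarrow> bdelta n (cnorm n x) = cnorm n (bdelta n x)"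
  unfolding cnorm_def by (simp add: b_simps bdelta_tau_pow)

text \<open>Face k becomes face l = k + j as long as this is at most n, and l = k + j - n - 1
  afterwards. The face k = n, missing in b', would be l = j - 1: hence the strict bound in the
  second sum.\<close>

lemma bmu'_tau_pow:
  assumes x: "x \<in> chains (Suc n)" and j: "1 \<le> j" "j \<le> Suc n"
  shows "bmu' n ((\<tau> ^^ j) x) = (\<Sum>l=j..n. (\<tau> ^^ j) (\<mu> l x)) + (\<Sum>l<j-1. (\<tau> ^^ (j - 1)) (\<mu> l x))"
proof -
  have "{..<n} = {..<Suc n - j} \<union> {Suc n - j..<n}" using j by auto
  then have "bmu' n ((\<tau> ^^ j) x) =
      (\<Sum>k<Suc n - j. \<mu> k ((\<tau> ^^ j) x)) + (\<Sum>k=Suc n - j..<n. \<mu> k ((\<tau> ^^ j) x))"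
    unfolding bmu'_def by (simp add: sum.union_disjoint ivl_disj_int)
  also have "(\<Sum>k<Suc n - j. \<mu> k ((\<tau> ^^ j) x)) = (\<Sum>l=j..n. (\<tau> ^^ j) (\<mu> l x))"
    by (rule sum.reindex_bij_witness[of _ "\<lambda>l. l - j" "\<lambda>k. k +
        j"]) (use x in \<open>auto simp: mu_tau_pow\<close>)
  also have "(\<Sum>k=Suc n - j..<n. \<mu> k ((\<tau> ^^ j) x)) = (\<Sum>l<j-1. (\<tau> ^^ (j - 1)) (\<mu> l x))"
    by (rule sum.reindex_bij_witness[of _ "\<lambda>l. l + (Suc n - j)" "\<lambda>k. k - (Suc n - j)"])
      (use x j mu_tau_pow_wrap[of x n k "k + j - Suc n" j for k] in auto)
  finally show ?thesis .
qed

text \<open>b'N = Nb. The unwrapped faces fill l \<ge> j and the wrapped ones, after replacing j - 1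
  by j, fill l < j; together they give every face under every power.\<close>

lemma bmu'_norm:
  assumes x: "x \<in> chains (Suc (Suc n))"
  shows "bmu' (Suc n) (cnorm (Suc n) x) = cnorm n (bmu (Suc n) x)"
proof -
  have mux: "\<mu> l x \<in> chains (Suc n)" if "l \<le> Suc n" for l using mu_chains[OF x] that by simp
  have "bmu' (Suc n) (cnorm (Suc n) x) = (\<Sum>j=1..Suc (Suc n). bmu' (Suc n) ((\<tau> ^^ j) x))"
    unfolding norm_shift[OF x] b_simps2 ..
  also have "\<dots> = (\<Sum>j=1..Suc (Suc n). \<Sum>l=j..Suc n. (\<tau> ^^ j) (\<mu> l x))
      + (\<Sum>j=1..Suc (Suc n). \<Sum>l<j-1. (\<tau> ^^ (j - 1)) (\<mu> l x))"
    using x by (simp add: bmu'_tau_pow sum.distrib del: sum.cl_ivl_Suc sum.atMost_Suc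
        sum.lessThan_Suc)
  also have "(\<Sum>j=1..Suc (Suc n). \<Sum>l=j..Suc n. (\<tau> ^^ j) (\<mu> l x)) =
      (\<Sum>j=1..Suc n. \<Sum>l=j..Suc n. (\<tau> ^^ j) (\<mu> l x))"
    by simp
  \<comment> \<open>After the shift j runs from 0 to n + 1, and the term j = 0 is empty.\<close>
  also have "(\<Sum>j=1..Suc (Suc n). \<Sum>l<j-1. (\<tau> ^^ (j - 1)) (\<mu> l x)) =
      (\<Sum>j=1..Suc n. \<Sum>l<j. (\<tau> ^^ j) (\<mu> l x))"
    unfolding One_nat_def sum.atLeast1_atMost_eq by (subst sum.lessThan_Suc_shift) simp
  also have "(\<Sum>j=1..Suc n. \<Sum>l=j..Suc n. (\<tau> ^^ j) (\<mu> l x)) + (\<Sum>j=1..Suc n. \<Sum>l<j. (\<tau> ^^ j) (\<mu> l x))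
      = (\<Sum>j=1..Suc n. \<Sum>l\<le>Suc n. (\<tau> ^^ j) (\<mu> l x))"
    unfolding sum.distrib[symmetric]
  proof (rule sum.cong[OF refl])
    fix j assume "j \<in> {1..Suc n}"
    then show "(\<Sum>l=j..Suc n. (\<tau> ^^ j) (\<mu> l x)) + (\<Sum>l<j. (\<tau> ^^ j) (\<mu> l x)) =
        (\<Sum>l\<le>Suc n. (\<tau> ^^ j) (\<mu> l x))"
      using sum_atMost_split[of j "Suc n" "\<lambda>l. (\<tau> ^^ j) (\<mu> l x)"] by (simp add: add.commute)
  qed
  also have "\<dots> = cnorm n (bmu (Suc n) x)"
    unfolding norm_shift[OF bmu_chains[OF x]] unfolding bmu_def op_simps ..
  finally show ?thesis .
qed

lemma E_bdelta: "x \<in> chains (Suc n) \<Longrightarrow> j \<le> n \<Longrightarrow> E j (bdelta n x) = bdelta n (E j x) + \<delta> j x"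
  unfolding bdelta_def by (simp add: op_simps E_delta sum.distrib)

section \<open>Cartan homotopy identities for E\<close>

text \<open>\<mu>^(0) anticommutes with the internal differential and E^(1) commutes with it up to
  \<delta>^(1); only that defect survives.\<close>

lemma bdelta_mu_0_E:
  assumes x: "x \<in> chains (Suc (Suc n))"
  shows "bdelta n (\<mu> 0 (E 1 x)) + \<mu> 0 (E 1 (bdelta (Suc n) x)) = \<mu> 0 (\<delta> 1 x)"
  using bdelta_mu[OF E_chains[OF x, of 1], of 0] E_bdelta[OF x, of 1] by (simp add: op_simps)

text \<open>The terms with E^(1) cancel by the simplicial relations. The derivation rule leaves
  \<mu>^(0)\<mu>^(0)E^(2) + \<mu>^(0)\<mu>^(1)E^(2), which is zero by associativity: contraction by
  a derivation is closed for the products.\<close>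

lemma bmu_mu_0_E:
  assumes x: "x \<in> chains (Suc (Suc n))"
  shows "bmu n (\<mu> 0 (E 1 x)) + \<mu> 0 (E 1 (bmu (Suc n) x)) = 0"
proof (cases n)
  case 0
  have "\<mu> 0 (E 1 x) \<in> chains 1" "E 1 (bmu (Suc n) x) \<in> chains 1"
    using mu_chains[OF E_chains[OF x]] E_chains[OF bmu_chains[OF x]] 0 by auto
  then show ?thesis using 0 by (simp add: bmu_def mu_chains_1)
next
  case (Suc m)
  note Ex = E_chains[OF x]
  have 1: "bmu n (\<mu> 0 (E 1 x)) = - (\<Sum>j\<le>n. \<mu> 0 (\<mu> (Suc j) (E 1 x)))"
    unfolding bmu_def sum_negf[symmetric]
    using mu_mu[OF Ex[of 1], of 0 "Suc j" for j] by (intro sum.cong) auto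
  have E1: "E 1 (\<mu> l x) = \<mu> l (if 1 < l then E 1 x else if 1 = l then E 1 x + E 2 x else E 2 x)"
    if "l \<le> Suc n" for l
    using E_mu[OF x, of 1 l] that Suc by (simp add: numeral_2_eq_2)
  have "\<mu> 0 (E 1 (bmu (Suc n) x)) = (\<Sum>l\<le>Suc n. \<mu> 0 (E 1 (\<mu> l x)))"
    unfolding bmu_def op_simps ..
  also have "\<dots> = \<mu> 0 (\<mu> 0 (E 2 x)) + (\<Sum>l\<le>n. \<mu> 0 (E 1 (\<mu> (Suc l) x)))"
    unfolding sum.atMost_Suc_shift using E1[of 0] by simp
  also have "(\<Sum>l\<le>n. \<mu> 0 (E 1 (\<mu> (Suc l) x))) =
      (\<Sum>l\<le>n. \<mu> 0 (\<mu> (Suc l) (E 1 x)) + (if l = 0 then \<mu> 0 (\<mu> 1 (E 2 x)) else 0))"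
    using E1[of "Suc l" for l] by (intro sum.cong) (auto simp: op_simps)
  also have "\<dots> = (\<Sum>l\<le>n. \<mu> 0 (\<mu> (Suc l) (E 1 x))) + \<mu> 0 (\<mu> 1 (E 2 x))"
    by (simp add: sum.distrib)
  also have "\<mu> 0 (\<mu> 1 (E 2 x)) = - \<mu> 0 (\<mu> 0 (E 2 x))"
    using mu_mu[OF Ex[of 2], of 0 1] by simp
  finally show ?thesis unfolding 1 by simp
qed

text \<open>The powers of \<tau> commute with the internal differential, so the only defect is that
  of E^(i), namely \<delta>^(i).\<close>

lemma sg_bdelta:
  assumes x: "x \<in> chains (Suc n)"
  shows "sg E n (bdelta n x) = bdelta n (sg E n x) + sg \<delta> n x"
proof -
  have "(\<tau> ^^ j) (E i (bdelta n x)) = bdelta n ((\<tau> ^^ j) (E i x)) + (\<tau> ^^ j) (\<delta> i x)"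
      if "i \<le> n" for i j
    using x that by (simp add: E_bdelta op_simps bdelta_tau_pow E_chains)
  then show ?thesis unfolding sg_def b_simps by (simp add: sum.distrib)
qed

text \<open>The relation b'S = Sb + N\<mu>^(0)E^(1) for the cyclic sum S of H1. All terms have the
  form \<open>g i j l\<close>, and both sides run over the same triples: i < j with any l, together
  with j = i and l < i.\<close>

lemma bmu'_sg:
  assumes x: "x \<in> chains (Suc (Suc m))"
  shows "bmu' (Suc m) (sg E (Suc m) x) = sg E m (bmu (Suc m) x) + cnorm m (\<mu> 0 (E 1 x))"
proof -
  let ?n = "Suc m"
  define g where "g i j l = (\<tau> ^^ j) (\<mu> l (E i x))" for i j l
  have Ex: "E i x \<in> chains (Suc ?n)" for i using x by (rule E_chains)
  have mux: "\<mu> l x \<in> chains (Suc m)" if "l \<le> ?n" for l using mu_chains[OF x] that by simp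
  have "bmu' ?n (sg E ?n x) = (\<Sum>i=1..?n. \<Sum>j=i+1..?n+1. bmu' ?n ((\<tau> ^^ j) (E i x)))"
    unfolding sg_def b_simps2 ..
  also have "\<dots> = (\<Sum>i=1..?n. \<Sum>j=i+1..?n+1. (\<Sum>l=j..?n. g i j l) + (\<Sum>l<j-1. g i (j - 1) l))"
    unfolding g_def by (intro sum.cong refl bmu'_tau_pow[OF Ex]) auto
  \<comment> \<open>The unwrapped sum is empty at j = n + 1. The wrapped one is moved to j - 1 and
    so starts at j = i; only this row stays incomplete.\<close>
  also have "\<dots> = (\<Sum>i=1..?n. (\<Sum>j=i+1..?n. \<Sum>l\<le>?n. g i j l) + (\<Sum>l<i. g i i l))"
  proof (rule sum.cong[OF refl])
    fix i assume i: "i \<in> {1..?n}"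
    have "(\<Sum>j=i+1..?n+1. \<Sum>l=j..?n. g i j l) = (\<Sum>j=i+1..?n. \<Sum>l=j..?n. g i j l)"
      using i by simp
    moreover have "(\<Sum>j=i+1..?n+1. \<Sum>l<j-1. g i (j - 1) l) = (\<Sum>j=i..?n. \<Sum>l<j. g i j l)"
      unfolding sum.shift_bounds_cl_nat_ivl by simp
    moreover have "(\<Sum>j=i..?n. \<Sum>l<j. g i j l) = (\<Sum>l<i. g i i l) + (\<Sum>j=i+1..?n. \<Sum>l<j. g i j l)"
      using i by (simp add: sum.atLeast_Suc_atMost del: sum.cl_ivl_Suc)
    moreover have "(\<Sum>l\<le>?n. g i j l) = (\<Sum>l=j..?n. g i j l) + (\<Sum>l<j. g i j l)"
        if "j \<in> {i+1..?n}" for j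
      using sum_atMost_split[of j ?n "g i j"] that
          by (simp only: atLeastAtMost_iff add.commute le_SucI)
    ultimately show "(\<Sum>j=i+1..?n+1. (\<Sum>l=j..?n. g i j l) + (\<Sum>l<j-1. g i (j - 1) l)) =
       (\<Sum>j=i+1..?n. \<Sum>l\<le>?n. g i j l) + (\<Sum>l<i. g i i l)"
      by (simp only: sum.distrib add_ac cong: sum.cong)
  qed
  finally have left: "bmu' ?n (sg E ?n x) = (\<Sum>i=1..?n. (\<Sum>j=i+1..?n. \<Sum>l\<le>?n. g i j l) +
      (\<Sum>l<i. g i i l))" .
  \<comment> \<open>At l = i the derivation rule gives both E^(i) and E^(i+1), so the two ranges
    overlap there.\<close>
  have E_bmu: "E i (bmu ?n x) = (\<Sum>l=i..?n. \<mu> l (E i x)) + (\<Sum>l<Suc i. \<mu> l (E (Suc i) x))"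
    if i: "i \<in> {1..m}" for i
  proof -
    have "E i (bmu ?n x) = (\<Sum>l\<le>?n. \<mu> l (if i \<le> l then E i x else 0) +
        \<mu> l (if l \<le> i then E (Suc i) x else 0))"
      unfolding bmu_def op_simps using i by (intro sum.cong refl) (auto simp: E_mu[OF x] op_simps)
    also have "\<dots> = (\<Sum>l\<in>{..?n} \<inter> {l. i \<le> l}. \<mu> l (E i x)) +
        (\<Sum>l\<in>{..?n} \<inter> {l. l \<le> i}. \<mu> l (E (Suc i) x))"
      unfolding sum.distrib sum.inter_restrict[OF finite_atMost]
          by (simp add: if_distrib op_simps cong: if_cong)
    also have "{..?n} \<inter> {l. i \<le> l} = {i..?n}" by auto
    also have "{..?n} \<inter> {l. l \<le> i} = {..<Suc i}" using i by auto
    finally show ?thesis .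
  qed
  have "sg E m (bmu ?n x) = (\<Sum>i=1..m. \<Sum>j=i+1..?n. (\<Sum>l=i..?n. g i j l) + (\<Sum>l<Suc i. g (Suc i) j l))"
    unfolding sg_def g_def using E_bmu by (simp add: op_simps del: sum.cl_ivl_Suc sum.lessThan_Suc)
  also have "\<dots> = (\<Sum>i=1..m. \<Sum>j=i+1..?n. \<Sum>l=i..?n. g i j l) +
      (\<Sum>i=1..m. \<Sum>j=i+1..?n. \<Sum>l<Suc i. g (Suc i) j l)"
    by (simp only: sum.distrib)
  also have "(\<Sum>i=1..m. \<Sum>j=i+1..?n. \<Sum>l=i..?n. g i j l) = (\<Sum>i=1..?n. \<Sum>j=i+1..?n. \<Sum>l=i..?n. g i j l)"
    by simp
  also have "(\<Sum>i=1..m. \<Sum>j=i+1..?n. \<Sum>l<Suc i. g (Suc i) j l) = (\<Sum>i=2..?n. \<Sum>j=i..?n. \<Sum>l<i. g i j l)"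
    using sum.shift_bounds_cl_Suc_ivl[of "\<lambda>i. \<Sum>j=i..?n. \<Sum>l<i. g i j l" 1 m]
        by (simp add: numeral_2_eq_2)
  finally have sg_bmu: "sg E m (bmu ?n x) = (\<Sum>i=1..?n. \<Sum>j=i+1..?n. \<Sum>l=i..?n. g i j l)
     + (\<Sum>i=2..?n. \<Sum>j=i..?n. \<Sum>l<i. g i j l)" .
  have "\<mu> 0 (E 1 x) \<in> chains ?n" using mu_chains[OF Ex[of 1], of 0] by simp
  then have norm_mu: "cnorm m (\<mu> 0 (E 1 x)) = (\<Sum>j=1..?n. g 1 j 0)"
    unfolding g_def by (rule norm_shift)
  have "sg E m (bmu ?n x) + cnorm m (\<mu> 0 (E 1 x)) = (\<Sum>i=1..?n. \<Sum>j=i+1..?n. \<Sum>l=i..?n. g i j l)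
     + ((\<Sum>j=1..?n. g 1 j 0) + (\<Sum>i=2..?n. \<Sum>j=i..?n. \<Sum>l<i. g i j l))"
    unfolding sg_bmu norm_mu by (simp only: add_ac)
  \<comment> \<open>The norm term is the summand i = 1 missing in the other sum, where l < 1 leaves
    l = 0.\<close>
  also have "(\<Sum>j=1..?n. g 1 j 0) + (\<Sum>i=2..?n. \<Sum>j=i..?n. \<Sum>l<i. g i j l) =
      (\<Sum>i=1..?n. \<Sum>j=i..?n. \<Sum>l<i. g i j l)"
    by (subst (2) sum.atLeast_Suc_atMost) (simp_all add: numeral_2_eq_2 del: sum.cl_ivl_Suc)
  also have "(\<Sum>i=1..?n. \<Sum>j=i+1..?n. \<Sum>l=i..?n. g i j l) + (\<Sum>i=1..?n. \<Sum>j=i..?n. \<Sum>l<i. g i j l) =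
     (\<Sum>i=1..?n. (\<Sum>j=i+1..?n. \<Sum>l\<le>?n. g i j l) + (\<Sum>l<i. g i i l))"
    unfolding sum.distrib[symmetric]
  proof (rule sum.cong[OF refl])
    fix i assume i: "i \<in> {1..?n}"
    have "(\<Sum>j=i..?n. \<Sum>l<i. g i j l) = (\<Sum>l<i. g i i l) + (\<Sum>j=i+1..?n. \<Sum>l<i. g i j l)"
      using i by (simp add: sum.atLeast_Suc_atMost del: sum.cl_ivl_Suc)
    moreover have "(\<Sum>l\<le>?n. g i j l) = (\<Sum>l=i..?n. g i j l) + (\<Sum>l<i. g i j l)" for j
      using sum_atMost_split[of i ?n "g i j"] i
          by (simp only: atLeastAtMost_iff add.commute le_SucI)
    ultimately show "(\<Sum>j=i+1..?n. \<Sum>l=i..?n. g i j l) + (\<Sum>j=i..?n. \<Sum>l<i. g i j l) =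
       (\<Sum>j=i+1..?n. \<Sum>l\<le>?n. g i j l) + (\<Sum>l<i. g i i l)"
      by (simp only: sum.distrib add_ac)
  qed
  finally show ?thesis unfolding left by (rule sym)
qed

text \<open>(1 - \<tau>^{-1})S telescopes in j to the sum of E^(i) - \<tau>^i E^(i) over i \<ge> 1,
  and E^(0)N is the sum of all \<tau>^i E^(i).\<close>

lemma sg_left:
  assumes x: "x \<in> chains (Suc n)"
  shows "sg E n x - (\<tau> ^^ n) (sg E n x) + E 0 (cnorm n x) = (\<Sum>i\<le>n. E i x)"
proof -
  have Ex: "E i x \<in> chains (Suc n)" for i using x by (rule E_chains)
  have "(\<tau> ^^ n) ((\<tau> ^^ j) y) = (\<tau> ^^ (j - 1)) y" if "j \<ge> 1" "y \<in> chains (Suc n)" for j y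
  proof -
    have *: "n + j = (j - 1) + Suc n" using that by simp
    have "(\<tau> ^^ n) ((\<tau> ^^ j) y) = (\<tau> ^^ (n + j)) y" by (simp only: funpow_add comp_apply)
    also have "\<dots> = (\<tau> ^^ (j - 1)) ((\<tau> ^^ Suc n) y)" unfolding *
        by (simp only: funpow_add comp_apply)
    finally show ?thesis by (simp only: tau_pow_id[OF that(2)])
  qed
  then have "sg E n x - (\<tau> ^^ n) (sg E n x) =
      (\<Sum>i=1..n. \<Sum>j=Suc i..Suc n. (\<tau> ^^ j) (E i x) - (\<tau> ^^ (j - 1)) (E i x))"
    unfolding sg_def op_simps using Ex
    by (simp add: sum_subtractf[symmetric] del: sum.cl_ivl_Suc)
  also have "\<dots> = (\<Sum>i=1..n. (\<tau> ^^ Suc n) (E i x) - (\<tau> ^^ i) (E i x))"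
  proof (rule sum.cong[OF refl])
    fix i assume "i \<in> {1..n}"
    then have "i \<le> Suc n" by simp
    from sum_telescope''[OF this, of "\<lambda>j. (\<tau> ^^ j) (E i x)"]
    show "(\<Sum>j=Suc i..Suc n. (\<tau> ^^ j) (E i x) - (\<tau> ^^ (j - 1)) (E i x)) =
        (\<tau> ^^ Suc n) (E i x) - (\<tau> ^^ i) (E i x)" .
  qed
  also have "\<dots> = (\<Sum>i=1..n. E i x - (\<tau> ^^ i) (E i x))"
    by (simp only: tau_pow_id[OF Ex])
  finally have 1: "sg E n x - (\<tau> ^^ n) (sg E n x) = (\<Sum>i=1..n. E i x - (\<tau> ^^ i) (E i x))" .
  have "E 0 (cnorm n x) = (\<Sum>i\<le>n. (\<tau> ^^ i) (E i x))"
    unfolding cnorm_def op_simps using E_tau_pow[OF x, of 0] by simp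
  also have "\<dots> = E 0 x + (\<Sum>i=1..n. (\<tau> ^^ i) (E i x))"
    using sum_atMost_split[of 1 n "\<lambda>i. (\<tau> ^^ i) (E i x)"] by simp
  finally show ?thesis
    using sum_atMost_split[of 1 n "\<lambda>i. E i x"] unfolding 1 by (simp add: sum_subtractf)
qed

text \<open>Counterpart for C^+(A). As E^(i+1)\<tau>^{-1} = \<tau>^{-1}E^(i), the sum S\<tau>^{-1}
  is S with both indices lowered: it lacks the terms with \<tau>^{n+1} = 1 and has extra terms
  \<tau>^j E^(0), which NE^(0) compensates.\<close>

lemma sg_right:
  assumes x: "x \<in> chains (Suc n)"
  shows "sg E n (x - (\<tau> ^^ n) x) + cnorm n (E 0 x) = (\<Sum>i\<le>n. E i x)"
proof -
  have Ex: "E i x \<in> chains (Suc n)" for i using x by (rule E_chains)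
  have "(\<tau> ^^ Suc j) ((\<tau> ^^ n) y) = (\<tau> ^^ j) y" if "y \<in> chains (Suc n)" for j y
  proof -
    have "(\<tau> ^^ Suc j) ((\<tau> ^^ n) y) = (\<tau> ^^ j) ((\<tau> ^^ Suc n) y)" by (simp add: funpow_swap1)
    then show ?thesis by (simp only: tau_pow_id[OF that])
  qed
  then have *: "(\<tau> ^^ Suc j) (E (Suc i) ((\<tau> ^^ n) x)) = (\<tau> ^^ j) (E i x)" if "i < n" for i j
    using E_tau_inv[OF x that] Ex by simp
  have "sg E n ((\<tau> ^^ n) x) = (\<Sum>i<n. \<Sum>j=Suc (Suc i)..Suc n. (\<tau> ^^ j) (E (Suc i) ((\<tau> ^^ n) x)))"
    unfolding sg_def One_nat_def sum.atLeast1_atMost_eq by simp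
  also have "\<dots> = (\<Sum>i<n. \<Sum>j=Suc i..n. (\<tau> ^^ j) (E i x))"
    unfolding sum.shift_bounds_cl_Suc_ivl using * by (intro sum.cong refl) simp
  \<comment> \<open>The added summand i = n is empty.\<close>
  also have "\<dots> = (\<Sum>i\<le>n. \<Sum>j=Suc i..n. (\<tau> ^^ j) (E i x))"
    by (simp flip: lessThan_Suc_atMost)
  also have "\<dots> = (\<Sum>j=1..n. (\<tau> ^^ j) (E 0 x)) + (\<Sum>i=1..n. \<Sum>j=Suc i..n. (\<tau> ^^ j) (E i x))"
    by (subst sum_atMost_split[of 1]) (simp_all add: lessThan_Suc)
  finally have 1: "sg E n ((\<tau> ^^ n) x) = (\<Sum>j=1..n. (\<tau> ^^ j) (E 0 x)) +
      (\<Sum>i=1..n. \<Sum>j=Suc i..n. (\<tau> ^^ j) (E i x))" .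
  have "sg E n x = (\<Sum>i=1..n. (\<Sum>j=Suc i..n. (\<tau> ^^ j) (E i x)) + (\<tau> ^^ Suc n) (E i x))"
    unfolding sg_def by simp
  also have "\<dots> = (\<Sum>i=1..n. \<Sum>j=Suc i..n. (\<tau> ^^ j) (E i x)) + (\<Sum>i=1..n. E i x)"
    unfolding sum.distrib by (simp only: tau_pow_id[OF Ex])
  finally have 2: "sg E n x = (\<Sum>i=1..n. \<Sum>j=Suc i..n. (\<tau> ^^ j) (E i x)) + (\<Sum>i=1..n. E i x)" .
  have 3: "cnorm n (E 0 x) = E 0 x + (\<Sum>j=1..n. (\<tau> ^^ j) (E 0 x))"
    unfolding cnorm_def by (subst sum_atMost_split[of 1]) (simp_all add: lessThan_Suc)
  have 4: "(\<Sum>i\<le>n. E i x) = E 0 x + (\<Sum>i=1..n. E i x)"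
    by (subst sum_atMost_split[of 1]) (simp_all add: lessThan_Suc)
  show ?thesis unfolding b_simps2 1 2 3 4 by simp
qed

section \<open>Putting e in front\<close>

lemma lin_he: "lin Y \<Longrightarrow> lin (\<lambda>x. he A (Y x))"
  unfolding he_def by (rule lin_lin_ext)

lemmas he_simps = lin_simps[OF lin_he[OF lin_id]]

lemma he_tns: "he A (tns A w) = tns A (ee # w)"
proof -
  have "multilin (ext_smul A) tscale (\<lambda>w. tns A (ee # w))"
    unfolding multilin_def
  proof (intro allI)
    fix xs ys
    show "Vector_Spaces.linear (ext_smul A) tscale (\<lambda>x. tns A (ee # xs @ x # ys))"
      using multilin_tensor[OF vs_ext[OF A]] unfolding multilin_def append_Cons[symmetric] by blast
  qed
  then show ?thesis unfolding he_def by (rule lin_ext_tensor) (auto intro: TS.span_base)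
qed

lemma he_T: "he A (T lw) = T ((0, ee) # lw)"
  by (simp add: T_def he_tns)

lemma ee_gr: "ee \<in> ext_gr D 0"
  by (simp add: ext_gr_def ee_def S.subspace_0[OF D_props(4)])

lemma ee_mult: "ext_mult A ee x = x" "ext_mult A x ee = x"
  by (simp_all add: ext_mult_def ee_def)

lemma ee_dif: "ext_dif A ee = 0"
  by (simp add: ext_dif_def ee_def dif_0 zero_prod_def)

lemma he_chains: "x \<in> chains n \<Longrightarrow> he A x \<in> chains (Suc n)"
proof (rule chains_in[OF lin_he[OF lin_id]])
  fix lw :: "('a, 'k) lword" assume "good lw" "length lw = n"
  then have "he A (T lw) = tscale 1 (T ((0, ee) # lw))" "good ((0, ee) # lw)" "length ((0, ee) #
      lw) = Suc n"
    by (simp_all add: he_T ee_gr)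
  then show "\<exists>c lw'. he A (T lw) = tscale c (T lw') \<and> good lw' \<and> length lw' = Suc n" by blast
qed

lemma delta_0_he: "x \<in> chains (Suc n) \<Longrightarrow> \<delta> 0 (he A x) = 0"
proof (rule chains_eqI[of "\<lambda>x. \<delta> 0 (he A x)" "\<lambda>x. 0"])
  fix lw :: "('a, 'k) lword" assume "good lw" "length lw = Suc n"
  then show "\<delta> 0 (he A (T lw)) = 0"
    using delta_T[of "[]" 0 ee lw 0] by (simp add: he_T ee_gr ee_dif T_letter(3)[of "[]",
        simplified])
qed (intro lin_ops lin_intros lin_he)+

text \<open>The minus sign is the Koszul sign of passing se, which is odd.\<close>

lemma delta_he: "x \<in> chains (Suc n) \<Longrightarrow> i \<le> n \<Longrightarrow> \<delta> (Suc i) (he A x) = - he A (\<delta> i x)"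
proof (rule chains_eqI[of "\<lambda>x. \<delta> (Suc i) (he A x)" "\<lambda>x. - he A (\<delta> i x)"])
  fix lw :: "('a, 'k) lword" assume lw: "good lw" "length lw = Suc n" "i \<le> n"
  have "i < length lw" using lw by simp
  then obtain xs d x ys where z: "lw = xs @ (d, x) # ys" "length xs = i" by (rule split_at)
  have "\<delta> (Suc i) (T (((0, ee) # xs) @ (d, x) # ys)) =
      tscale (ksign (1 + sh xs)) (T (((0, ee) # xs) @ (d + 1, ext_dif A x) # ys))"
    using lw z by (subst delta_T; simp add: ee_gr)
  moreover have "\<delta> i (T (xs @ (d, x) # ys)) = tscale (ksign (sh xs)) (T (xs @ (d +
      1, ext_dif A x) # ys))"
    using lw z by (subst delta_T; simp)
  ultimately show "\<delta> (Suc i) (he A (T lw)) = - he A (\<delta> i (T lw))"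
    unfolding z(1) by (cases "sh xs") (simp_all add: he_T he_simps ksign_def)
qed (intro lin_ops lin_intros lin_he)+

lemma mu_0_he: "x \<in> chains (Suc n) \<Longrightarrow> \<mu> 0 (he A x) = x"
proof (rule chains_eqI[of "\<lambda>x. \<mu> 0 (he A x)" "\<lambda>x. x"])
  fix lw :: "('a, 'k) lword" assume lw: "good lw" "length lw = Suc n"
  obtain d x zs where z: "lw = (d, x) # zs" using lw(2) by (cases lw) auto
  then show "\<mu> 0 (he A (T lw)) = T lw"
    using mu_T[of "[]" 0 ee d x zs 0] lw by (simp add: he_T ee_gr ee_mult ksign_def)
qed (intro lin_ops lin_intros lin_he)+

lemma mu_he: "x \<in> chains (Suc n) \<Longrightarrow> i < n \<Longrightarrow> \<mu> (Suc i) (he A x) = - he A (\<mu> i x)"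
proof (rule chains_eqI[of "\<lambda>x. \<mu> (Suc i) (he A x)" "\<lambda>x. - he A (\<mu> i x)"])
  fix lw :: "('a, 'k) lword" assume lw: "good lw" "length lw = Suc n" "i < n"
  have "Suc i < length lw" using lw by simp
  then obtain xs d x d' y ys where z: "lw = xs @ (d, x) # (d', y) # ys" "length xs = i"
      by (rule split_two)
  have "\<mu> (Suc i) (T (((0, ee) # xs) @ (d, x) # (d', y) # ys)) =
      tscale (ksign (1 + sh xs + of_int d)) (T (((0, ee) # xs) @ (d + d', ext_mult A x y) # ys))"
    using lw z by (subst mu_T; simp add: ee_gr)
  moreover have "\<mu> i (T (xs @ (d, x) # (d', y) # ys)) =
      tscale (ksign (sh xs + of_int d)) (T (xs @ (d + d', ext_mult A x y) # ys))"
    using lw z by (subst mu_T; simp)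
  ultimately show "\<mu> (Suc i) (he A (T lw)) = - he A (\<mu> i (T lw))"
    unfolding z(1) by (cases "sh xs"; cases "of_int d :: bit") (simp_all add: he_T he_simps
        ksign_def)
qed (intro lin_ops lin_intros lin_he)+

text \<open>The wrapped product a_n e = a_n turns the word back by one step, which is \<tau>^{-1} =
  \<tau>^n. Together with \<mu>^(0), which removes e again, this is the source of 1 -
  \<tau>^{-1}.\<close>

lemma mu_last_he: "x \<in> chains (Suc n) \<Longrightarrow> \<mu> (Suc n) (he A x) = - (\<tau> ^^ n) x"
proof (rule chains_eqI[of "\<lambda>x. \<mu> (Suc n) (he A x)" "\<lambda>x. - (\<tau> ^^ n) x"])
  fix lw :: "('a, 'k) lword" assume lw: "good lw" "length lw = Suc n"
  then obtain ys d x where z: "lw = ys @ [(d, x)]" "length ys = n"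
    by (cases lw rule: rev_cases) auto
  have "\<mu> (Suc n) (T ((0, ee) # ys @ [(d, x)])) =
      tscale (ksign ((of_int d + 1) * (0 + sh ys) + 1)) (T ((d + 0, ext_mult A x ee) # ys))"
    using lw z by (subst mu_T_last; simp add: ee_gr)
  moreover have "(\<tau> ^^ n) (T (ys @ [(d, x)])) =
      tscale (ksign (sh ys * sh [(d, x)])) (T ([(d, x)] @ ys))"
    using tau_pow_T[of ys "[(d, x)]"] lw z by simp
  ultimately show "\<mu> (Suc n) (he A (T lw)) = - (\<tau> ^^ n) (T lw)"
    unfolding z(1) by (cases "sh ys"; cases "of_int d :: bit") (simp_all add: he_T ksign_def
        ee_mult)
qed (intro lin_ops lin_intros lin_he)+

lemma E_0_he: "x \<in> chains (Suc n) \<Longrightarrow> E 0 (he A x) = 0"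
proof (rule chains_eqI[of "\<lambda>x. E 0 (he A x)" "\<lambda>x. 0"])
  fix lw :: "('a, 'k) lword" assume "good lw" "length lw = Suc n"
  then show "E 0 (he A (T lw)) = 0"
    using E_T[of "(0, ee) # lw" 0] by (simp add: he_T ee_gr)
qed (intro lin_ops lin_intros lin_he)+

lemma E_he: "x \<in> chains (Suc n) \<Longrightarrow> E (Suc i) (he A x) = he A (E i x)"
proof (rule chains_eqI[of "\<lambda>x. E (Suc i) (he A x)" "\<lambda>x. he A (E i x)"])
  fix lw :: "('a, 'k) lword" assume "good lw" "length lw = Suc n"
  then show "E (Suc i) (he A (T lw)) = he A (E i (T lw))"
    using E_T[of "(0, ee) # lw" "Suc i"] by (simp add: he_T ee_gr E_T he_simps)
qed (intro lin_ops lin_intros lin_he)+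

lemma bdelta_he:
  assumes x: "x \<in> chains (Suc n)"
  shows "bdelta (Suc n) (he A x) = - he A (bdelta n x)"
  unfolding bdelta_def sum.atMost_Suc_shift he_simps
  using x by (simp add: delta_0_he delta_he sum_negf del: sum.atMost_Suc)

lemma bmu_he:
  assumes x: "x \<in> chains (Suc n)"
  shows "bmu (Suc n) (he A x) = x - (\<tau> ^^ n) x - he A (bmu' n x)"
proof -
  have "bmu (Suc n) (he A x) = \<mu> 0 (he A x) + ((\<Sum>i<n. \<mu> (Suc i) (he A x)) + \<mu> (Suc n) (he A x))"
    by (simp add: bmu_def sum.atMost_shift add.assoc)
  also have "(\<Sum>i<n. \<mu> (Suc i) (he A x)) = - he A (bmu' n x)"
    unfolding bmu'_def he_simps sum_negf[symmetric] using x by (simp add: mu_he)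
  also have "\<mu> 0 (he A x) + (- he A (bmu' n x) + \<mu> (Suc n) (he A x)) =
      x - (\<tau> ^^ n) x - he A (bmu' n x)"
    unfolding mu_0_he[OF x] mu_last_he[OF x] by (simp add: algebra_simps)
  finally show ?thesis .
qed

section \<open>The extended complex\<close>

lemma letter_decomp:
  fixes x :: "'a \<times> 'k"
  shows "\<exists>c I. finite I \<and> x = (\<Sum>i\<in>I. c i) \<and> (\<forall>i. c i \<in> ext_gr D i)"
  using gcomp_decomp[OF vs_ext[OF A] gr_ext_D, of x] unfolding is_decomp_def
  by (intro exI[of _ "gcomp (ext_gr D) x"] exI[of _ "{i. gcomp (ext_gr D) x i \<noteq> 0}"]) blast

text \<open>The grading of A itself is used, so that the components have no e-part either.\<close>

lemma A_letter_decomp: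
  assumes "snd x = 0"
  shows "\<exists>c I. finite I \<and> x = (\<Sum>i\<in>I. c i) \<and> (\<forall>i. c i \<in> ext_gr D i \<and> snd (c i) = (0 :: 'k))"
proof -
  have "is_grading (smul A) UNIV D" using D unfolding Z_grading_lift_def by blast
  from gcomp_decomp[OF S.vector_space_axioms this, of "fst x"]
  obtain c I where c: "finite I" "fst x = (\<Sum>i\<in>I. c i)" "\<forall>i. c i \<in> D i"
    unfolding is_decomp_def by blast
  have "x = (\<Sum>i\<in>I. emb (c i))"
    using c assms by (intro prod_eqI) (simp_all add: fst_sum snd_sum emb_def)
  moreover have "\<forall>i. emb (c i) \<in> ext_gr D i \<and> snd (emb (c i) :: 'a \<times> 'k) = 0"
    using c by (simp add: emb_def ext_gr_def)
  ultimately show ?thesis using c(1) by (intro exI[of _ "\<lambda>i. emb (c i)"] exI[of _ I]) blast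
qed

text \<open>The prefix \<open>us\<close> is already expanded, and the induction splits the next
  letter of w. L is a class of letters closed under homogeneous components: all of A^e, or only
  A.\<close>

lemma tns_expand:
  assumes L: "\<And>x. x \<in> L \<Longrightarrow> \<exists>c I. finite I \<and> x = (\<Sum>i\<in>I. c i) \<and> (\<forall>i. c i \<in> ext_gr D i \<inter> L)"
    and "set w \<subseteq> L" "good us" "snd ` set us \<subseteq> L"
  shows "tns A (map snd us @ w) \<in>
     TS.span {T lw |lw. good lw \<and> length lw = length us + length w \<and> snd ` set lw \<subseteq> L}"
  using assms(2-)
proof (induction w arbitrary: us)
  case Nil
  have "T us \<in> {T lw |lw. good lw \<and> length lw = length us + length [] \<and> snd ` set lw \<subseteq> L}"
    using Nil by auto
  then show ?case unfolding T_def[symmetric] append_Nil2 by (rule TS.span_base)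
next
  case (Cons x w)
  then obtain c I where c: "finite I" "x = (\<Sum>i\<in>I. c i)" "\<And>i. c i \<in> ext_gr D i" "\<And>i. c i \<in> L"
    using L[of x] by auto
  have lin: "Vector_Spaces.linear (ext_smul A) tscale (\<lambda>x. tns A (map snd us @ x # w))"
    using multilin_tensor[OF vs_ext[OF A]] unfolding multilin_def by blast
  have add: "tns A (map snd us @ (y + z) # w) =
      tns A (map snd us @ y # w) + tns A (map snd us @ z # w)" for y z
    using lin unfolding linear_iff' by blast
  have zero: "tns A (map snd us @ 0 # w) = 0"
    using add[of 0 0] by (metis add_0_left add_cancel_right_left)
  have "tns A (map snd us @ (\<Sum>i\<in>I. c i) # w) = (\<Sum>i\<in>I. tns A (map snd us @ c i # w))"
    using c(1)
  proof (induction I rule: finite_induct)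
    case empty
    then show ?case using zero by (simp only: sum.empty)
  next
    case (insert i I)
    show ?case unfolding sum.insert[OF insert(1,2)] add insert(3) ..
  qed
  also have "\<dots> \<in> TS.span {T lw |lw. good lw \<and> length lw = length us + length (x # w) \<and>
      snd ` set lw \<subseteq> L}"
  proof (rule TS.span_sum)
    fix i
    have "tns A (map snd (us @ [(i, c i)]) @ w) \<in>
       TS.span {T lw |lw. good lw \<and> length lw = length (us @ [(i, c i)]) + length w \<and>
           snd ` set lw \<subseteq> L}"
      by (rule Cons.IH) (use Cons.prems c in auto)
    then show "tns A (map snd us @ c i # w) \<in>
       TS.span {T lw |lw. good lw \<and> length lw = length us + length (x # w) \<and> snd ` set lw \<subseteq> L}"
      by simp
  qed
  finally show ?case using c(2) by simp
qed

lemma tns_chains: "tns A w \<in> chains (length w)"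
proof -
  have "tns A (map snd ([] :: ('a, 'k) lword) @ w) \<in>
      TS.span {T lw |lw. good lw \<and> length lw = length ([] :: ('a, 'k) lword) + length w \<and>
          snd ` set lw \<subseteq> UNIV}"
    by (rule tns_expand) (use letter_decomp in auto)
  then show ?thesis by (simp add: chains_def)
qed

lemma chains_span_range: "x \<in> chains n \<Longrightarrow> x \<in> TS.span (range (tns A))"
  unfolding chains_def by (erule TS.span_mono[THEN subsetD, rotated]) (auto simp: T_def)

text \<open>On words of one length, a formula depending on the length is a single member of the
  family X; this replaces \<open>lin_ext\<close> by explicit sums.\<close>

lemma lin_ext_chains:
  assumes X: "\<And>n. lin (X n)" and span: "\<And>x n. x \<in> chains n \<Longrightarrow> X n x \<in> TS.span (range (tns A))"
    and x: "x \<in> chains n"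
  shows "lin_ext (\<lambda>w. X (length w) (tns A w)) x = X n x"
proof -
  have *: "lin_ext (\<lambda>w. X (length w) (tns A w)) (tns A w) = X (length w) (tns A w)" for w
    by (rule lin_ext_length[OF vs_ext[OF A] X span[OF tns_chains]])
  have "lin (lin_ext (\<lambda>w. X (length w) (tns A w)))" by (rule lin_lin_ext[OF lin_id])
  from this X[of n] _ x show ?thesis
    by (rule chains_eqI) (use * in \<open>auto simp: T_def\<close>)
qed

lemma mu_in_span: "x \<in> chains n \<Longrightarrow> \<mu> i x \<in> TS.span (range (tns A))"
  unfolding chains_def
proof (rule lin_in_span[OF _ lin_mu[OF lin_id]])
  fix y assume "y \<in> {T lw |lw. good lw \<and> length lw = n}"
  then obtain lw where lw: "y = T lw" "good lw" by blast
  show "\<mu> i y \<in> TS.span (range (tns A))"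
  proof (cases "length lw \<le> 1 \<or> length lw \<le> i")
    case True
    then show ?thesis using mu_T_zero[OF lw(2) True] lw(1) by (simp only: TS.span_zero)
  next
    case False
    then have "length lw = Suc (length lw - 1)" "i \<le> length lw - 1" "length lw - 1 \<ge> 1" by auto
    from mu_word[OF lw(2) this] obtain c lw' where "\<mu> i (T lw) = tscale c (T lw')" by blast
    then show ?thesis unfolding lw(1) T_def by (simp only: TS.span_scale TS.span_base rangeI)
  qed
qed

section \<open>Explicit form of the operators on words of fixed length\<close>

lemma be_chains:
  assumes x: "x \<in> chains (Suc n)"
  shows "be A x = bdelta n x + bmu n x"
proof -
  define X where "X m x = (\<Sum>i=0..m-1. \<delta> i x) + (\<Sum>i=0..m-1. \<mu> i x)" for m x
  have "be A x = lin_ext (\<lambda>w. X (length w) (tns A w)) x"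
    by (simp add: be_def X_def Let_def)
  also have "\<dots> = X (Suc n) x"
  proof (rule lin_ext_chains[OF _ _ x])
    show "lin (X m)" for m unfolding X_def by (intro lin_ops lin_intros)
    show "X m y \<in> TS.span (range (tns A))" if "y \<in> chains m" for y m
      unfolding X_def using that
      by (intro TS.span_add TS.span_sum chains_span_range[OF delta_chains[OF that]] mu_in_span[OF
          that])
  qed
  finally show ?thesis by (simp add: X_def bdelta_def bmu_def atMost_atLeast0)
qed

lemma NN_chains:
  assumes x: "x \<in> chains (Suc n)"
  shows "NN A x = cnorm n x"
proof -
  define X where "X m x = (\<Sum>i=0..m-1. (\<tau> ^^ i) x)" for m x
  have "NN A x = lin_ext (\<lambda>w. X (length w) (tns A w)) x"
    by (simp add: NN_def X_def Let_def)
  also have "\<dots> = X (Suc n) x"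
  proof (rule lin_ext_chains[OF _ _ x])
    show "lin (X m)" for m unfolding X_def by (intro lin_ops lin_intros)
    show "X m y \<in> TS.span (range (tns A))" if "y \<in> chains m" for y m
      using that chains_span_range unfolding X_def
      by (cases m) (auto intro!: TS.span_sum intro: chains_span_range[OF tau_pow_chains])
  qed
  finally show ?thesis by (simp add: X_def cnorm_def atMost_atLeast0)
qed

text \<open>The operator inside \<open>VV\<close> with \<delta> made a parameter: \<open>VV\<close>
  folds to it with \<Phi> = \<delta>, and H1 uses \<Phi> = E.\<close>

definition SG :: "(nat \<Rightarrow> ('a, 'k) chain \<Rightarrow> ('a, 'k) chain) \<Rightarrow> ('a, 'k) chain \<Rightarrow> ('a, 'k) chain" where
  "SG \<Phi> = lin_ext (\<lambda>w. let n = length w - 1 in \<Sum>i=1..n. \<Sum>j=i+1..n+1. (\<tau> ^^ j) (\<Phi> i (tns A w)))"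

lemma SG_chains:
  assumes x: "x \<in> chains (Suc n)" and \<Phi>: "\<And>i. lin (\<Phi> i)" "\<And>i n x. x \<in> chains n \<Longrightarrow> \<Phi> i x \<in> chains n"
  shows "SG \<Phi> x = sg \<Phi> n x"
proof -
  define X where "X m = sg \<Phi> (m - 1)" for m
  have "SG \<Phi> x = lin_ext (\<lambda>w. X (length w) (tns A w)) x"
    by (simp add: SG_def X_def sg_def Let_def)
  also have "\<dots> = X (Suc n) x"
  proof (rule lin_ext_chains[OF _ _ x])
    show "lin (X m)" for m unfolding X_def sg_def by (intro lin_tau_pow lin_sum \<Phi>)
    show "X m y \<in> TS.span (range (tns A))" if "y \<in> chains m" for y m
      using that chains_span_range[OF tau_pow_chains[OF \<Phi>(2)]] unfolding X_def sg_def
      by (cases m) (auto intro!: TS.span_sum simp: TS.span_zero simp del: sum.cl_ivl_Suc)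
  qed
  finally show ?thesis by (simp add: X_def)
qed

lemma Gamma_chains:
  assumes x: "x \<in> chains (Suc n)"
  shows "Gamma A x = tscale (- (of_nat n / 2)) x"
proof -
  define X :: "nat \<Rightarrow> ('a, 'k) chain \<Rightarrow> ('a, 'k) chain" where "X m x =
      tscale (- (of_nat (m - 1) / 2)) x" for m x
  have "Gamma A x = lin_ext (\<lambda>w. X (length w) (tns A w)) x"
    by (simp add: Gamma_def X_def Let_def)
  also have "\<dots> = X (Suc n) x"
  proof (rule lin_ext_chains[OF _ _ x])
    show "lin (X m)" for m unfolding X_def by (intro lin_ops lin_intros)
    show "X m y \<in> TS.span (range (tns A))" if "y \<in> chains m" for y m
      unfolding X_def by (intro TS.span_scale chains_span_range[OF that])
  qed
  finally show ?thesis by (simp add: X_def)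
qed

text \<open>The Lie derivative of E, with the total internal degree as eigenvalue; \<Gamma>' is this
  operator minus n.\<close>

definition Ldeg :: "nat \<Rightarrow> ('a, 'k) chain \<Rightarrow> ('a, 'k) chain" where "Ldeg n x = (\<Sum>i\<le>n. E i x)"

lemma lin_Ldeg: "lin Y \<Longrightarrow> lin (\<lambda>x. Ldeg n (Y x))"
  unfolding Ldeg_def by (intro lin_sum lin_ops)

lemma Ldeg_T: "good lw \<Longrightarrow> length lw = Suc n \<Longrightarrow> Ldeg n (T lw) = tscale (of_int (\<Sum>z\<leftarrow>lw. fst z)) (T lw)"
proof -
  assume lw: "good lw" "length lw = Suc n"
  have "Ldeg n (T lw) = (\<Sum>i\<le>n. tscale (of_int (fst (lw ! i))) (T lw))"
    unfolding Ldeg_def using lw by (simp add: E_T)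
  also have "\<dots> = tscale (\<Sum>i\<le>n. of_int (fst (lw ! i))) (T lw)"
    by (simp only: TS.scale_sum_left)
  also have "(\<Sum>i\<le>n. of_int (fst (lw ! i))) = (of_int (\<Sum>z\<leftarrow>lw. fst z) :: 'k)"
    using lw(2) by (simp add: sum_list_sum_nth atLeast0LessThan lessThan_Suc_atMost)
  finally show ?thesis .
qed

lemma Gamma'_chains: "x \<in> chains (Suc n) \<Longrightarrow> Gamma' A D x = Ldeg n x - tscale (of_nat n) x"
proof (rule chains_eqI[of "Gamma' A D" "\<lambda>x. Ldeg n x - tscale (of_nat n) x"])
  show "lin (Gamma' A D)" unfolding Gamma'_def by (rule lin_hom_ext[OF lin_id])
  show "lin (\<lambda>x. Ldeg n x - tscale (of_nat n) x)" by (intro lin_intros lin_Ldeg)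
  fix lw :: "('a, 'k) lword" assume lw: "good lw" "length lw = Suc n"
  then show "Gamma' A D (T lw) = Ldeg n (T lw) - tscale (of_nat n) (T lw)"
    by (simp add: Gamma'_T Ldeg_def E_T TS.scale_left_diff_distrib TS.scale_sum_left)
qed

lemma Ldeg_mu: "x \<in> chains (Suc (Suc n)) \<Longrightarrow> i \<le> Suc n \<Longrightarrow> Ldeg n (\<mu> i x) = \<mu> i (Ldeg (Suc n) x)"
proof (rule chains_eqI[of "\<lambda>x. Ldeg n (\<mu> i x)" "\<lambda>x. \<mu> i (Ldeg (Suc n) x)"])
  fix lw :: "('a, 'k) lword" assume lw: "good lw" "length lw = Suc (Suc n)" "i \<le> Suc n"
  then obtain c lw' where "\<mu> i (T lw) = tscale c (T lw')" "good lw'" "length lw' = Suc n"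
    "(\<Sum>z\<leftarrow>lw'. fst z) = (\<Sum>z\<leftarrow>lw. fst z)"
    using mu_word[of lw "Suc n" i] by auto
  then show "Ldeg n (\<mu> i (T lw)) = \<mu> i (Ldeg (Suc n) (T lw))"
    using lw by (simp add: Ldeg_T op_simps linD[OF lin_Ldeg[OF lin_id]] mult.commute)
qed (intro lin_ops lin_intros lin_Ldeg)+

lemma Ldeg_bmu: "x \<in> chains (Suc (Suc n)) \<Longrightarrow> Ldeg n (bmu (Suc n) x) = bmu (Suc n) (Ldeg (Suc n) x)"
  unfolding bmu_def lin_simps[OF lin_Ldeg[OF lin_id]] by (intro sum.cong) (auto simp: Ldeg_mu)

lemma Ldeg_bdelta: "x \<in> chains (Suc n) \<Longrightarrow> Ldeg n (bdelta n x) = bdelta n (Ldeg n x) + bdelta n x"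
  unfolding Ldeg_def b_simps by (subst (3) bdelta_def) (simp add: E_bdelta sum.distrib)

lemma Ldeg_tau: "x \<in> chains (Suc n) \<Longrightarrow> Ldeg n (\<tau> x) = \<tau> (Ldeg n x)"
proof (rule chains_eqI[of "\<lambda>x. Ldeg n (\<tau> x)" "\<lambda>x. \<tau> (Ldeg n x)"])
  fix lw :: "('a, 'k) lword" assume lw: "good lw" "length lw = Suc n"
  then have "lw \<noteq> []" by auto
  then obtain c where c: "\<tau> (T lw) = tscale c (T (rotate1 lw))" "good (rotate1 lw)"
    using tau_word[OF lw(1)] by blast
  have "(\<Sum>z\<leftarrow>rotate1 lw. fst z) = (\<Sum>z\<leftarrow>lw. fst z)"
    by (cases lw) (simp_all add: add.commute)
  then show "Ldeg n (\<tau> (T lw)) = \<tau> (Ldeg n (T lw))"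
    using lw c by (simp add: Ldeg_T op_simps linD[OF lin_Ldeg[OF lin_id]] mult.commute)
qed (intro lin_ops lin_intros lin_Ldeg)+

lemma Ldeg_norm: "x \<in> chains (Suc n) \<Longrightarrow> Ldeg n (cnorm n x) = cnorm n (Ldeg n x)"
proof -
  assume x: "x \<in> chains (Suc n)"
  have "Ldeg n ((\<tau> ^^ i) x) = (\<tau> ^^ i) (Ldeg n x)" for i
    using x by (induction i) (simp_all add: Ldeg_tau tau_pow_chains)
  then show ?thesis unfolding cnorm_def lin_simps[OF lin_Ldeg[OF lin_id]] by simp
qed

lemma Ldeg_chains: "x \<in> chains n \<Longrightarrow> Ldeg m x \<in> chains n"
  unfolding Ldeg_def by (intro chains_lin E_chains)

lemma Ldeg_he: "x \<in> chains (Suc n) \<Longrightarrow> Ldeg (Suc n) (he A x) = he A (Ldeg n x)"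
  unfolding Ldeg_def sum.atMost_Suc_shift he_simps by (simp add: E_0_he E_he)

lemma A_chains_lin: "x \<in> A_chains p n \<Longrightarrow> y \<in> A_chains p n \<Longrightarrow>
    x + y \<in> A_chains p n" "x \<in> A_chains p n \<Longrightarrow> tscale c x \<in> A_chains p n"
  "x \<in> A_chains p n \<Longrightarrow> - x \<in> A_chains p n" "x \<in> A_chains p n \<Longrightarrow> y \<in> A_chains p n \<Longrightarrow>
      x - y \<in> A_chains p n" "0 \<in> A_chains p n"
  "(\<And>i. i \<in> I \<Longrightarrow> f i \<in> A_chains p n) \<Longrightarrow> sum f I \<in> A_chains p n"
  unfolding A_chains_def by (rule TS.span_add TS.span_scale TS.span_neg TS.span_diff TS.span_zero
      TS.span_sum; assumption)+

lemma bdelta_A_chains: "x \<in> A_chains p (Suc n) \<Longrightarrow> bdelta n x \<in> A_chains (p + 1) (Suc n)"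
  unfolding bdelta_def by (intro A_chains_lin delta_A_chains) auto

lemma bmu_A_chains: "x \<in> A_chains p (Suc (Suc n)) \<Longrightarrow> bmu (Suc n) x \<in> A_chains (p + 1) (Suc n)"
  unfolding bmu_def by (intro A_chains_lin mu_A_chains) auto

lemma bmu'_A_chains: "x \<in> A_chains p (Suc (Suc n)) \<Longrightarrow> bmu' (Suc n) x \<in> A_chains (p + 1) (Suc n)"
  unfolding bmu'_def by (intro A_chains_lin mu_A_chains) auto

lemma norm_A_chains: "x \<in> A_chains p (Suc n) \<Longrightarrow> cnorm n x \<in> A_chains p (Suc n)"
  unfolding cnorm_def by (intro A_chains_lin tau_pow_A_chains)

lemma sg_E_A_chains: "x \<in> A_chains p (Suc n) \<Longrightarrow> sg E n x \<in> A_chains p (Suc n)"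
  unfolding sg_def by (intro A_chains_lin tau_pow_A_chains E_A_chains)

lemma Ldeg_A_chains: "x \<in> A_chains p n \<Longrightarrow> Ldeg m x \<in> A_chains p n"
  unfolding Ldeg_def by (intro A_chains_lin E_A_chains)

section \<open>Generators and grading of C^e\<close>

text \<open>Here p is the parity in C^e: a_0 is unshifted in C(A), whence p + 1, while in C^+(A) all
  a_i are shifted and stand behind the even letter e.\<close>

definition gens :: "bit \<Rightarrow> ('a, 'k) chain set" where
  "gens p = (\<Union>n. A_chains (p + 1) (Suc n)) \<union> (\<Union>n. he A ` A_chains p (Suc n))"

lemma gens_cases:
  assumes "x \<in> gens p"
  obtains n where "x \<in> A_chains (p + 1) (Suc n)" | n y where "x = he A y" "y \<in> A_chains p (Suc n)"
  using assms unfolding gens_def by blast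

lemma word_par_pars: "length lw = Suc n \<Longrightarrow> word_par (pars lw) = sh lw + 1"
proof -
  assume "length lw = Suc n"
  then obtain z ys where lw: "lw = z # ys" by (cases lw) auto
  show ?thesis
    using sum_pars_Cons[of z ys "[]"] unfolding lw word_par_def
    by (cases "of_int (fst z) :: bit") (simp_all add: add.commute)
qed

lemma A_lword_A_words: "A_lword lw \<Longrightarrow> lw \<noteq> [] \<Longrightarrow> map snd lw \<in> A_words"
proof -
  assume lw: "A_lword lw" "lw \<noteq> []"
  have "map snd lw = map emb (map (\<lambda>z. fst (snd z)) lw)"
    using lw(1) by (auto simp: A_lword_def emb_def prod_eq_iff)
  then show ?thesis using lw(2) unfolding A_words_def by blast
qed

lemma A_lword_e_words: "A_lword lw \<Longrightarrow> lw \<noteq> [] \<Longrightarrow> ee # map snd lw \<in> e_words"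
  using A_lword_A_words[of lw] unfolding A_words_def e_words_def by blast

lemma A_chains_Ce_par: "x \<in> A_chains q (Suc n) \<Longrightarrow> x \<in> Ce_par A (q + 1)"
  unfolding A_chains_def Ce_par_def
proof (erule TS.span_mono[THEN subsetD, rotated], rule subsetI)
  fix y assume "y \<in> {T lw |lw. good lw \<and> length lw = Suc n \<and> A_lword lw \<and> sh lw = q}"
  then obtain lw where lw: "y = T lw" "good lw" "length lw = Suc n" "A_lword lw" "sh lw =
      q" by blast
  have "map snd lw \<in> A_words" using A_lword_A_words[of lw] lw by (cases lw) auto
  then show "y \<in> {tns A w |w ps. w \<in> A_words \<union> e_words \<and> homog A ps w \<and> word_par ps = q + 1}"
    using lw homog[of lw] word_par_pars[of lw n] unfolding T_def by blast
qed

lemma he_A_chains_Ce_par: "x \<in> A_chains p (Suc n) \<Longrightarrow> he A x \<in> Ce_par A p"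
  unfolding A_chains_def Ce_par_def
proof (erule lin_in_span[OF _ lin_he[OF lin_id]])
  fix y assume "y \<in> {T lw |lw. good lw \<and> length lw = Suc n \<and> A_lword lw \<and> sh lw = p}"
  then obtain lw where lw: "y = T lw" "good lw" "length lw = Suc n" "A_lword lw" "sh lw =
      p" by blast
  have e: "map snd ((0, ee) # lw) \<in> e_words" using A_lword_e_words[of lw] lw by (cases lw) auto
  have "word_par (pars ((0, ee) # lw)) = p"
    using word_par_pars[of "(0, ee) # lw" "Suc n"] lw by (cases p) simp_all
  moreover have "homog A (pars ((0, ee) # lw)) (map snd ((0, ee) # lw))"
    using lw by (intro homog) (simp add: ee_gr)
  moreover have "he A y = tns A (map snd ((0, ee) # lw))"
    by (simp add: lw(1) T_def he_tns)
  ultimately show "he A y \<in> TS.span {tns A w |w ps. w \<in> A_words \<union> e_words \<and> homog A ps w \<and>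
      word_par ps = p}"
    using e by (intro TS.span_base) blast
qed

lemma gens_Ce_par: "x \<in> gens p \<Longrightarrow> x \<in> Ce_par A p"
  using A_chains_Ce_par[of x "p + 1"] he_A_chains_Ce_par unfolding bit_add_1_1
  by (elim gens_cases) blast+

lemma A_words_span: "w \<in> A_words \<Longrightarrow> tns A w \<in> TS.span (\<Union>p n. A_chains p (Suc n))"
proof -
  assume "w \<in> A_words"
  then have w: "set w \<subseteq> {x. snd x = 0}" "w \<noteq> []" by (auto simp: A_words_def emb_def)
  let ?L = "{x. snd x = (0 :: 'k)} :: ('a \<times> 'k) set"
  have "tns A (map snd ([] :: ('a, 'k) lword) @ w) \<in>
      TS.span {T lw |lw. good lw \<and> length lw = length ([] :: ('a, 'k) lword) + length w \<and>
          snd ` set lw \<subseteq> ?L}"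
  proof (rule tns_expand)
    fix x assume "x \<in> ?L"
    then show "\<exists>c I. finite I \<and> x = (\<Sum>i\<in>I. c i) \<and> (\<forall>i. c i \<in> ext_gr D i \<inter> ?L)"
      using A_letter_decomp[of x] by auto
  qed (use w in auto)
  moreover have "{T lw |lw. good lw \<and> length lw = length ([] :: ('a, 'k) lword) + length w \<and>
      snd ` set lw \<subseteq> ?L}
      \<subseteq> (\<Union>p n. A_chains p (Suc n))"
  proof
    fix y assume "y \<in> {T lw |lw. good lw \<and> length lw = length ([] :: ('a, 'k) lword) + length w \<and>
        snd ` set lw \<subseteq> ?L}"
    then obtain lw where lw: "y = T lw" "good lw" "length lw = length w" "snd ` set lw \<subseteq> ?L" by auto
    then have "A_lword lw" "length lw = Suc (length w - 1)" using w(2) by (auto simp: A_lword_def)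
    then have "y \<in> A_chains (sh lw) (Suc (length w - 1))"
      unfolding A_chains_def using lw by (intro TS.span_base) blast
    then show "y \<in> (\<Union>p n. A_chains p (Suc n))" by blast
  qed
  ultimately show ?thesis unfolding list.map append_Nil using TS.span_mono by blast
qed

lemma A_chains_gens: "x \<in> A_chains p (Suc n) \<Longrightarrow> x \<in> gens 0 \<union> gens 1"
proof -
  assume "x \<in> A_chains p (Suc n)"
  then have "x \<in> A_chains ((p + 1) + 1) (Suc n)" by (simp only: bit_add_1_1)
  then have "x \<in> gens (p + 1)" unfolding gens_def by blast
  then show ?thesis by (cases "p + 1") auto
qed

lemma he_A_chains_gens: "x \<in> A_chains p (Suc n) \<Longrightarrow> he A x \<in> gens 0 \<union> gens 1"
proof -
  assume "x \<in> A_chains p (Suc n)"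
  then have "he A x \<in> gens p" unfolding gens_def by blast
  then show ?thesis by (cases p) auto
qed

lemma words_span: "w \<in> A_words \<union> e_words \<Longrightarrow> tns A w \<in> TS.span (gens 0 \<union> gens 1)"
proof -
  have 1: "tns A v \<in> TS.span (gens 0 \<union> gens 1)" if "v \<in> A_words" for v
    by (rule TS.span_mono[THEN subsetD, OF _ A_words_span[OF that]]) (use A_chains_gens in blast)
  have 2: "he A (tns A v) \<in> TS.span (gens 0 \<union> gens 1)" if "v \<in> A_words" for v
    by (rule lin_in_span[OF A_words_span[OF that] lin_he[OF lin_id]])
      (use he_A_chains_gens in \<open>blast intro: TS.span_base\<close>)
  assume "w \<in> A_words \<union> e_words"
  then show ?thesis
  proof
    assume "w \<in> e_words"
    then obtain v where "w = ee # v" "v \<in> A_words" unfolding e_words_def A_words_def by blast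
    then show ?thesis using 2[of v] he_tns[of v] by simp
  qed (rule 1)
qed

text \<open>Parity projection. It shows that the sum of the two parity parts is direct, and it sorts
  expansions into Z-homogeneous words by parity.\<close>

definition Pr :: "bit \<Rightarrow> ('a, 'k) chain \<Rightarrow> ('a, 'k) chain" where
  "Pr p = hom_ext (ext_gr (par A)) (\<lambda>ps w. tscale (if word_par ps = p then 1 else 0) (tns A w))"

lemma lin_Pr: "lin Y \<Longrightarrow> lin (\<lambda>x. Pr p (Y x))"
  unfolding Pr_def by (rule lin_hom_ext)

lemma Pr_tns:
  assumes "homog A ps w"
  shows "Pr p (tns A w) = (if word_par ps = p then tns A w else 0)"
proof -
  have "is_grading (ext_smul A) UNIV (ext_gr (par A))"
    by (rule gr_ext[OF A]) (use A in \<open>unfold dg_algebra_def, blast\<close>)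
  then have "Pr p (tns A w) = tscale (if word_par ps = p then 1 else 0) (tns A w)"
    unfolding Pr_def using assms
    by (subst hom_ext_tensor[OF vs_ext[OF A], where ds = ps])
      (auto simp: homog_def tensor_in_span multilin_word simp del: TS.scale_one TS.scale_zero_left)
  then show ?thesis by simp
qed

lemma Pr_Ce_par: "x \<in> Ce_par A q \<Longrightarrow> Pr p x = (if q = p then x else 0)"
proof -
  assume x: "x \<in> Ce_par A q"
  have "lin (\<lambda>x :: ('a, 'k) chain. if q = p then x else 0)"
      by (cases "q = p") (simp_all add: lin_id lin_zero)
  then show ?thesis
  proof (rule lin_eq_on_span[OF x[unfolded Ce_par_def] lin_Pr[OF lin_id]])
    fix y assume "y \<in> {tns A w |w ps. w \<in> A_words \<union> e_words \<and> homog A ps w \<and> word_par ps = q}"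
    then obtain w ps where "y = tns A w" "homog A ps w" "word_par ps = q" by blast
    then show "Pr p y = (if q = p then y else 0)" using Pr_tns by simp
  qed
qed

text \<open>\<open>Ce_par\<close> is spanned by words homogeneous for the parity only. Expanding
  them into Z-homogeneous words is known at first to give generators of either parity;
  \<open>Pr p\<close> fixes the word and discards the wrong ones.\<close>

lemma Ce_par_gens: "Ce_par A p = TS.span (gens p)"
proof
  show "TS.span (gens p) \<subseteq> Ce_par A p"
    unfolding Ce_par_def by (rule TS.span_minimal) (use gens_Ce_par in \<open>auto simp: Ce_par_def\<close>)
  have Pr: "Pr p x \<in> TS.span (gens p)" if x: "x \<in> TS.span (gens 0 \<union> gens 1)" for x
  proof (rule lin_in_span[OF x lin_Pr[OF lin_id]])
    fix y assume "y \<in> gens 0 \<union> gens 1"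
    then obtain q where q: "y \<in> gens q" by blast
    then show "Pr p y \<in> TS.span (gens p)"
      using Pr_Ce_par[OF gens_Ce_par[OF q], of p]
          by (cases "q = p") (auto intro: TS.span_base TS.span_zero)
  qed
  show "Ce_par A p \<subseteq> TS.span (gens p)"
    unfolding Ce_par_def
  proof (rule TS.span_minimal)
    show "{tns A w |w ps. w \<in> A_words \<union> e_words \<and> homog A ps w \<and> word_par ps = p} \<subseteq>
        TS.span (gens p)"
    proof
      fix y assume "y \<in> {tns A w |w ps. w \<in> A_words \<union> e_words \<and> homog A ps w \<and> word_par ps = p}"
      then obtain w ps where w: "y = tns A w" "w \<in>
          A_words \<union> e_words" "homog A ps w" "word_par ps = p" by blast
      then have "Pr p y = y" using Pr_tns[OF w(3), of p] by simp
      then show "y \<in> TS.span (gens p)" using Pr[OF words_span[OF w(2)]] w(1) by simp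
    qed
  qed simp
qed

lemma Ce_gens: "Ce A = TS.span (gens 0 \<union> gens 1)"
proof
  have "CA A \<subseteq> TS.span (gens 0 \<union> gens 1)" "Cplus A \<subseteq> TS.span (gens 0 \<union> gens 1)"
    unfolding CA_def Cplus_def by (rule TS.span_minimal; use words_span in auto)+
  then show "Ce A \<subseteq> TS.span (gens 0 \<union> gens 1)"
    unfolding Ce_def using TS.span_add by blast
  have sub: "TS.subspace (Ce A)" unfolding Ce_def CA_def Cplus_def
      by (intro TS.subspace_sums TS.subspace_span)
  have words: "tns A w \<in> Ce A" if "w \<in> A_words \<union> e_words" for w
  proof -
    have "tns A w \<in> CA A \<or> tns A w \<in> Cplus A"
      using that unfolding CA_def Cplus_def by (blast intro: TS.span_base)
    moreover have "0 \<in> CA A" "0 \<in> Cplus A" unfolding CA_def Cplus_def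
        by (simp_all add: TS.span_zero)
    ultimately show ?thesis unfolding Ce_def mem_Collect_eq
      by (metis add_0_left add_0_right)
  qed
  have "Ce_par A p \<subseteq> Ce A" for p
    unfolding Ce_par_def by (rule TS.span_minimal[OF _ sub]) (use words in blast)
  then show "TS.span (gens 0 \<union> gens 1) \<subseteq> Ce A"
    by (intro TS.span_minimal[OF _ sub]) (use gens_Ce_par in blast)
qed

lemma bit_decomp_sum: "(\<Sum>i | c i \<noteq> 0. c i) = c 0 + c (1 :: bit)" for c :: "bit \<Rightarrow> ('a, 'k) chain"
proof -
  have "(\<Sum>i | c i \<noteq> 0. c i) = (\<Sum>i\<in>{0, 1}. c i)"
  proof (rule sum.mono_neutral_left)
    show "{i. c i \<noteq> 0} \<subseteq> {0, 1}" using bit_not_zero_iff by blast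
  qed auto
  then show ?thesis by simp
qed

lemma Ce_grading: "is_grading tscale (Ce A) (Ce_par A)"
  unfolding is_grading_def
proof (intro conjI allI ballI)
  show "TS.subspace (Ce A)" unfolding Ce_gens by (rule TS.subspace_span)
  show "TS.subspace (Ce_par A p)" for p unfolding Ce_par_gens by (rule TS.subspace_span)
  show "Ce_par A p \<subseteq> Ce A" for p
    unfolding Ce_par_gens Ce_gens by (rule TS.span_mono) (cases p; auto)
  fix x assume "x \<in> Ce A"
  then obtain a b where ab: "x = a + b" "a \<in> Ce_par A 0" "b \<in> Ce_par A 1"
    unfolding Ce_gens TS.span_Un Ce_par_gens by blast
  have fin: "finite {i. c i \<noteq> 0}" for c :: "bit \<Rightarrow> ('a, 'k) chain"
    by (rule finite_subset[of _ "{0, 1}"]) (use bit_not_zero_iff in blast)+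
  show "\<exists>!c. is_decomp (Ce_par A) x c"
  proof (rule ex1I)
    show "is_decomp (Ce_par A) x (\<lambda>p. if p = 0 then a else b)"
      unfolding is_decomp_def bit_decomp_sum
    proof (intro conjI allI fin)
      show "(if p = 0 then a else b) \<in> Ce_par A p" for p using ab by (cases p) simp_all
    qed (simp add: ab(1))
    fix c assume c: "is_decomp (Ce_par A) x c"
    then have x: "x = c 0 + c 1" and cp: "\<And>p. c p \<in> Ce_par A p"
      unfolding is_decomp_def bit_decomp_sum by blast+
    \<comment> \<open>Projecting the sum recovers each component, which gives uniqueness.\<close>
    have "Pr p x = c p" for p
      unfolding x linD[OF lin_Pr[OF lin_id]] Pr_Ce_par[OF cp] by (cases p) simp_all
    moreover have "Pr p x = (if p = 0 then a else b)" for p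
      unfolding ab(1) linD[OF lin_Pr[OF lin_id]] Pr_Ce_par[OF ab(2)] Pr_Ce_par[OF ab(3)]
          by (cases p) simp_all
    ultimately show "c = (\<lambda>p. if p = 0 then a else b)" by (metis ext)
  qed
qed

text \<open>It suffices to treat the two families of generators. Their index p is the shifted
  parity, so the parity in C^e is p + 1 for words in A and p after putting e in front.\<close>

lemma parity_on_Ce:
  assumes X: "lin X" and A_part: "\<And>p n x. x \<in> A_chains p (Suc n) \<Longrightarrow> X x \<in> Ce_par A (p + 1 + q)"
    and e_part: "\<And>p n x. x \<in> A_chains p (Suc n) \<Longrightarrow> X (he A x) \<in> Ce_par A (p + q)"
  shows "linear_on tscale (Ce A) X" "has_parity (Ce_par A) q X"
proof -
  have gens: "X x \<in> Ce_par A (p + q)" if "x \<in> gens p" for x p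
    using that
  proof (cases rule: gens_cases)
    case (1 n)
    then show ?thesis using A_part[of x "p + 1" n] by (simp only: bit_add_1_1)
  next
    case (2 n y)
    then show ?thesis using e_part by simp
  qed
  have par: "X x \<in> Ce_par A (p + q)" if x: "x \<in> Ce_par A p" for x p
    using gens unfolding Ce_par_gens by (rule lin_in_span[OF x[unfolded Ce_par_gens] X])
  then show "has_parity (Ce_par A) q X" unfolding has_parity_def by blast
  have "Ce_par A p \<subseteq> Ce A" for p using Ce_grading unfolding is_grading_def by blast
  then have "X y \<in> Ce A" if "y \<in> gens 0 \<union> gens 1" for y using that gens by blast
  then have "X x \<in> Ce A" if x: "x \<in> Ce A" for x
    unfolding Ce_gens by (rule lin_in_span[OF x[unfolded Ce_gens] X])
  then show "linear_on tscale (Ce A) X"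
    unfolding linear_on_def using linD[OF X] by blast
qed

lemma eq_on_Ce:
  assumes X: "lin X" and Y: "lin Y"
    and A_part: "\<And>p n x. x \<in> A_chains p (Suc n) \<Longrightarrow> X x = Y x"
    and e_part: "\<And>p n x. x \<in> A_chains p (Suc n) \<Longrightarrow> X (he A x) = Y (he A x)"
    and x: "x \<in> Ce A"
  shows "X x = Y x"
  using x unfolding Ce_gens
proof (rule lin_eq_on_span[OF _ X Y])
  fix y assume "y \<in> gens 0 \<union> gens 1"
  then obtain p where "y \<in> gens p" by blast
  then show "X y = Y y" by (rule gens_cases) (use A_part e_part in blast)+
qed

text \<open>The projections onto C(A) and C^+(A) act linearly on the first letter alone;
  multilinearity is checked at the head and behind it.\<close>

lemma lin_ext_head:
  assumes L: "Vector_Spaces.linear (ext_smul A) (ext_smul A) L" and w: "w \<noteq> []"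
  shows "lin_ext (\<lambda>w. if w = [] then 0 else tns A (L (hd w) # tl w)) (tns A w) =
      tns A (L (hd w) # tl w)"
proof -
  have lin: "Vector_Spaces.linear (ext_smul A) tscale (\<lambda>x. tns A (xs @ x # ys))" for xs ys
    using multilin_tensor[OF vs_ext[OF A]] unfolding multilin_def by blast
  have "multilin (ext_smul A) tscale (\<lambda>w. if w = [] then 0 else tns A (L (hd w) # tl w))"
    unfolding multilin_def
  proof (intro allI)
    fix xs ys :: "('a \<times> 'k) list"
    show "Vector_Spaces.linear (ext_smul A) tscale
      (\<lambda>x. if xs @ x # ys = [] then 0 else tns A (L (hd (xs @ x # ys)) # tl (xs @ x # ys)))"
    proof (cases xs)
      case Nil
      then show ?thesis using lin[of "[]" ys] L unfolding linear_iff'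
          by (simp del: split_paired_All)
    next
      case (Cons z zs)
      then show ?thesis using lin[of "L z # zs" ys] by simp
    qed
  qed
  then have "lin_ext (\<lambda>w. if w = [] then 0 else tns A (L (hd w) # tl w)) (tns A w) =
      (if w = [] then 0 else tns A (L (hd w) # tl w))"
    by (rule lin_ext_tensor) (auto intro: TS.span_base TS.span_zero)
  then show ?thesis using w by simp
qed

lemma prC_tns: "w \<noteq> [] \<Longrightarrow> prC A (tns A w) = tns A (emb (fst (hd w)) # tl w)"
  and prplus_tns: "w \<noteq> [] \<Longrightarrow> prplus A (tns A w) = tns A ((0, snd (hd w)) # tl w)"
  unfolding prC_def prplus_def
  using lin_ext_head[OF vector_space_ext_props(5)[OF A]] lin_ext_head[OF
      vector_space_ext_props(6)[OF A]]
  by blast+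

lemma lin_prC: "lin Y \<Longrightarrow> lin (\<lambda>x. prC A (Y x))" and lin_prplus: "lin Y \<Longrightarrow> lin (\<lambda>x. prplus A (Y x))"
  unfolding prC_def prplus_def by (rule lin_lin_ext, assumption)+

lemma tns_zero_head: "tns A ((0, 0) # w) = 0"
proof -
  have "Vector_Spaces.linear (ext_smul A) tscale (\<lambda>x. tns A ([] @ x # w))"
    using multilin_tensor[OF vs_ext[OF A]] unfolding multilin_def by blast
  then have "tns A ([] @ ((0, 0) + (0, 0)) # w) = tns A ([] @ (0, 0) # w) + tns A ([] @ (0, 0) # w)"
    unfolding linear_iff' by blast
  then show ?thesis by simp
qed

lemma A_chains_eqI:
  assumes "lin X" "lin Y" "\<And>z lw. A_lword (z # lw) \<Longrightarrow> X (T (z # lw)) = Y (T (z # lw))"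
    and x: "x \<in> A_chains p (Suc n)"
  shows "X x = Y x"
  using x unfolding A_chains_def
proof (rule lin_eq_on_span[OF _ assms(1,2)])
  fix y assume "y \<in> {T lw |lw. good lw \<and> length lw = Suc n \<and> A_lword lw \<and> sh lw = p}"
  then obtain lw where "y = T lw" "A_lword lw" "length lw = Suc n" by blast
  then show "X y = Y y" using assms(3) by (cases lw) auto
qed

lemma prC_A: "x \<in> A_chains p (Suc n) \<Longrightarrow> prC A x = x"
  by (rule A_chains_eqI[OF lin_prC[OF lin_id] lin_id]) (auto simp: T_def prC_tns emb_def)

lemma prplus_A: "x \<in> A_chains p (Suc n) \<Longrightarrow> prplus A x = 0"
  by (rule A_chains_eqI[OF lin_prplus[OF lin_id] lin_zero]) (auto simp: T_def prplus_tns
      tns_zero_head)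

lemma prC_he: "x \<in> A_chains p (Suc n) \<Longrightarrow> prC A (he A x) = 0"
  by (rule A_chains_eqI[OF lin_prC[OF lin_he[OF lin_id]] lin_zero])
    (auto simp: T_def he_tns prC_tns emb_def ee_def tns_zero_head)

lemma prplus_he: "x \<in> A_chains p (Suc n) \<Longrightarrow> prplus A (he A x) = he A x"
  by (rule A_chains_eqI[OF lin_prplus[OF lin_he[OF lin_id]] lin_he[OF lin_id]])
    (auto simp: T_def he_tns prplus_tns ee_def)

section \<open>The mixed complex\<close>

lemma lin_be: "lin Y \<Longrightarrow> lin (\<lambda>x. be A (Y x))" and lin_NN: "lin Y \<Longrightarrow> lin (\<lambda>x. NN A (Y x))"
  and lin_SG: "lin Y \<Longrightarrow> lin (\<lambda>x. SG \<Phi> (Y x))"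
  unfolding be_def NN_def SG_def by (rule lin_lin_ext, assumption)+

lemma lin_Be: "lin Y \<Longrightarrow> lin (\<lambda>x. Be A (Y x))"
  unfolding Be_def mat2_def by (intro lin_intros lin_he lin_NN lin_prC)

lemmas be_simps = lin_simps[OF lin_be[OF lin_id]] lin_simps[OF lin_Be[OF lin_id]]
  lin_simps[OF lin_SG[OF lin_id]] he_simps

lemma be_he: "x \<in> chains (Suc n) \<Longrightarrow> be A (he A x) = x - (\<tau> ^^ n) x - he A (bdelta n x + bmu' n x)"
  unfolding be_chains[OF he_chains] bdelta_he bmu_he he_simps by (simp add: algebra_simps)

lemma Be_A: "x \<in> A_chains p (Suc n) \<Longrightarrow> Be A x = he A (cnorm n x)"
  unfolding Be_def mat2_def by (simp add: prC_A NN_chains[OF A_chains_chains])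

lemma Be_he: "x \<in> A_chains p (Suc n) \<Longrightarrow> Be A (he A x) = 0"
  unfolding Be_def mat2_def by (simp add: prC_he lin_0[OF lin_NN[OF lin_id]] he_simps)

lemma bmu_0: "x \<in> chains (Suc 0) \<Longrightarrow> bmu 0 x = 0"
  by (simp add: bmu_def mu_chains_1)

lemma be_be: "x \<in> chains (Suc n) \<Longrightarrow> be A (be A x) = 0"
proof -
  assume x: "x \<in> chains (Suc n)"
  note bx = bdelta_chains[OF x]
  have 1: "be A (bdelta n x) = bmu n (bdelta n x)"
    unfolding be_chains[OF bx] bdelta_bdelta[OF x] by simp
  have 2: "be A (bmu n x) = - bmu n (bdelta n x)"
  proof (cases n)
    case 0
    then show ?thesis using x bx by (simp add: bmu_0 be_simps)
  next
    case (Suc m)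
    have "bmu n x \<in> chains (Suc m)" using x bmu_chains Suc by simp
    from be_chains[OF this] show ?thesis using x Suc bdelta_bmu[of x m] bmu_bmu[of x m] by simp
  qed
  show ?thesis unfolding be_chains[OF x] be_simps 1 2 by simp
qed

lemma Be_bmu: "x \<in> A_chains p (Suc n) \<Longrightarrow> Be A (bmu n x) = he A (bmu' n (cnorm n x))"
proof (cases n)
  case 0
  assume "x \<in> A_chains p (Suc n)"
  then show ?thesis using 0 A_chains_chains[of x p 1] by (simp add: bmu_0 bmu'_def be_simps)
next
  case (Suc m)
  assume x: "x \<in> A_chains p (Suc n)"
  then have "bmu n x \<in> A_chains (p + 1) (Suc m)" using bmu_A_chains Suc by simp
  then show ?thesis unfolding Be_A[OF \<open>bmu n x \<in> _\<close>]
      using bmu'_norm[of x m] A_chains_chains[OF x] Suc by simp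
qed

text \<open>\<tau>^{-1}N = N removes the component in C(A). The component in C^+(A) cancels because
  N commutes with the internal differential and b'N = Nb.\<close>

lemma bB_A:
  assumes x: "x \<in> A_chains p (Suc n)"
  shows "be A (Be A x) + Be A (be A x) = 0"
proof -
  note cx = A_chains_chains[OF x]
  have 1: "be A (Be A x) = - he A (cnorm n (bdelta n x)) - he A (bmu' n (cnorm n x))"
    unfolding Be_A[OF x] be_he[OF norm_chains[OF cx]] tau_pow_norm[OF cx] bdelta_norm[OF cx]
        he_simps by simp
  have 2: "Be A (be A x) = he A (cnorm n (bdelta n x)) + he A (bmu' n (cnorm n x))"
    unfolding be_chains[OF cx] be_simps Be_A[OF bdelta_A_chains[OF x]] Be_bmu[OF x] ..
  show ?thesis unfolding 1 2 by simp
qed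

text \<open>B vanishes on C^+(A), and on the component x - \<tau>^{-1}x in C(A) it vanishes because
  N\<tau>^{-1} = N.\<close>

lemma Be_be_he:
  assumes x: "x \<in> A_chains p (Suc n)"
  shows "Be A (be A (he A x)) = 0"
proof -
  note cx = A_chains_chains[OF x]
  have 1: "Be A (he A (bdelta n x)) = 0" by (rule Be_he[OF bdelta_A_chains[OF x]])
  have 2: "Be A (he A (bmu' n x)) = 0"
  proof (cases n)
    case 0
    then show ?thesis by (simp add: bmu'_def be_simps)
  next
    case (Suc m)
    then show ?thesis using Be_he[OF bmu'_A_chains] x by simp
  qed
  show ?thesis unfolding be_he[OF cx] be_simps 1 2 Be_A[OF x] Be_A[OF tau_pow_A_chains[OF x]]
      norm_tau_pow[OF cx] by simp
qed

lemma mixed_complex_Ce: "mixed_complex tscale (Ce A) (Ce_par A) (be A) (Be A)"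
proof -
  have be_par: "be A x \<in> Ce_par A (p + 1 + 1)" if x: "x \<in> A_chains p (Suc n)" for x p n
  proof -
    have "bmu n x \<in> Ce_par A (p + 1 + 1)"
    proof (cases n)
      case 0
      then show ?thesis using x A_chains_chains[of x p 1]
          by (simp add: bmu_0 Ce_par_gens TS.span_zero)
    next
      case (Suc m)
      then show ?thesis using A_chains_Ce_par[OF bmu_A_chains] x by simp
    qed
    moreover have "bdelta n x \<in> Ce_par A (p + 1 + 1)"
        by (rule A_chains_Ce_par[OF bdelta_A_chains[OF x]])
    ultimately show ?thesis unfolding be_chains[OF A_chains_chains[OF x]] Ce_par_gens
        by (rule TS.span_add[rotated])
  qed
  have be_he_par: "be A (he A x) \<in> Ce_par A (p + 1)" if x: "x \<in> A_chains p (Suc n)" for x p n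
  proof -
    have "he A (bmu' n x) \<in> Ce_par A (p + 1)"
    proof (cases n)
      case 0
      then show ?thesis by (simp add: bmu'_def he_simps Ce_par_gens TS.span_zero)
    next
      case (Suc m)
      then show ?thesis using he_A_chains_Ce_par[OF bmu'_A_chains] x by simp
    qed
    then show ?thesis
      using A_chains_Ce_par[OF x] A_chains_Ce_par[OF tau_pow_A_chains[OF x]] he_A_chains_Ce_par[OF
          bdelta_A_chains[OF x]]
      unfolding be_he[OF A_chains_chains[OF x]] he_simps Ce_par_gens
          by (intro TS.span_diff TS.span_add)
  qed
  have Be_par: "Be A x \<in> Ce_par A (p + 1 + 1)" if "x \<in> A_chains p (Suc n)" for x p n
    unfolding Be_A[OF that] bit_add_1_1 by (rule he_A_chains_Ce_par[OF norm_A_chains[OF that]])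
  have Be_he_par: "Be A (he A x) \<in> Ce_par A (p + 1)" if "x \<in> A_chains p (Suc n)" for x p n
    unfolding Be_he[OF that] Ce_par_gens by (rule TS.span_zero)
  have b: "linear_on tscale (Ce A) (be A)" "has_parity (Ce_par A) 1 (be A)"
    by (rule parity_on_Ce[where q = 1 and X = "be A"];
        (rule lin_be[OF lin_id] | erule be_par | erule be_he_par))+
  have B: "linear_on tscale (Ce A) (Be A)" "has_parity (Ce_par A) 1 (Be A)"
    by (rule parity_on_Ce[where q = 1 and X = "Be A"];
        (rule lin_Be[OF lin_id] | erule Be_par | erule Be_he_par))+
  have "be A (be A x) = 0" if "x \<in> Ce A" for x
    by (rule eq_on_Ce[OF lin_be[OF lin_be[OF lin_id]] lin_zero _ _ that])
      (rule be_be[OF A_chains_chains] be_be[OF he_chains[OF A_chains_chains]], assumption)+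
  moreover have "Be A (Be A x) = 0" if "x \<in> Ce A" for x
  proof (rule eq_on_Ce[OF lin_Be[OF lin_Be[OF lin_id]] lin_zero _ _ that])
    show "Be A (Be A x) = 0" if "x \<in> A_chains p (Suc n)" for x p n
      unfolding Be_A[OF that] by (rule Be_he[OF norm_A_chains[OF that]])
    show "Be A (Be A (he A x)) = 0" if "x \<in> A_chains p (Suc n)" for x p n
      unfolding Be_he[OF that] be_simps ..
  qed
  moreover have "be A (Be A x) + Be A (be A x) = 0" if "x \<in> Ce A" for x
  proof (rule eq_on_Ce[OF lin_add[OF lin_be[OF lin_Be[OF lin_id]] lin_Be[OF lin_be[OF lin_id]]]
      lin_zero bB_A _ that])
    show "be A (Be A (he A x)) + Be A (be A (he A x)) = 0" if "x \<in> A_chains p (Suc n)" for x p n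
      unfolding Be_he[OF that] Be_be_he[OF that] be_simps by simp
  qed
  ultimately show ?thesis
    unfolding mixed_complex_def using vector_space_tscale Ce_grading b B by blast
qed

section \<open>The homotopy\<close>

text \<open>The factor -1/2 is that of U(\<delta>) and V(\<delta>). Since the first row of U has the
  same entry twice, H0 carries no projection; on C^+(A) it sends \<open>he A x\<close> to -E^(0)x/2.
  H1, like V, is zero on C^+(A).\<close>

definition H0 :: "('a, 'k) chain \<Rightarrow> ('a, 'k) chain" where
  "H0 x = tscale (- (1 / 2)) (\<mu> 0 (E 1 x))"

definition H1 :: "('a, 'k) chain \<Rightarrow> ('a, 'k) chain" where
  "H1 x = tscale (- (1 / 2)) (he A (SG E (prC A x)))"

lemma lin_H0: "lin Y \<Longrightarrow> lin (\<lambda>x. H0 (Y x))" and lin_H1: "lin Y \<Longrightarrow> lin (\<lambda>x. H1 (Y x))"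
  unfolding H0_def H1_def by (intro lin_intros lin_ops lin_he lin_SG lin_prC, assumption)+

lemma lin_UU: "lin Y \<Longrightarrow> lin (\<lambda>x. UU A (Y x))"
  unfolding UU_def mat2_def by (intro lin_intros lin_ops lin_prC lin_prplus)

lemma lin_VV: "lin Y \<Longrightarrow> lin (\<lambda>x. VV A (Y x))"
  unfolding VV_def mat2_def by (intro lin_intros lin_he lin_prC)

lemma lin_Gamma: "lin Y \<Longrightarrow> lin (\<lambda>x. Gamma A (Y x))" and lin_Gamma': "lin Y \<Longrightarrow>
    lin (\<lambda>x. Gamma' A D (Y x))"
  unfolding Gamma_def Gamma'_def by (intro lin_intros, assumption)+

lemma SG_E: "x \<in> chains (Suc n) \<Longrightarrow> SG E x = sg E n x" and SG_delta: "x \<in> chains (Suc n) \<Longrightarrow>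
    SG \<delta> x = sg \<delta> n x"
  by (rule SG_chains; simp add: lin_E[OF lin_id] lin_delta[OF lin_id] E_chains delta_chains)+

lemma mu_0_E_he: "x \<in> chains (Suc n) \<Longrightarrow> \<mu> 0 (E 1 (he A x)) = E 0 x"
  using E_he[of x n 0] mu_0_he[OF E_chains] by simp

lemma be_mu_0_E:
  assumes x: "x \<in> chains (Suc n)"
  shows "be A (\<mu> 0 (E 1 x)) + \<mu> 0 (E 1 (be A x)) = \<mu> 0 (\<delta> 1 x)"
proof (cases n)
  case 0
  have zero: "\<mu> 0 y = 0" if "y \<in> chains (Suc 0)" for y using that by (simp add: mu_chains_1)
  have bx: "be A x \<in> chains (Suc 0)"
    using x 0 bdelta_chains[of x 0] by (simp add: be_chains[of x 0] bmu_0)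
  show ?thesis
    using zero[OF E_chains] zero[OF delta_chains] zero[OF E_chains[OF bx]] x 0
        by (simp add: be_simps)
next
  case (Suc m)
  then have x: "x \<in> chains (Suc (Suc m))" using x by simp
  have "\<mu> 0 (E 1 x) \<in> chains (Suc m)" using mu_chains[OF E_chains[OF x], of 0] by simp
  then have "be A (\<mu> 0 (E 1 x)) + \<mu> 0 (E 1 (be A x)) =
      (bdelta m (\<mu> 0 (E 1 x)) + bmu m (\<mu> 0 (E 1 x))) + (\<mu> 0 (E 1 (bdelta (Suc m) x)) +
          \<mu> 0 (E 1 (bmu (Suc m) x)))"
    by (simp only: be_chains[OF x] be_chains op_simps)
  also have "\<dots> = (bdelta m (\<mu> 0 (E 1 x)) + \<mu> 0 (E 1 (bdelta (Suc m) x))) + (bmu m (\<mu> 0 (E 1 x)) +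
      \<mu> 0 (E 1 (bmu (Suc m) x)))"
    by (simp only: add_ac)
  finally show ?thesis unfolding bdelta_mu_0_E[OF x] bmu_mu_0_E[OF x] add_0_right .
qed

text \<open>The two columns carry the same operator, so the projections add up to the
  identity.\<close>

lemma UU_eq: "prC A x + prplus A x = x \<Longrightarrow> UU A x = tscale (- (1 / 2)) (\<mu> 0 (\<delta> 1 x))"
proof -
  assume x: "prC A x + prplus A x = x"
  have "UU A x = tscale (- (1 / 2)) (\<mu> 0 (\<delta> 1 (prC A x + prplus A x)))"
    unfolding UU_def mat2_def by (simp add: op_simps algebra_simps)
  then show ?thesis unfolding x .
qed

lemma homotopy_U:
  assumes "x \<in> chains (Suc n)" "prC A x + prplus A x = x"
  shows "UU A x = be A (H0 x) + H0 (be A x)"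
  unfolding UU_eq[OF assms(2)] H0_def be_simps be_mu_0_E[OF assms(1), symmetric]
      TS.scale_right_distrib ..

text \<open>The terms of [b, H1] + [B, H0] in C^+(A) that involve a product; they match by b'S = Sb
  + N\<mu>^(0)E^(1).\<close>

lemma homotopy_shorter_words:
  assumes x: "x \<in> A_chains p (Suc n)"
  shows "he A (SG E (bmu n x)) + Be A (\<mu> 0 (E 1 x)) = he A (bmu' n (sg E n x))"
proof (cases n)
  case 0
  have "\<mu> 0 (E 1 x) = 0" "bmu 0 x = 0"
    using A_chains_chains[OF x] 0 E_chains[of x 1 1] by (simp_all add: bmu_0 mu_chains_1)
  then show ?thesis using 0 by (simp add: be_simps bmu'_def)
next
  case (Suc m)
  note x' = x[unfolded Suc] and cx = A_chains_chains[OF x[unfolded Suc]]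
  have 1: "SG E (bmu n x) = sg E m (bmu n x)"
    using SG_E[OF bmu_chains[OF cx]] Suc by simp
  have 2: "Be A (\<mu> 0 (E 1 x)) = he A (cnorm m (\<mu> 0 (E 1 x)))"
    by (rule Be_A[OF mu_A_chains[OF E_A_chains[OF x']]]) simp
  show ?thesis unfolding 1[unfolded Suc] 2 Suc bmu'_sg[OF cx] he_simps ..
qed

lemma prC_be:
  assumes x: "x \<in> A_chains p (Suc n)"
  shows "prC A (be A x) = bdelta n x + bmu n x"
proof -
  have 1: "prC A (bmu n x) = bmu n x"
  proof (cases n)
    case 0
    then show ?thesis using A_chains_chains[OF x] by (simp add: bmu_0 lin_0[OF lin_prC[OF lin_id]])
  next
    case (Suc m)
    then show ?thesis using prC_A[OF bmu_A_chains] x by simp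
  qed
  show ?thesis unfolding be_chains[OF A_chains_chains[OF x]] linD[OF lin_prC[OF lin_id]] 1
      prC_A[OF bdelta_A_chains[OF x]] ..
qed

text \<open>Here the word length drops out: -n/2 from \<Gamma> cancels against the n/2 contributed
  by -\<Gamma>'/2.\<close>

lemma tscale_halves:
  fixes y z :: "('a, 'k) chain"
  shows "tscale (1 / 2) (- y) + tscale (- (c / 2)) x - tscale (1 / 2) (z - tscale c x) =
      tscale (- (1 / 2)) (z + y)"
  by (simp add: TS.scale_right_distrib TS.scale_right_diff_distrib)

text \<open>Sorted by target, the component in C(A) is the Lie derivative by \<open>sg_left\<close>.
  In C^+(A) the internal differential leaves the sum with \<delta>, that is V, and the terms with
  products cancel.\<close>

lemma homotopy_V_A:
  assumes x: "x \<in> A_chains p (Suc n)"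
  shows "(VV A x + Gamma A x) - tscale (1 / 2) (Gamma' A D x) =
    be A (H1 x) + H1 (be A x) + (Be A (H0 x) + H0 (Be A x))"
proof -
  note cx = A_chains_chains[OF x]
  let ?h = "- (1 / 2) :: 'k"
  let ?y = "sg E n x"
  note cy = sg_E_chains[OF cx]
  have VV: "VV A x = tscale (1 / 2) (- he A (sg \<delta> n x))"
    unfolding VV_def mat2_def SG_def[symmetric] prC_A[OF x] SG_delta[OF cx] by simp
  have left: "(VV A x + Gamma A x) - tscale (1 / 2) (Gamma' A D x) =
      tscale ?h (Ldeg n x + he A (sg \<delta> n x))"
    unfolding VV Gamma_chains[OF cx] Gamma'_chains[OF cx] by (rule tscale_halves)
  have 1: "be A (H1 x) = tscale ?h (?y - (\<tau> ^^ n) ?y - he A (bdelta n ?y + bmu' n ?y))"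
    unfolding H1_def be_simps prC_A[OF x] SG_E[OF cx] be_he[OF cy] ..
  have 2: "H1 (be A x) = tscale ?h (he A (bdelta n ?y + sg \<delta> n x) + he A (SG E (bmu n x)))"
    unfolding H1_def prC_be[OF x] be_simps SG_E[OF bdelta_chains[OF cx]] sg_bdelta[OF cx] ..
  have 3: "Be A (H0 x) = tscale ?h (Be A (\<mu> 0 (E 1 x)))"
    unfolding H0_def be_simps ..
  have 4: "H0 (Be A x) = tscale ?h (E 0 (cnorm n x))"
    unfolding H0_def Be_A[OF x] mu_0_E_he[OF norm_chains[OF cx]] ..
  have "(?y - (\<tau> ^^ n) ?y - he A (bdelta n ?y + bmu' n ?y)) + (he A (bdelta n ?y + sg \<delta> n x) +
      he A (SG E (bmu n x)))
      + (Be A (\<mu> 0 (E 1 x)) + E 0 (cnorm n x)) =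
     (?y - (\<tau> ^^ n) ?y + E 0 (cnorm n x)) + he A (sg \<delta> n x)
      + ((he A (SG E (bmu n x)) + Be A (\<mu> 0 (E 1 x))) - he A (bmu' n ?y))"
    unfolding he_simps by (simp add: algebra_simps)
  also have "\<dots> = Ldeg n x + he A (sg \<delta> n x)"
    unfolding homotopy_shorter_words[OF x] sg_left[OF cx] Ldeg_def by simp
  finally show ?thesis
    unfolding left 1 2 3 4 TS.scale_right_distrib[symmetric] by (rule arg_cong[OF sym])
qed

text \<open>V and H1 vanish on C^+(A), so H1 only meets the component x - \<tau>^{-1}x of the
  boundary. Together with BH0 this is the Lie derivative in the form of
  \<open>sg_right\<close>.\<close>

lemma homotopy_V_e:
  assumes x: "x \<in> A_chains p (Suc n)"
  shows "(VV A (he A x) + Gamma A (he A x)) - tscale (1 / 2) (Gamma' A D (he A x)) =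
    be A (H1 (he A x)) + H1 (be A (he A x)) + (Be A (H0 (he A x)) + H0 (Be A (he A x)))"
proof -
  note cx = A_chains_chains[OF x]
  let ?h = "- (1 / 2) :: 'k"
  \<comment> \<open>The zero is kept as - 0 so that \<open>tscale_halves\<close> applies with y =
    0.\<close>
  have VV: "VV A (he A x) = tscale (1 / 2) (- 0)"
    unfolding VV_def mat2_def SG_def[symmetric] prC_he[OF x] by (simp add: be_simps)
  have left: "(VV A (he A x) + Gamma A (he A x)) - tscale (1 / 2) (Gamma' A D (he A x)) =
      tscale ?h (he A (Ldeg n x) + 0)"
    unfolding VV Gamma_chains[OF he_chains[OF cx]] Gamma'_chains[OF he_chains[OF cx]] Ldeg_he[OF cx]
    by (rule tscale_halves)
  have 1: "H1 (he A x) = 0" unfolding H1_def prC_he[OF x] be_simps by simp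
  have 2: "H1 (he A (bdelta n x)) = 0" unfolding H1_def prC_he[OF bdelta_A_chains[OF x]] be_simps
      by simp
  have 3: "H1 (he A (bmu' n x)) = 0"
  proof (cases n)
    case 0
    then show ?thesis by (simp add: bmu'_def be_simps lin_0[OF lin_H1[OF lin_id]])
  next
    case (Suc m)
    then show ?thesis unfolding H1_def using prC_he[OF bmu'_A_chains] x by (simp add: be_simps)
  qed
  have y: "x - (\<tau> ^^ n) x \<in> A_chains p (Suc n)" by (intro A_chains_lin tau_pow_A_chains x)
  have "H1 (be A (he A x)) = H1 (x - (\<tau> ^^ n) x) - (H1 (he A (bdelta n x)) + H1 (he A (bmu' n x)))"
    unfolding be_he[OF cx] he_simps lin_simps[OF lin_H1[OF lin_id]] ..
  also have "\<dots> = tscale ?h (he A (sg E n (x - (\<tau> ^^ n) x)))"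
    unfolding 2 3 unfolding H1_def prC_A[OF y] SG_E[OF A_chains_chains[OF y]] by simp
  finally have 4: "H1 (be A (he A x)) = tscale ?h (he A (sg E n (x - (\<tau> ^^ n) x)))" .
  have 5: "Be A (H0 (he A x)) = tscale ?h (he A (cnorm n (E 0 x)))"
    unfolding H0_def mu_0_E_he[OF cx] be_simps Be_A[OF E_A_chains[OF x]] ..
  have 6: "H0 (Be A (he A x)) = 0"
    unfolding Be_he[OF x] lin_0[OF lin_H0[OF lin_id]] ..
  have "Ldeg n x = sg E n (x - (\<tau> ^^ n) x) + cnorm n (E 0 x)"
    unfolding sg_right[OF cx] Ldeg_def ..
  then show ?thesis
    unfolding left 1 4 5 6 be_simps by (simp only: he_simps TS.scale_right_distrib add_0_left
        add_0_right)
qed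

text \<open>B and H1 both map C(A) to C^+(A) and kill C^+(A), so their products vanish.\<close>

lemma Be_H1:
  assumes x: "x \<in> A_chains p (Suc n)"
  shows "Be A (H1 x) = 0" "H1 (Be A x) = 0" "H1 (he A x) = 0"
proof -
  note cx = A_chains_chains[OF x]
  show "Be A (H1 x) = 0"
    unfolding H1_def prC_A[OF x] SG_E[OF cx] be_simps Be_he[OF sg_E_A_chains[OF x]] by simp
  have 1: "H1 (he A y) = 0" if "y \<in> A_chains p (Suc n)" for y
    unfolding H1_def prC_he[OF that] be_simps by simp
  show "H1 (he A x) = 0" by (rule 1[OF x])
  show "H1 (Be A x) = 0" unfolding Be_A[OF x] by (rule 1[OF norm_A_chains[OF x]])
qed

text \<open>The internal differential raises the total degree by 1 and keeps n; the products keep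
  the degree and lower n by 1. Either way the eigenvalue of \<Gamma>' grows by 1.\<close>

lemma Gamma'_be:
  assumes x: "x \<in> chains (Suc n)"
  shows "Gamma' A D (be A x) - be A (Gamma' A D x) = be A x"
proof -
  note bx = bdelta_chains[OF x]
  have 1: "Gamma' A D (bdelta n x) = bdelta n (Gamma' A D x) + bdelta n x"
    unfolding Gamma'_chains[OF bx] Gamma'_chains[OF x] Ldeg_bdelta[OF x] b_simps
        by (simp add: algebra_simps)
  have 2: "Gamma' A D (bmu n x) = bmu n (Gamma' A D x) + bmu n x"
  proof (cases n)
    case 0
    have "Gamma' A D x \<in> chains (Suc 0)"
      using x 0 unfolding Gamma'_chains[OF x] by (auto intro!: chains_lin Ldeg_chains)
    then show ?thesis using x 0 by (simp add: bmu_0 lin_0[OF lin_Gamma'[OF lin_id]])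
  next
    case (Suc m)
    then have x': "x \<in> chains (Suc (Suc m))" using x by simp
    show ?thesis unfolding Suc Gamma'_chains[OF bmu_chains[OF x']] Gamma'_chains[OF x']
        Ldeg_bmu[OF x'] b_simps
      by (simp add: TS.scale_left_distrib)
  qed
  have cG: "Gamma' A D x \<in> chains (Suc n)"
    unfolding Gamma'_chains[OF x] by (intro chains_lin Ldeg_chains x)
  show ?thesis
    unfolding be_chains[OF x] be_chains[OF cG] linD[OF lin_Gamma'[OF lin_id]] 1 2 by simp
qed

lemma Gamma'_A_chains: "x \<in> A_chains p (Suc n) \<Longrightarrow> Gamma' A D x \<in> A_chains p (Suc n)"
  unfolding Gamma'_chains[OF A_chains_chains] by (intro A_chains_lin Ldeg_A_chains)

lemma Gamma'_he: "x \<in> chains (Suc n) \<Longrightarrow> Gamma' A D (he A x) = he A (Gamma' A D x) - he A x"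
  unfolding Gamma'_chains[OF he_chains] Gamma'_chains Ldeg_he he_simps
  by (simp add: TS.scale_left_distrib)

lemma Gamma'_norm: "x \<in> chains (Suc n) \<Longrightarrow> Gamma' A D (cnorm n x) = cnorm n (Gamma' A D x)"
  unfolding Gamma'_chains[OF norm_chains] Gamma'_chains Ldeg_norm b_simps2 ..

text \<open>N preserves the total degree and the length; e has degree 0 but makes the word longer by
  one letter, so the eigenvalue drops by 1.\<close>

lemma Gamma'_Be_A:
  assumes x: "x \<in> A_chains p (Suc n)"
  shows "Gamma' A D (Be A x) - Be A (Gamma' A D x) = - Be A x"
proof -
  note cx = A_chains_chains[OF x]
  show ?thesis
    unfolding Be_A[OF x] Be_A[OF Gamma'_A_chains[OF x]] Gamma'_he[OF norm_chains[OF cx]]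
        Gamma'_norm[OF cx]
    by simp
qed

lemma Gamma'_Be_e:
  assumes x: "x \<in> A_chains p (Suc n)"
  shows "Gamma' A D (Be A (he A x)) - Be A (Gamma' A D (he A x)) = - Be A (he A x)"
  unfolding Be_he[OF x] Gamma'_he[OF A_chains_chains[OF x]] be_simps Be_he[OF Gamma'_A_chains[OF x]]
  by (simp add: lin_0[OF lin_Gamma'[OF lin_id]])

lemma parity_H0: "linear_on tscale (Ce A) H0" "has_parity (Ce_par A) 1 H0"
proof -
  have A_part: "H0 x \<in> Ce_par A (p + 1 + 1)" if x: "x \<in> A_chains p (Suc n)" for x p n
  proof (cases n)
    case 0
    then have "E 1 x \<in> chains 1" using E_chains[OF A_chains_chains[OF x]] by simp
    then have "H0 x = 0" by (simp add: H0_def mu_chains_1)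
    then show ?thesis by (simp add: Ce_par_gens TS.span_zero)
  next
    case (Suc m)
    have "\<mu> 0 (E 1 x) \<in> A_chains (p + 1) (Suc m)"
      by (rule mu_A_chains[OF E_A_chains]) (use x Suc in auto)
    from A_chains_Ce_par[OF this] show ?thesis
      unfolding H0_def Ce_par_gens by (rule TS.span_scale)
  qed
  have e_part: "H0 (he A x) \<in> Ce_par A (p + 1)" if x: "x \<in> A_chains p (Suc n)" for x p n
    using A_chains_Ce_par[OF E_A_chains[OF x]]
        unfolding H0_def mu_0_E_he[OF A_chains_chains[OF x]] Ce_par_gens
    by (rule TS.span_scale)
  show "linear_on tscale (Ce A) H0" "has_parity (Ce_par A) 1 H0"
    by (rule parity_on_Ce[where q = 1 and X = H0]; (rule lin_H0[OF lin_id] | erule A_part | erule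
        e_part))+
qed

lemma parity_H1: "linear_on tscale (Ce A) H1" "has_parity (Ce_par A) 1 H1"
proof -
  have A_part: "H1 x \<in> Ce_par A (p + 1 + 1)" if x: "x \<in> A_chains p (Suc n)" for x p n
    using he_A_chains_Ce_par[OF sg_E_A_chains[OF x]]
    unfolding H1_def prC_A[OF x] SG_E[OF A_chains_chains[OF x]] bit_add_1_1 Ce_par_gens
        by (rule TS.span_scale)
  have e_part: "H1 (he A x) \<in> Ce_par A (p + 1)" if x: "x \<in> A_chains p (Suc n)" for x p n
    unfolding Be_H1(3)[OF x] Ce_par_gens by (rule TS.span_zero)
  show "linear_on tscale (Ce A) H1" "has_parity (Ce_par A) 1 H1"
    by (rule parity_on_Ce[where q = 1 and X = H1]; (rule lin_H1[OF lin_id] | erule A_part | erule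
        e_part))+
qed

lemma parity_Gamma': "linear_on tscale (Ce A) (Gamma' A D)" "has_parity (Ce_par A) 0 (Gamma' A D)"
proof -
  have A_part: "Gamma' A D x \<in> Ce_par A (p + 1 + 0)" if x: "x \<in> A_chains p (Suc n)" for x p n
    using A_chains_Ce_par[OF Gamma'_A_chains[OF x]] unfolding add_0_right .
  have e_part: "Gamma' A D (he A x) \<in> Ce_par A (p + 0)" if x: "x \<in> A_chains p (Suc n)" for x p n
    using he_A_chains_Ce_par[OF x] he_A_chains_Ce_par[OF Gamma'_A_chains[OF x]]
    unfolding Gamma'_he[OF A_chains_chains[OF x]] add_0_right Ce_par_gens
        by (rule TS.span_diff[rotated])
  show "linear_on tscale (Ce A) (Gamma' A D)" "has_parity (Ce_par A) 0 (Gamma' A D)"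
    by (rule parity_on_Ce[where q = 0 and X = "Gamma' A D"];
        (rule lin_Gamma'[OF lin_id] | erule A_part | erule e_part))+
qed

lemma nabla_connections:
  assumes two: "(2 :: 'k) \<noteq> 0"
  shows "u_connection tscale (Ce A) (Ce_par A) (be A) (Be A) (nabla A)"
    "u_connection tscale (Ce A) (Ce_par A) (be A) (Be A) (nabla_gr A D)"
    "equal_up_to_u_homotopy tscale (Ce A) (Ce_par A) (be A) (Be A) (nabla A) (nabla_gr A D)"
proof -
  have hU: "UU A x = be A (H0 x) + H0 (be A x)" if "x \<in> Ce A" for x
  proof (rule eq_on_Ce[OF lin_UU[OF lin_id] lin_add[OF lin_be[OF lin_H0[OF lin_id]] lin_H0[OF
      lin_be[OF lin_id]]] _ _ that])
    fix p n y assume y: "y \<in> A_chains p (Suc n)"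
    show "UU A y = be A (H0 y) + H0 (be A y)"
      by (rule homotopy_U[OF A_chains_chains[OF y]]) (simp add: prC_A[OF y] prplus_A[OF y])
    show "UU A (he A y) = be A (H0 (he A y)) + H0 (be A (he A y))"
      by (rule homotopy_U[OF he_chains[OF A_chains_chains[OF y]]]) (simp add: prC_he[OF y]
          prplus_he[OF y])
  qed
  have hV: "(VV A x + Gamma A x) - tscale (1 / 2) (Gamma' A D x) =
      be A (H1 x) + H1 (be A x) + (Be A (H0 x) + H0 (Be A x))" if "x \<in> Ce A" for x
    by (rule eq_on_Ce[where X = "\<lambda>x. (VV A x + Gamma A x) - tscale (1 / 2) (Gamma' A D x)"
          and Y = "\<lambda>x. be A (H1 x) + H1 (be A x) + (Be A (H0 x) +
              H0 (Be A x))", OF _ _ homotopy_V_A homotopy_V_e that])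
      (intro lin_intros lin_VV lin_Gamma lin_Gamma' lin_be lin_Be lin_H0 lin_H1 | assumption)+
  have hB: "Be A (H1 x) + H1 (Be A x) = 0" if "x \<in> Ce A" for x
  proof (rule eq_on_Ce[OF lin_add[OF lin_Be[OF lin_H1[OF lin_id]] lin_H1[OF lin_Be[OF lin_id]]]
      lin_zero _ _ that])
    fix p n y assume y: "y \<in> A_chains p (Suc n)"
    show "Be A (H1 y) + H1 (Be A y) = 0" unfolding Be_H1[OF y] by simp
    show "Be A (H1 (he A y)) + H1 (Be A (he A y)) = 0"
      unfolding Be_H1(3)[OF y] Be_he[OF y] be_simps lin_0[OF lin_H1[OF lin_id]] by simp
  qed
  have gb: "Gamma' A D (be A x) - be A (Gamma' A D x) = be A x" if "x \<in> Ce A" for x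
  proof (rule eq_on_Ce[OF lin_diff[OF lin_Gamma'[OF lin_be[OF lin_id]] lin_be[OF lin_Gamma'[OF
      lin_id]]] lin_be[OF lin_id] _ _ that])
    fix p n y assume y: "y \<in> A_chains p (Suc n)"
    show "Gamma' A D (be A y) - be A (Gamma' A D y) = be A y"
      by (rule Gamma'_be[OF A_chains_chains[OF y]])
    show "Gamma' A D (be A (he A y)) - be A (Gamma' A D (he A y)) = be A (he A y)"
      by (rule Gamma'_be[OF he_chains[OF A_chains_chains[OF y]]])
  qed
  have gB: "Gamma' A D (Be A x) - Be A (Gamma' A D x) = - Be A x" if "x \<in> Ce A" for x
    by (rule eq_on_Ce[OF lin_diff[OF lin_Gamma'[OF lin_Be[OF lin_id]] lin_Be[OF lin_Gamma'[OF
        lin_id]]]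
          lin_uminus[OF lin_Be[OF lin_id]] Gamma'_Be_A Gamma'_Be_e that])
  have V0: "VV A 0 + Gamma A 0 = 0"
    unfolding lin_0[OF lin_VV[OF lin_id]] lin_0[OF lin_Gamma[OF lin_id]] by simp
  have nabla: "nabla A = (\<lambda>x. d_du tscale x + fls_smul tscale (1 / fls_X\<^sup>2) (fls_map (UU A) x)
      + fls_smul tscale (1 / fls_X) (fls_map (\<lambda>y. VV A y + Gamma A y) x))"
    and nabla_gr: "nabla_gr A D = (\<lambda>x. d_du tscale x +
        fls_smul tscale (1 / (2 * fls_X)) (fls_map (Gamma' A D) x))"
    by (rule ext, simp only: nabla_def nabla_gr_def)+
  note * = equal_up_to_u_homotopyI[where s = tscale and U = "UU A" and V = "\<lambda>y. VV A y + Gamma A y",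
      OF two mixed_complex_Ce parity_Gamma' parity_H0 parity_H1 lin_0[OF lin_UU[OF lin_id]] V0 gb
          gB hU hV hB,
      folded nabla nabla_gr]
  show "u_connection tscale (Ce A) (Ce_par A) (be A) (Be A) (nabla A)"
    "u_connection tscale (Ce A) (Ce_par A) (be A) (Be A) (nabla_gr A D)"
    "equal_up_to_u_homotopy tscale (Ce A) (Ce_par A) (be A) (Be A) (nabla A) (nabla_gr A D)"
    by (rule *; assumption)+
qed

end

theorem proposition3p8:
  fixes A :: "('a::ring, 'k::field) dga_data"
    and D :: "int \<Rightarrow> 'a set"
  assumes "CHAR('k) \<noteq> 2"
    and "dg_algebra A"
    and "Z_grading_lift A D"
  shows "mixed_complex tscale (Ce A) (Ce_par A) (be A) (Be A) \<and>
    u_connection tscale (Ce A) (Ce_par A) (be A) (Be A) (nabla A) \<and>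
    u_connection tscale (Ce A) (Ce_par A) (be A) (Be A) (nabla_gr A D) \<and>
    equal_up_to_u_homotopy tscale (Ce A) (Ce_par A) (be A) (Be A) (nabla A) (nabla_gr A D)"
proof -
  interpret lifted_dga A D using assms by unfold_locales
  have "(2 :: 'k) \<noteq> 0"
  proof
    assume "(2 :: 'k) = 0"
    then have "CHAR('k) dvd 2" using of_nat_eq_0_iff_char_dvd[where ?'a = 'k, of 2] by simp
    \<comment> \<open>Characteristic 0 does not divide 2; characteristic 1, excluded next, would
      mean 1 = 0.\<close>
    then have "CHAR('k) = 1 \<or> CHAR('k) = 2" using dvd_imp_le[of "CHAR('k)" 2]
        by (cases "CHAR('k)") auto
    then show False using assms(1) of_nat_CHAR[where ?'a = 'k] by auto
  qed
  then show ?thesis using mixed_complex_Ce nabla_connections by blast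
qed

end
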